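(* Hitting Geodesic Intervals is fixed-parameter tractable parameterized by $k+\mathrm{mw}(G)$; that is, there is an algorithm that decides any instance $\langle G,T,k\rangle$ in time $f(k+\mathrm{mw}(G))\cdot |I|^{O(1)}$ for some computable function $f$, where $|I|$ is the input size.
   Context: All graphs are finite, simple and undirected. For vertices $u,v$ of a graph $G$, the geodesic interval $I_G[u,v]$ is the set of vertices lying on at least one shortest $u$--$v$ path in $G$. Hitting Geodesic Intervals: given a graph $G=(V,E)$, a set $T$ of (unordered) pairs of vertices, and an integer $k$, decide whether there is $S\subseteq V$ with $|S|\le k$ such that $S\cap I_G[u,v]\neq\emptyset$ for every $\{u,v\}\in T$. A set $M\subseteq V$ is a module of $G$ if $N_G(u)\setminus M=N_G(v)\setminus M$ for all $u,v\in M$. The modular-width $\mathrm{mw}(G)$ is the minimum integer $\mu$ such that either $|V|\le\mu$, or $V$ can be partitioned into modules $M_1,\dots,M_{\mu'}$ of $G$ with $2\le\mu'\le\mu$ and $\mathrm{mw}(G[M_i])\le\mu$ for each $i$. *)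

theory Defs
  imports Main "HOL-Library.Disjoint_Sets" "HOL-Library.Log_Nat"
begin

section \<open>Machine model\<close>

text \<open>
  Algorithms are programs of a first-order, call-by-value functional language over natural
  numbers and immutable cells (pure Lisp without symbols).  Every evaluation step has cost 1.
  The only arithmetic is addition and truncated subtraction, so after \<open>t\<close> steps every number
  has at most \<open>t\<close> more bits than the largest number in the input or the program; cells are
  shared and can only be built, tested and taken apart one at a time.  Hence, as for the
  unit-cost RAM with addition and subtraction, running time agrees with that of Turing machines
  up to a polynomial.
\<close>

datatype val = N nat | Cell val val

text \<open>
  Variables are positions in the environment: the arguments of a call are positions
  \<open>0, 1, \<dots>\<close>, and \<open>LetIn\<close> pushes one more value at position \<open>0\<close>.
  A program is a list of function bodies; \<open>Call f\<close> refers to its \<open>f\<close>-th entry.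
\<close>

datatype expr =
    Var nat
  | Lit nat
  | Add expr expr
  | Sub expr expr
  | MkCell expr expr
  | Fst expr
  | Snd expr
  | IsCell expr
  | IfNonzero expr expr expr
  | LetIn expr expr
  | Call nat "expr list"

type_synonym prog = "expr list"

text \<open>
  \<open>eval P env e v t\<close>: in environment \<open>env\<close> the expression \<open>e\<close> evaluates to \<open>v\<close> at cost \<open>t\<close>.
  Diverging and ill-typed expressions have no value.
\<close>

inductive eval :: "prog \<Rightarrow> val list \<Rightarrow> expr \<Rightarrow> val \<Rightarrow> nat \<Rightarrow> bool"
  and eval_args :: "prog \<Rightarrow> val list \<Rightarrow> expr list \<Rightarrow> val list \<Rightarrow> nat \<Rightarrow> bool"
  for P :: prog
where
  Var: "i < length env \<Longrightarrow> eval P env (Var i) (env ! i) 1"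
| Lit: "eval P env (Lit n) (N n) 1"
| Add: "eval P env a (N m) s \<Longrightarrow> eval P env b (N n) t \<Longrightarrow>
    eval P env (Add a b) (N (m + n)) (s + t + 1)"
| Sub: "eval P env a (N m) s \<Longrightarrow> eval P env b (N n) t \<Longrightarrow>
    eval P env (Sub a b) (N (m - n)) (s + t + 1)"
| MkCell: "eval P env a v s \<Longrightarrow> eval P env b w t \<Longrightarrow>
    eval P env (MkCell a b) (Cell v w) (s + t + 1)"
| Fst: "eval P env a (Cell v w) t \<Longrightarrow> eval P env (Fst a) v (t + 1)"
| Snd: "eval P env a (Cell v w) t \<Longrightarrow> eval P env (Snd a) w (t + 1)"
| IsCell_True: "eval P env a (Cell v w) t \<Longrightarrow> eval P env (IsCell a) (N 1) (t + 1)"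
| IsCell_False: "eval P env a (N n) t \<Longrightarrow> eval P env (IsCell a) (N 0) (t + 1)"
| If_True: "eval P env a (N n) s \<Longrightarrow> n \<noteq> 0 \<Longrightarrow> eval P env b v t \<Longrightarrow>
    eval P env (IfNonzero a b c) v (s + t + 1)"
| If_False: "eval P env a (N 0) s \<Longrightarrow> eval P env c v t \<Longrightarrow>
    eval P env (IfNonzero a b c) v (s + t + 1)"
| LetIn: "eval P env a v s \<Longrightarrow> eval P (v # env) b w t \<Longrightarrow>
    eval P env (LetIn a b) w (s + t + 1)"
| Call: "f < length P \<Longrightarrow> eval_args P env as vs s \<Longrightarrow> eval P vs (P ! f) v t \<Longrightarrow>
    eval P env (Call f as) v (s + t + 1)"
| Args_Nil: "eval_args P env [] [] 0"
| Args_Cons: "eval P env a v s \<Longrightarrow> eval_args P env as vs t \<Longrightarrow>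
    eval_args P env (a # as) (v # vs) (s + t)"

inductive_cases eval_elims:
  "eval P env (Var i) v t" "eval P env (Lit n) v t"
  "eval P env (Add a b) v t" "eval P env (Sub a b) v t"
  "eval P env (MkCell a b) v t" "eval P env (Fst a) v t" "eval P env (Snd a) v t"
  "eval P env (IsCell a) v t" "eval P env (IfNonzero a b c) v t"
  "eval P env (LetIn a b) v t" "eval P env (Call f as) v t"
  "eval_args P env [] vs t" "eval_args P env (a # as) vs t"

lemma eval_deterministic:
  "eval P env e v t \<Longrightarrow> eval P env e v' t' \<Longrightarrow> v' = v \<and> t' = t"
  "eval_args P env es vs t \<Longrightarrow> eval_args P env es vs' t' \<Longrightarrow> vs' = vs \<and> t' = t"
proof (induction arbitrary: v' t' and vs' t' rule: eval_eval_args.inducts)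
  case (Var i env)
  from Var.prems show ?case
    by (rule eval_elims) simp_all
next
  case (Lit env n)
  from Lit.prems show ?case
    by (rule eval_elims) simp_all
next
  case (Add env a m s b n t)
  from Add.prems show ?case
    by (rule eval_elims) (auto dest!: Add.IH(2,4))
next
  case (Sub env a m s b n t)
  from Sub.prems show ?case
    by (rule eval_elims) (auto dest!: Sub.IH(2,4))
next
  case (MkCell env a v s b w t)
  from MkCell.prems show ?case
    by (rule eval_elims) (auto dest!: MkCell.IH(2,4))
next
  case (Fst env a v w t)
  from Fst.prems show ?case
    by (rule eval_elims) (auto dest!: Fst.IH(2))
next
  case (Snd env a v w t)
  from Snd.prems show ?case
    by (rule eval_elims) (auto dest!: Snd.IH(2))
next
  case (IsCell_True env a v w t)
  from IsCell_True.prems show ?case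
    by (rule eval_elims) (auto dest!: IsCell_True.IH(2))
next
  case (IsCell_False env a n t)
  from IsCell_False.prems show ?case
    by (rule eval_elims) (auto dest!: IsCell_False.IH(2))
next
  case (If_True env a n s b v t c)
  from If_True.prems show ?case
    by (rule eval_elims) (auto simp: If_True.hyps dest!: If_True.IH(2,4))
next
  case (If_False env a s c v t b)
  from If_False.prems show ?case
    by (rule eval_elims) (auto dest!: If_False.IH(2,4))
next
  case (LetIn env a v s b w t)
  from LetIn.prems show ?case
    by (rule eval_elims) (auto dest!: LetIn.IH(2,4))
next
  case (Call f env as vs s v t)
  from Call.prems show ?case
    by (rule eval_elims) (auto dest!: Call.IH(3,5))
next
  case (Args_Nil env)
  from Args_Nil.prems show ?case
    by (rule eval_elims) simp_all
next
  case (Args_Cons env a v s as vs t)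
  from Args_Cons.prems show ?case
    by (rule eval_elims) (auto dest!: Args_Cons.IH(2,4))
qed

text \<open>\<open>runs P x y t\<close>: started on input \<open>x\<close>, program \<open>P\<close> halts with output \<open>y\<close> after \<open>t\<close> steps.\<close>

definition runs :: "prog \<Rightarrow> val \<Rightarrow> val \<Rightarrow> nat \<Rightarrow> bool" where
  "runs P x y t \<longleftrightarrow> eval P [x] (Call 0 [Var 0]) y t"

definition computable :: "(nat \<Rightarrow> nat) \<Rightarrow> bool" where
  "computable f \<longleftrightarrow> (\<exists>P. \<forall>n. \<exists>t. runs P (N n) (N (f n)) t)"

text \<open>Numbers are measured by their binary length.\<close>

fun val_size :: "val \<Rightarrow> nat" where
  "val_size (N n) = floorlog 2 n + 1"
| "val_size (Cell v w) = val_size v + val_size w + 1"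

text \<open>
  A parameterized decision problem is given by the relation \<open>enc\<close> between its instances and
  the inputs that represent them, the set of yes-instances, and the parameter \<open>\<kappa>\<close>.
  The parameter is not part of the input.
\<close>

definition fixed_parameter_tractable ::
    "('i \<Rightarrow> val \<Rightarrow> bool) \<Rightarrow> ('i \<Rightarrow> bool) \<Rightarrow> ('i \<Rightarrow> nat) \<Rightarrow> bool" where
  "fixed_parameter_tractable enc yes \<kappa> \<longleftrightarrow>
    (\<exists>P f c. computable f \<and>
      (\<forall>I x. enc I x \<longrightarrow>
        (\<exists>t \<le> f (\<kappa> I) * val_size x ^ c. runs P x (N (if yes I then 1 else 0)) t)))"


section \<open>Graphs\<close>

record 'a graph =
  verts :: "'a set"
  edges :: "'a set set"

definition simple_graph :: "'a graph \<Rightarrow> bool" where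
  "simple_graph G \<longleftrightarrow>
    finite (verts G) \<and> (\<forall>e\<in>edges G. e \<subseteq> verts G \<and> card e = 2)"

definition path :: "'a graph \<Rightarrow> 'a \<Rightarrow> 'a list \<Rightarrow> 'a \<Rightarrow> bool" where
  "path G u p v \<longleftrightarrow>
    p \<noteq> [] \<and> hd p = u \<and> last p = v \<and> distinct p \<and> set p \<subseteq> verts G \<and>
    successively (\<lambda>x y. {x, y} \<in> edges G) p"

definition shortest_path :: "'a graph \<Rightarrow> 'a \<Rightarrow> 'a list \<Rightarrow> 'a \<Rightarrow> bool" where
  "shortest_path G u p v \<longleftrightarrow> path G u p v \<and> (\<forall>q. path G u q v \<longrightarrow> length p \<le> length q)"

definition geodesic_interval :: "'a graph \<Rightarrow> 'a \<Rightarrow> 'a \<Rightarrow> 'a set" where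
  "geodesic_interval G u v = {w. \<exists>p. shortest_path G u p v \<and> w \<in> set p}"

definition neighborhood :: "'a graph \<Rightarrow> 'a \<Rightarrow> 'a set" where
  "neighborhood G u = {v. {u, v} \<in> edges G}"

definition graph_module :: "'a graph \<Rightarrow> 'a set \<Rightarrow> bool" where
  "graph_module G M \<longleftrightarrow>
    M \<subseteq> verts G \<and> (\<forall>u\<in>M. \<forall>v\<in>M. neighborhood G u - M = neighborhood G v - M)"

definition induced_subgraph :: "'a graph \<Rightarrow> 'a set \<Rightarrow> 'a graph" where
  "induced_subgraph G M = \<lparr>verts = M, edges = {e \<in> edges G. e \<subseteq> M}\<rparr>"

lemma disj_fundef_cong:
  "P = P' \<Longrightarrow> (\<not> P' \<Longrightarrow> Q = Q') \<Longrightarrow> (P \<or> Q) = (P' \<or> Q')"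
  by blast

context
  notes conj_cong [fundef_cong] and disj_fundef_cong [fundef_cong]
begin

function modular_width :: "'a graph \<Rightarrow> nat" where
  "modular_width G =
    (LEAST \<mu>. card (verts G) \<le> \<mu> \<or>
      (\<exists>Ms. partition_on (verts G) Ms \<and> (\<forall>M\<in>Ms. graph_module G M) \<and>
        2 \<le> card Ms \<and> card Ms \<le> \<mu> \<and>
        (\<forall>M\<in>Ms. modular_width (induced_subgraph G M) \<le> \<mu>)))"
  by pat_completeness auto

termination
proof (relation "measure (\<lambda>G. card (verts G))", goal_cases)
  case (2 G \<mu> Ms M)
  then have fin: "finite (verts G)"
    by (metis card.infinite le0)
  then have "finite Ms"
    using 2 by (metis card.infinite not_numeral_le_zero)
  have "Ms \<noteq> {M}"
    using 2 by auto
  then obtain M' where M': "M' \<in> Ms" "M' \<noteq> M"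
    using 2 by blast
  then have "M \<inter> M' = {}" "M' \<noteq> {}" "M' \<subseteq> verts G" "M \<subseteq> verts G"
    using 2 by (auto simp: partition_on_def disjoint_def)
  then have "M \<subset> verts G"
    by blast
  then show ?case
    using fin by (simp add: induced_subgraph_def psubset_card_mono)
qed simp

end

declare modular_width.simps [simp del]


section \<open>Hitting Geodesic Intervals\<close>

text \<open>
  Pairs are sets \<open>{u, v}\<close> of vertices; \<open>u = v\<close> is allowed in \<open>T\<close>.
\<close>

type_synonym hgi_inst = "nat graph \<times> nat set set \<times> nat"

definition hgi_instance :: "hgi_inst \<Rightarrow> bool" where
  "hgi_instance = (\<lambda>(G, T, k).
    simple_graph G \<and> (\<forall>e\<in>T. \<exists>u\<in>verts G. \<exists>v\<in>verts G. e = {u, v}))"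

definition hgi_yes :: "hgi_inst \<Rightarrow> bool" where
  "hgi_yes = (\<lambda>(G, T, k).
    \<exists>S \<subseteq> verts G. card S \<le> k \<and>
      (\<forall>u v. {u, v} \<in> T \<longrightarrow> S \<inter> geodesic_interval G u v \<noteq> {}))"

fun enc_list :: "val list \<Rightarrow> val" where
  "enc_list [] = N 0"
| "enc_list (v # vs) = Cell v (enc_list vs)"

definition enc_pairs :: "(nat \<times> nat) list \<Rightarrow> val" where
  "enc_pairs ps = enc_list (map (\<lambda>(u, v). Cell (N u) (N v)) ps)"

definition lists_pairs :: "(nat \<times> nat) list \<Rightarrow> nat set set \<Rightarrow> bool" where
  "lists_pairs ps A \<longleftrightarrow>
    distinct (map (\<lambda>(u, v). {u, v}) ps) \<and> set (map (\<lambda>(u, v). {u, v}) ps) = A"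

text \<open>
  The input lists the vertices, the edges and the pairs of \<open>T\<close>, each exactly once but in
  arbitrary order and with arbitrary orientation, followed by \<open>k\<close>.
\<close>

definition hgi_encodes :: "hgi_inst \<Rightarrow> val \<Rightarrow> bool" where
  "hgi_encodes = (\<lambda>(G, T, k) x.
    hgi_instance (G, T, k) \<and>
    (\<exists>vs es ts. distinct vs \<and> set vs = verts G \<and> lists_pairs es (edges G) \<and> lists_pairs ts T \<and>
      x = enc_list [enc_list (map N vs), enc_pairs es, enc_pairs ts, N k]))"

end

theory Submission
  imports Defs
begin

text \<open>
  Partition the vertex set into modules such that every part is a single vertex or has neighbours,
  and no union of several parts is a module with neighbours.  Then the parts inside one component
  form a quotient without nontrivial modules, so there are at most \<open>modular_width G\<close> of them.

  Call a pair inner if its vertices are distinct, non-adjacent and in the same part \<open>c\<close>.  The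
  interval of an inner pair contains the whole neighbourhood of \<open>c\<close> and lies in \<open>c\<close> together with
  this neighbourhood; the interval of any other pair consists of its ends and of whole parts.  If a
  hitting set contains two vertices of \<open>c\<close>, one of which is not needed as an end of a non-inner
  pair, then that vertex can be deleted or moved to the neighbourhood of \<open>c\<close>.  Hence some optimal
  hitting set has, in each part, at most one vertex or only vertices forced as ends of non-inner
  pairs.  It can be found by a bounded search that, for an unhit pair, guesses an end of the pair, a
  part in the interior of its interval, or that the pair is hit from inside its own part: this gives
  at most \<open>modular_width G + 2\<close> branches and depth at most \<open>3 * k\<close>.  A part that is only known to be
  met gets one representative, chosen to hit all inner pairs of this part whenever a single vertex
  can do so.
\<close>

section \<open>Geodesic intervals described by distances, and distances by balls\<close>

section \<open>Distances and geodesic intervals\<close>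

text \<open>The recursion in modular width is never followed: one level of modules is enough,
  because a common neighbour forces the ends of an inner pair to distance two, and the inside of a
  part then matters only through forced ends or one representative. Modules overlap (in a complete
  graph every vertex set is one), so there is no canonical partition to aim for; the condition on
  unions of parts is what a greedy construction can reach. The number of parts is bounded per
  component only: isolated vertices all form parts of their own, although an edgeless graph has
  small width. This does no harm, since intervals stay in a component. The depth
  \<open>3 * k\<close> arises because a vertex of the hitting set accounts for at most three true
  guesses: itself, its part, and its part with missed neighbourhood. The search costs only about
  \<open>m ^ m\<close> up to constants in the exponent; the larger bound
  \<open>2 ^ 2 ^ (m + 8)\<close> is taken because it can be computed by doubling alone.\<close>

locale fin_graph =
  fixes G :: "'a graph"
  assumes simple: "simple_graph G"
begin

abbreviation "V \<equiv> verts G"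

definition adj :: "'a \<Rightarrow> 'a \<Rightarrow> bool" where
  "adj x y \<longleftrightarrow> {x, y} \<in> edges G"

lemma finite_V: "finite V"
  using simple by (simp add: simple_graph_def)

lemma adj_sym: "adj x y \<longleftrightarrow> adj y x"
  by (simp add: adj_def insert_commute)

lemma adj_irrefl: "\<not> adj x x"
  using simple by (auto simp: adj_def simple_graph_def)

lemma adj_V: "adj x y \<Longrightarrow> x \<in> V \<and> y \<in> V"
  using simple unfolding adj_def simple_graph_def by blast

text \<open>Staying put counts as a step, so balls grow monotonically and walks may repeat vertices;
  concatenation (\<open>ball_trans\<close>) then needs no surgery on paths. The program runs the
  same recursion on lists.\<close>

primrec ball :: "'a \<Rightarrow> nat \<Rightarrow> 'a set" where
  "ball u 0 = {u}"
| "ball u (Suc i) = {w \<in> V. \<exists>x\<in>ball u i. x = w \<or> adj x w}"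

lemma ball_V: "u \<in> V \<Longrightarrow> ball u i \<subseteq> V"
  by (cases i) auto

lemma ball_Suc_mono: "u \<in> V \<Longrightarrow> ball u i \<subseteq> ball u (Suc i)"
  using ball_V by fastforce

lemma ball_mono: "u \<in> V \<Longrightarrow> i \<le> j \<Longrightarrow> ball u i \<subseteq> ball u j"
  using lift_Suc_mono_le[of "ball u"] ball_Suc_mono by blast

lemma ball_trans: "u \<in> V \<Longrightarrow> w \<in> ball u i \<Longrightarrow> v \<in> ball w j \<Longrightarrow> v \<in> ball u (i + j)"
  by (induction j arbitrary: v) auto

lemma adj_ball: "adj x w \<Longrightarrow> w \<in> ball x (Suc 0)"
  using adj_V by auto

lemma ball_sym: "u \<in> V \<Longrightarrow> v \<in> ball u i \<Longrightarrow> u \<in> ball v i"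
proof (induction i arbitrary: v)
  case (Suc i)
  then obtain x where x: "x \<in> ball u i" "x = v \<or> adj x v" and v: "v \<in> V"
    by auto
  have "x \<in> ball v (Suc 0)"
    using x v adj_sym adj_ball by auto
  then have "u \<in> ball v (Suc 0 + i)"
    using ball_trans v Suc.IH x Suc.prems(1) by blast
  then show ?case by simp
qed simp

definition reach :: "'a \<Rightarrow> 'a \<Rightarrow> bool" where
  "reach u v \<longleftrightarrow> (\<exists>i. v \<in> ball u i)"

text \<open>Without reachability \<open>LEAST\<close> gives an unspecified value, which is why
  \<open>reach\<close> accompanies most statements about \<open>dst\<close>.\<close>

definition dst :: "'a \<Rightarrow> 'a \<Rightarrow> nat" where
  "dst u v = (LEAST i. v \<in> ball u i)"

lemma reach_dst: "reach u v \<Longrightarrow> v \<in> ball u (dst u v)"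
  unfolding reach_def dst_def by (rule LeastI_ex)

lemma dst_le: "v \<in> ball u i \<Longrightarrow> dst u v \<le> i"
  unfolding dst_def by (rule Least_le)

lemma in_ball_iff: "u \<in> V \<Longrightarrow> v \<in> ball u i \<longleftrightarrow> reach u v \<and> dst u v \<le> i"
  using reach_dst dst_le ball_mono unfolding reach_def by blast

lemma reach_refl: "reach u u"
  unfolding reach_def by (rule exI[of _ 0]) simp

lemma reach_trans: "u \<in> V \<Longrightarrow> reach u w \<Longrightarrow> reach w v \<Longrightarrow> reach u v"
  using ball_trans unfolding reach_def by blast

lemma reach_sym: "u \<in> V \<Longrightarrow> reach u v \<Longrightarrow> reach v u"
  using ball_sym unfolding reach_def by blast

lemma reach_V: "u \<in> V \<Longrightarrow> reach u v \<Longrightarrow> v \<in> V"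
  using ball_V unfolding reach_def by blast

lemma reach_adj: "adj u v \<Longrightarrow> reach u v"
  using adj_ball unfolding reach_def by blast

lemma dst_sym: "u \<in> V \<Longrightarrow> v \<in> V \<Longrightarrow> dst u v = dst v u"
  unfolding dst_def using ball_sym by metis

lemma dst_triangle: "u \<in> V \<Longrightarrow> reach u w \<Longrightarrow> reach w v \<Longrightarrow> dst u v \<le> dst u w + dst w v"
  using ball_trans reach_dst dst_le by blast

lemma dst_self: "dst u u = 0"
  using dst_le[of u u 0] by simp

lemma dst_eq_0: "reach u v \<Longrightarrow> dst u v = 0 \<longleftrightarrow> u = v"
  using reach_dst[of u v] dst_self by auto

lemma dst_eq_1: "u \<in> V \<Longrightarrow> reach u v \<Longrightarrow> dst u v = Suc 0 \<longleftrightarrow> adj u v"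
  using reach_dst[of u v] dst_eq_0[of u v] dst_le[OF adj_ball, of u v] adj_irrefl[of u]
  by (auto simp: le_Suc_eq)

lemma path_nth_ball:
  assumes "path G u p v" "i \<le> j" "j < length p"
  shows "p ! j \<in> ball (p ! i) (j - i)"
  using assms(2,3)
proof (induction j rule: dec_induct)
  case (step j)
  have "{p ! j, p ! Suc j} \<in> edges G"
    using assms(1) step.prems by (auto simp: path_def successively_conv_nth)
  moreover have "p ! Suc j \<in> V"
    using assms(1) step.prems by (auto simp: path_def)
  ultimately show ?case
    using step by (auto simp: Suc_diff_le adj_def)
qed simp

lemma path_ends:
  assumes "path G u p v"
  shows "p \<noteq> []" "p ! 0 = u" "p ! (length p - 1) = v" "u \<in> V" "v \<in> V"
  using assms by (auto simp: path_def hd_conv_nth last_conv_nth)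

lemma path_reach: "path G u p v \<Longrightarrow> reach u v \<and> Suc (dst u v) \<le> length p"
  using path_nth_ball[of u p v 0 "length p - 1"] path_ends[of u p v] dst_le[of v u "length p - 1"]
  unfolding reach_def by (cases p) auto

text \<open>A new end that already lies on the path found so far is not appended; the path is cut
  there instead, which keeps it free of repetitions.\<close>

lemma ball_path:
  assumes "u \<in> V" "v \<in> ball u i"
  shows "\<exists>p. path G u p v \<and> length p \<le> Suc i"
  using assms(2)
proof (induction i arbitrary: v)
  case 0
  then show ?case
    using assms(1) by (intro exI[of _ "[u]"]) (auto simp: path_def)
next
  case (Suc i)
  then obtain x where x: "x \<in> ball u i" "x = v \<or> adj x v" and v: "v \<in> V"
    by auto
  from Suc.IH[OF x(1)] obtain p where p: "path G u p x" "length p \<le> Suc i"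
    by blast
  show ?case
  proof (cases "v \<in> set p")
    case True
    then obtain ys zs where "p = ys @ v # zs"
      by (auto simp: in_set_conv_decomp)
    then have "path G u (ys @ [v]) v"
      using p(1) by (auto simp: path_def successively_append_iff hd_append split: if_splits)
    then show ?thesis
      using \<open>p = _\<close> p(2) by (intro exI[of _ "ys @ [v]"]) auto
  next
    case False
    then have "adj x v"
      using x p(1) by (auto simp: path_def)
    then have "path G u (p @ [v]) v"
      using p(1) False v by (auto simp: path_def successively_append_iff adj_def)
    then show ?thesis
      using p(2) by (intro exI[of _ "p @ [v]"]) auto
  qed
qed

lemma reach_path:
  assumes "u \<in> V" "reach u v"
  obtains p where "path G u p v" "length p = Suc (dst u v)"
  using ball_path[OF assms(1) reach_dst[OF assms(2)]] path_reach by (metis le_antisym)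

lemma shortest_path_iff: "shortest_path G u p v \<longleftrightarrow> path G u p v \<and> length p = Suc (dst u v)"
proof
  assume "shortest_path G u p v"
  then have p: "path G u p v" "\<And>q. path G u q v \<Longrightarrow> length p \<le> length q"
    by (auto simp: shortest_path_def)
  then obtain q where "path G u q v" "length q = Suc (dst u v)"
    using path_ends path_reach reach_path by metis
  then show "path G u p v \<and> length p = Suc (dst u v)"
    using p path_reach by (metis le_antisym)
qed (auto simp: shortest_path_def dest: path_reach)

lemma dst_less_card:
  assumes "u \<in> V" "reach u v"
  shows "dst u v < card V"
proof -
  obtain p where p: "path G u p v" "length p = Suc (dst u v)"
    using reach_path assms by metis
  then have "length p \<le> card V"
    using finite_V by (metis path_def distinct_card card_mono)
  then show ?thesis using p by simp
qed

text \<open>A repeated vertex would let the walk skip the detour between the two occurrences and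
  reach \<open>v\<close> in fewer than \<open>dst u v\<close> steps. Hence shortest paths can be
  joined without checking that they are disjoint.\<close>

lemma walk_path:
  assumes "u \<in> V" "xs \<noteq> []" "hd xs = u" "last xs = v" "set xs \<subseteq> V"
    "successively (\<lambda>x y. {x, y} \<in> edges G) xs" "length xs = Suc (dst u v)"
  shows "path G u xs v"
proof -
  have *: "xs ! j \<in> ball (xs ! i) (j - i)" if "i \<le> j" "j < length xs" for i j
    using that
  proof (induction j rule: dec_induct)
    case (step j)
    have "{xs ! j, xs ! Suc j} \<in> edges G"
      using assms(6) step.prems by (auto simp: successively_conv_nth)
    moreover have "xs ! Suc j \<in> V"
      using assms(5) step.prems by auto
    ultimately show ?case
      using step by (auto simp: Suc_diff_le adj_def)
  qed simp
  have "xs ! i \<noteq> xs ! j" if "i < j" "j < length xs" for i j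
  proof
    assume eq: "xs ! i = xs ! j"
    let ?d = "length xs - 1"
    have "xs ! i \<in> ball u i" "v \<in> ball (xs ! j) (?d - j)"
      using *[of 0 i] *[of j ?d] that assms by (auto simp: hd_conv_nth last_conv_nth)
    then have "v \<in> ball u (i + (?d - j))"
      using ball_trans assms(1) eq by metis
    then have "dst u v \<le> i + (?d - j)"
      by (rule dst_le)
    then show False
      using that assms(7) by simp
  qed
  then have "distinct xs"
    unfolding distinct_conv_nth by (metis linorder_neqE_nat)
  then show ?thesis
    using assms by (simp add: path_def)
qed

text \<open>From here on intervals are handled by distances alone. In the backward direction two
  shortest paths are glued at \<open>w\<close>; their total length is \<open>dst u v\<close>, so
  \<open>walk_path\<close> applies.\<close>

lemma geodesic_interval_iff:
  assumes "u \<in> V"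
  shows "w \<in> geodesic_interval G u v \<longleftrightarrow>
    reach u w \<and> reach w v \<and> dst u w + dst w v = dst u v"
proof
  assume "w \<in> geodesic_interval G u v"
  then obtain p where p: "path G u p v" "length p = Suc (dst u v)" "w \<in> set p"
    by (auto simp: geodesic_interval_def shortest_path_iff)
  then obtain i where i: "i < length p" "w = p ! i"
    by (auto simp: in_set_conv_nth)
  have "w \<in> ball u i" "v \<in> ball w (length p - 1 - i)"
    using path_nth_ball[OF p(1), of 0 i] path_nth_ball[OF p(1), of i "length p - 1"] i
      path_ends[OF p(1)] by auto
  then have "reach u w" "reach w v" "dst u w \<le> i" "dst w v \<le> dst u v - i"
    using dst_le p(2) by (auto simp: reach_def)
  then show "reach u w \<and> reach w v \<and> dst u w + dst w v = dst u v"
    using dst_triangle[OF assms, of w v] i p(2) by force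
next
  assume *: "reach u w \<and> reach w v \<and> dst u w + dst w v = dst u v"
  then obtain p where p: "path G u p w" "length p = Suc (dst u w)"
    using reach_path assms by metis
  obtain q where q: "path G w q v" "length q = Suc (dst w v)"
    using * reach_path path_ends[OF p(1)] by metis
  have ne: "p \<noteq> []" "q \<noteq> []"
    using p q by auto
  then obtain r where r: "q = w # r"
    using q(1) by (cases q) (auto simp: path_def)
  have qr: "path G w (w # r) v"
    using q(1) r by simp
  have "path G u (p @ r) v"
  proof (rule walk_path)
    show "last (p @ r) = v"
      using p(1) qr by (cases r) (auto simp: path_def)
    show "successively (\<lambda>x y. {x, y} \<in> edges G) (p @ r)"
      using p(1) qr by (cases r) (auto simp: path_def successively_append_iff)
    show "set (p @ r) \<subseteq> V"
      using p(1) qr by (auto simp: path_def)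
    show "length (p @ r) = Suc (dst u v)"
      using p(2) q(2) r * by simp
  qed (use p q assms in \<open>auto simp: path_def\<close>)
  then have "shortest_path G u (p @ r) v"
    using p(2) q(2) r * by (simp add: shortest_path_iff)
  moreover have "w \<in> set (p @ r)"
    using p(1) by (auto simp: path_def)
  ultimately show "w \<in> geodesic_interval G u v"
    unfolding geodesic_interval_def by blast
qed

end

section \<open>Distances and intervals relative to a module\<close>

section \<open>Modules\<close>

context fin_graph
begin

definition nb :: "'a set \<Rightarrow> 'a set" where
  "nb U = {y \<in> V - U. \<exists>a\<in>U. adj y a}"

text \<open>The module condition seen from outside: an outer vertex is adjacent to all of
  \<open>U\<close> or to none. A vertex that violates it is exactly what a module closure has to
  absorb.\<close>

definition homogeneous :: "'a set \<Rightarrow> bool" where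
  "homogeneous U \<longleftrightarrow> U \<subseteq> V \<and> (\<forall>y\<in>V - U. \<forall>a\<in>U. \<forall>b\<in>U. adj y a \<longrightarrow> adj y b)"

lemma nb_adj: "homogeneous U \<Longrightarrow> y \<in> nb U \<Longrightarrow> a \<in> U \<Longrightarrow> adj y a"
  unfolding nb_def homogeneous_def by blast

lemma nb_disjoint: "nb U \<inter> U = {}"
  unfolding nb_def by blast

text \<open>A walk from \<open>a\<close> to \<open>v\<close> leaves \<open>U\<close> for a last
  time, and the next vertex is adjacent to \<open>b\<close> as well; starting from \<open>b\<close>
  costs no more.\<close>

lemma ball_homogeneous:
  assumes "homogeneous U" "a \<in> U" "b \<in> U" "v \<notin> U" "v \<in> ball a i"
  shows "v \<in> ball b i"
  using assms(4,5)
proof (induction i arbitrary: v)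
  case 0
  then show ?case using assms by auto
next
  case (Suc i)
  then obtain x where x: "x \<in> ball a i" "x = v \<or> adj x v" and v: "v \<in> V"
    by auto
  show ?case
  proof (cases "x \<in> U")
    case False
    then show ?thesis using Suc.IH x v by auto
  next
    case True
    then have "adj v b"
      using x(2) Suc.prems(1) v assms(1,3) adj_sym[of x v] unfolding homogeneous_def by blast
    then have "v \<in> ball b (Suc 0)"
      using adj_ball adj_sym by blast
    then show ?thesis
      using ball_mono[of b "Suc 0" "Suc i"] assms(1,3) by (auto simp: homogeneous_def)
  qed
qed

lemma reach_homogeneous:
  assumes "homogeneous U" "a \<in> U" "b \<in> U" "v \<notin> U"
  shows "reach a v \<longleftrightarrow> reach b v" "dst a v = dst b v"
proof -
  have "v \<in> ball a i \<longleftrightarrow> v \<in> ball b i" for i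
    using ball_homogeneous assms by blast
  then show "reach a v \<longleftrightarrow> reach b v" "dst a v = dst b v"
    by (simp_all add: reach_def dst_def)
qed

abbreviation "interval \<equiv> geodesic_interval G"

lemma interval_commute: "u \<in> V \<Longrightarrow> v \<in> V \<Longrightarrow> interval u v = interval v u"
proof -
  have "interval u v \<subseteq> interval v u" if "u \<in> V" "v \<in> V" for u v
  proof
    fix w
    assume "w \<in> interval u v"
    then have w: "reach u w" "reach w v" "dst u w + dst w v = dst u v"
      using that geodesic_interval_iff by blast+
    then have "w \<in> V" using reach_V that by blast
    then have "reach v w" "reach w u"
      using w reach_sym that by blast+
    moreover have "dst v w + dst w u = dst v u"
      using w(3) dst_sym that \<open>w \<in> V\<close> by simp
    ultimately show "w \<in> interval v u"
      using that by (simp add: geodesic_interval_iff)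
  qed
  then show "u \<in> V \<Longrightarrow> v \<in> V \<Longrightarrow> interval u v = interval v u"
    by blast
qed

lemma interval_ends:
  assumes "u \<in> V" "interval u v \<noteq> {}"
  shows "u \<in> interval u v" "v \<in> interval u v"
proof -
  have "reach u v"
    using assms reach_trans by (auto simp: geodesic_interval_iff)
  then show "u \<in> interval u v" "v \<in> interval u v"
    using assms reach_refl dst_self reach_V by (auto simp: geodesic_interval_iff)
qed

lemma interval_adjacent:
  assumes "u \<in> V" "u = v \<or> adj u v" "x \<in> interval u v"
  shows "x = u \<or> x = v"
proof -
  have x: "reach u x" "reach x v" "dst u x + dst x v = dst u v"
    using assms geodesic_interval_iff by blast+
  have "dst u v \<le> 1"
    using assms dst_self dst_le[OF adj_ball] by auto
  then have "dst u x = 0 \<or> dst x v = 0"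
    using x(3) by linarith
  then show ?thesis
    using x dst_eq_0 by blast
qed

text \<open>Seen from \<open>u\<close> and \<open>v\<close>, all vertices of \<open>c\<close> are at
  the same distances, so the metric condition passes from \<open>x\<close> to each of them.\<close>

lemma interval_outside:
  assumes "homogeneous c" "u \<in> V" "v \<in> V" "u \<notin> c" "v \<notin> c" "x \<in> c" "x \<in> interval u v"
  shows "c \<subseteq> interval u v"
proof
  fix y
  assume y: "y \<in> c"
  have c: "c \<subseteq> V"
    using assms(1) by (simp add: homogeneous_def)
  have x: "reach u x" "reach x v" "dst u x + dst x v = dst u v"
    using assms geodesic_interval_iff by blast+
  have yv: "reach y v" "dst y v = dst x v" and "reach y u" "dst y u = dst x u"
    using reach_homogeneous[OF assms(1,6) y] assms x(1,2) reach_sym by auto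
  moreover have "x \<in> V" "y \<in> V"
    using c y assms(6) by blast+
  ultimately have "reach u y" "dst u y = dst u x"
    using reach_sym[of y u] dst_sym[of y u] dst_sym[of x u] assms(2) by simp_all
  then show "y \<in> interval u v"
    using yv x(3) assms(2) by (simp add: geodesic_interval_iff)
qed

text \<open>All vertices of \<open>c\<close> are equally far from \<open>v\<close>, so a geodesic
  from \<open>u\<close> to \<open>v\<close> makes no progress at a further vertex of
  \<open>c\<close>.\<close>

lemma interval_crossing:
  assumes "homogeneous c" "u \<in> c" "v \<in> V" "v \<notin> c" "x \<in> c" "x \<in> interval u v"
  shows "x = u"
proof -
  have u: "u \<in> V"
    using assms(1,2) by (auto simp: homogeneous_def)
  have "reach u x" "dst u x + dst x v = dst u v"
    using assms u geodesic_interval_iff by blast+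
  moreover have "dst x v = dst u v"
    using reach_homogeneous assms by blast
  ultimately show ?thesis
    using dst_eq_0 by simp
qed

definition inner :: "'a set \<Rightarrow> 'a \<Rightarrow> 'a \<Rightarrow> bool" where
  "inner c u v \<longleftrightarrow> u \<in> c \<and> v \<in> c \<and> u \<noteq> v \<and> \<not> adj u v"

text \<open>If a non-inner pair has both ends in \<open>c\<close>, they are equal or adjacent and
  nothing lies strictly between; exactly one end in \<open>c\<close> is excluded by
  \<open>interval_crossing\<close>. So both ends are outside and cannot tell the vertices of
  \<open>c\<close> apart.\<close>

lemma interval_interior:
  assumes "homogeneous c" "\<not> inner c u v" "u \<in> V" "v \<in> V"
    "x \<in> c" "x \<in> interval u v" "x \<noteq> u" "x \<noteq> v"
  shows "u \<notin> c \<and> v \<notin> c \<and> c \<subseteq> interval u v"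
proof -
  have "\<not> (u = v \<or> adj u v)"
    using interval_adjacent assms by blast
  then have "u \<notin> c \<or> v \<notin> c"
    using assms(2) by (auto simp: inner_def)
  moreover have "u \<notin> c" if "v \<notin> c"
    using interval_crossing[OF assms(1) _ assms(4) that assms(5,6)] assms(7) by blast
  moreover have "v \<notin> c" if "u \<notin> c"
    using interval_crossing[OF assms(1) _ assms(3) that assms(5)] assms(3,4,6,8)
      interval_commute by blast
  ultimately show ?thesis
    using interval_outside assms by blast
qed

text \<open>Any vertex of \<open>nb c\<close> is a common neighbour of \<open>u\<close> and
  \<open>v\<close>, so their distance is exactly two and every other vertex between them is adjacent
  to \<open>u\<close>.\<close>

lemma interval_inner:
  assumes "homogeneous c" "inner c u v" "nb c \<noteq> {}"
  shows "nb c \<subseteq> interval u v" "interval u v \<subseteq> c \<union> nb c"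
proof -
  have uv: "u \<in> c" "v \<in> c" "u \<noteq> v" "\<not> adj u v" "u \<in> V" "v \<in> V"
    using assms by (auto simp: inner_def homogeneous_def)
  have two: "reach u y \<and> reach y v \<and> dst u y = 1 \<and> dst y v = 1" if "y \<in> nb c" for y
  proof -
    have "adj u y" "adj y v" "y \<in> V"
      using nb_adj[OF assms(1) that] uv adj_sym that by (auto simp: nb_def)
    then show ?thesis
      using reach_adj dst_eq_1 uv by simp
  qed
  have "dst u v = 2"
  proof -
    obtain y where "y \<in> nb c" using assms(3) by blast
    note y = two[OF this]
    then have r: "reach u v" "dst u v \<le> 2"
      using reach_trans uv dst_triangle[of u y v] by auto
    then have "dst u v \<noteq> 0" "dst u v \<noteq> Suc 0"
      using dst_eq_0 dst_eq_1 uv by blast+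
    then show ?thesis using r by linarith
  qed
  then show "nb c \<subseteq> interval u v"
    using two uv by (auto simp: geodesic_interval_iff)
  show "interval u v \<subseteq> c \<union> nb c"
  proof
    fix x
    assume "x \<in> interval u v"
    then have x: "reach u x" "reach x v" "dst u x + dst x v = 2"
      using \<open>dst u v = 2\<close> uv by (auto simp: geodesic_interval_iff)
    then consider "dst u x = 0" | "dst x v = 0" | "dst u x = Suc 0"
      by linarith
    then show "x \<in> c \<union> nb c"
    proof cases
      case 3
      then have "adj u x"
        using x uv dst_eq_1 by blast
      then show ?thesis
        using uv adj_sym adj_V[of u x] by (auto simp: nb_def)
    qed (use x dst_eq_0 uv in auto)
  qed
qed

end

section \<open>Exchanging vertices of a hitting set within a part\<close>

section \<open>A normal form for hitting sets\<close>

text \<open>A part without neighbours is a union of components, where non-adjacent vertices need not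
  have a common neighbour and \<open>interval_inner\<close> does not apply; \<open>nb_parts\<close>
  therefore admits only singletons there.\<close>

locale module_partition = fin_graph +
  fixes P :: "'a set set"
  assumes partition: "partition_on V P"
    and homogeneous_parts: "c \<in> P \<Longrightarrow> homogeneous c"
    and nb_parts: "c \<in> P \<Longrightarrow> nb c = {} \<Longrightarrow> \<exists>x. c = {x}"
begin

lemma parts_V: "c \<in> P \<Longrightarrow> c \<subseteq> V"
  using homogeneous_parts by (simp add: homogeneous_def)

lemma parts_finite: "c \<in> P \<Longrightarrow> finite c"
  using parts_V finite_V finite_subset by blast

lemma finite_P: "finite P"
  using partition finite_V by (rule finite_elements[rotated])

lemma parts_eq: "c \<in> P \<Longrightarrow> c' \<in> P \<Longrightarrow> x \<in> c \<Longrightarrow> x \<in> c' \<Longrightarrow> c = c'"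
  using partition by (auto simp: partition_on_def disjoint_def)

lemma parts_ex: "x \<in> V \<Longrightarrow> \<exists>c\<in>P. x \<in> c"
  using partition by (auto simp: partition_on_def)

text \<open>Two parts are completely joined or not joined at all. Consequently vertices of the same
  part lie in the same neighbourhoods of other parts.\<close>

lemma nb_parts_absorb:
  assumes "c \<in> P" "c' \<in> P" "x \<in> c" "x \<in> nb c'"
  shows "c \<subseteq> nb c'"
proof
  fix y
  assume y: "y \<in> c"
  obtain a where a: "a \<in> c'" "adj x a"
    using assms by (auto simp: nb_def)
  have "x \<notin> c'"
    using assms by (auto simp: nb_def)
  then have "a \<notin> c" "y \<notin> c'"
    using parts_eq assms a y by blast+
  then have "adj a y"
    using homogeneous_parts[OF assms(1)] a adj_sym[of x a] assms y parts_V
    unfolding homogeneous_def by blast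
  then show "y \<in> nb c'"
    using a \<open>y \<notin> c'\<close> adj_sym[of a y] y assms parts_V unfolding nb_def by blast
qed

lemma inner_nb: "c \<in> P \<Longrightarrow> inner c u v \<Longrightarrow> nb c \<noteq> {}"
  using nb_parts[of c] by (auto simp: inner_def)

definition hits :: "('a \<times> 'a) set \<Rightarrow> 'a set \<Rightarrow> bool" where
  "hits T S \<longleftrightarrow> S \<subseteq> V \<and> (\<forall>(u, v)\<in>T. S \<inter> interval u v \<noteq> {})"

text \<open>Another vertex of the same part can take over for \<open>x\<close> when \<open>x\<close>
  lies strictly inside an interval; an end that alone hits a non-inner pair is exempt from this
  argument.\<close>

definition critical :: "('a \<times> 'a) set \<Rightarrow> 'a set \<Rightarrow> 'a \<Rightarrow> bool" where
  "critical T S x \<longleftrightarrow>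
    (\<exists>(u, v)\<in>T. x \<in> {u, v} \<and> (\<forall>c\<in>P. \<not> inner c u v) \<and> S \<inter> interval u v \<subseteq> {x})"

text \<open>Consider a pair hit by \<open>x\<close> alone. If it is inner in \<open>c\<close>, the
  vertex of \<open>S'\<close> in \<open>nb c\<close> hits it. If it is inner in another part,
  \<open>x\<close> lies in the neighbourhood of that part and so does \<open>z\<close>. If it is not
  inner, \<open>x\<close> lies strictly inside the interval because it is not critical, so all of
  \<open>c\<close> does, including \<open>z\<close>.\<close>

lemma hits_remove:
  assumes T: "T \<subseteq> V \<times> V" and S: "hits T S" and c: "c \<in> P"
    and x: "x \<in> S \<inter> c" "\<not> critical T S x" and z: "z \<in> S \<inter> c" "z \<noteq> x"
    and S': "S' \<subseteq> V" "S - {x} \<subseteq> S'" "S' \<inter> nb c \<noteq> {}"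
  shows "hits T S'"
proof -
  have "S' \<inter> interval u v \<noteq> {}" if uv: "(u, v) \<in> T" for u v
  proof (rule ccontr)
    assume neg: "\<not> S' \<inter> interval u v \<noteq> {}"
    then have only: "S \<inter> interval u v \<subseteq> {x}"
      using S' by blast
    then have xI: "x \<in> interval u v"
      using S uv by (auto simp: hits_def)
    have V: "u \<in> V" "v \<in> V"
      using T uv by auto
    have zS: "z \<in> S'" using z S' by blast
    show False
    proof (cases "\<exists>c\<in>P. inner c u v")
      case True
      then obtain c' where c': "c' \<in> P" "inner c' u v"
        by blast
      note I = interval_inner[OF homogeneous_parts[OF c'(1)] c'(2) inner_nb[OF c']]
      show False
      proof (cases "c' = c")
        case True
        then show ?thesis using I S' neg by blast
      next
        case False
        then have "x \<in> nb c'"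
          using I xI x parts_eq c' c by blast
        then have "z \<in> nb c'"
          using nb_parts_absorb c c' x z by blast
        then show ?thesis using I zS neg by blast
      qed
    next
      case False
      then have "x \<noteq> u" "x \<noteq> v"
        using x(2) only uv by (auto simp: critical_def)
      then have "c \<subseteq> interval u v"
        using interval_interior[OF homogeneous_parts[OF c]] False c V x xI by blast
      then show ?thesis using zS z neg by blast
    qed
  qed
  then show ?thesis
    using S' by (auto simp: hits_def)
qed

definition normal :: "('a \<times> 'a) set \<Rightarrow> 'a set \<Rightarrow> bool" where
  "normal T S \<longleftrightarrow> (\<forall>c\<in>P. card (S \<inter> c) \<le> 1 \<or> (\<forall>x\<in>S \<inter> c. critical T S x))"

lemma ex_normal:
  assumes T: "T \<subseteq> V \<times> V" and "hits T S"
  shows "\<exists>S'. hits T S' \<and> card S' \<le> card S \<and> normal T S'"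
proof -
  define missed where "missed S = {c \<in> P. nb c \<inter> S = {}}" for S
  \<comment> \<open>The factor \<open>Suc (card P)\<close> exceeds every value of the second
    summand, so one vertex less outweighs any number of newly missed neighbourhoods.\<close>
  define m where "m S = card S * Suc (card P) + card (missed S)" for S
  have missed_le: "card (missed S) \<le> card P" for S
    unfolding missed_def using finite_P by (intro card_mono) auto
  show ?thesis
    using \<open>hits T S\<close>
  proof (induction S rule: measure_induct_rule[of m])
    case (less S)
    have fin: "finite S"
      using less.prems finite_V finite_subset by (auto simp: hits_def)
    have "\<exists>S'. hits T S' \<and> m S' < m S \<and> card S' \<le> card S" if "\<not> normal T S"
    proof -
      from that obtain c x where c: "c \<in> P" "\<not> card (S \<inter> c) \<le> 1"
        and x: "x \<in> S \<inter> c" "\<not> critical T S x"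
        by (auto simp: normal_def)
      have "S \<inter> c \<noteq> {x}"
        using c by auto
      then obtain z where z: "z \<in> S \<inter> c" "z \<noteq> x"
        using x by blast
      have V: "S \<subseteq> V" "c \<subseteq> V"
        using less.prems parts_V c by (auto simp: hits_def)
      show ?thesis
      proof (cases "nb c \<inter> S = {}")
        case False
        have "hits T (S - {x})"
          by (rule hits_remove[OF T less.prems c(1) x z])
            (use V False x nb_disjoint[of c] in blast)+
        moreover have lt: "card (S - {x}) < card S"
          using x fin by (intro card_Diff1_less) auto
        moreover have "m (S - {x}) < m S"
        proof -
          have "m (S - {x}) < Suc (card (S - {x})) * Suc (card P)"
            using missed_le[of "S - {x}"] by (simp add: m_def)
          also have "\<dots> \<le> card S * Suc (card P)"
            using lt by (intro mult_right_mono) auto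
          finally show ?thesis by (simp add: m_def)
        qed
        ultimately show ?thesis by (meson less_imp_le)
      next
        case True
        have "nb c \<noteq> {}"
          using nb_parts[OF c(1)] x z by auto
        then obtain y where y: "y \<in> nb c" by blast
        define S' where "S' = insert y (S - {x})"
        have "hits T S'"
          by (rule hits_remove[OF T less.prems c(1) x z])
            (use V y in \<open>auto simp: S'_def nb_def\<close>)
        moreover have "y \<notin> S" using y True by blast
        then have card: "card S' = card S"
          using fin x card_Suc_Diff1[of S x] by (auto simp: S'_def card_insert_if)
        moreover have "missed S' \<subset> missed S"
        proof -
          \<comment> \<open>Taking \<open>x\<close> away uncovers no neighbourhood: one that
            contains \<open>x\<close> contains all of \<open>c\<close>, hence
            \<open>z\<close>.\<close>
          have "c' \<in> missed S" if "c' \<in> missed S'" for c'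
          proof (rule ccontr)
            assume "c' \<notin> missed S"
            then have "x \<in> nb c'" "c' \<in> P"
              using that by (auto simp: missed_def S'_def)
            then have "z \<in> nb c'"
              using nb_parts_absorb c x z by blast
            then show False
              using that z by (auto simp: missed_def S'_def)
          qed
          moreover have "c \<in> missed S" "c \<notin> missed S'"
            using True c y by (auto simp: missed_def S'_def)
          ultimately show ?thesis by blast
        qed
        then have "card (missed S') < card (missed S)"
          using finite_P by (intro psubset_card_mono) (auto simp: missed_def)
        ultimately show ?thesis
          by (intro exI[of _ S']) (simp add: m_def)
      qed
    qed
    then show ?case
      using less by (meson order_refl order_trans)
  qed
qed

end

section \<open>Modular width bounds the number of parts in a component\<close>

section \<open>Modular width\<close>

definition mw_split :: "'a graph \<Rightarrow> nat \<Rightarrow> bool" where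
  "mw_split G \<mu> \<longleftrightarrow> card (verts G) \<le> \<mu> \<or>
    (\<exists>Ms. partition_on (verts G) Ms \<and> (\<forall>M\<in>Ms. graph_module G M) \<and>
      2 \<le> card Ms \<and> card Ms \<le> \<mu> \<and>
      (\<forall>M\<in>Ms. modular_width (induced_subgraph G M) \<le> \<mu>))"

lemma modular_width_Least: "modular_width G = (LEAST \<mu>. mw_split G \<mu>)"
  unfolding mw_split_def by (rule modular_width.simps)

lemma mw_split_modular_width: "mw_split G (modular_width G)"
proof -
  have "mw_split G (card (verts G))"
    by (simp add: mw_split_def)
  then show ?thesis
    unfolding modular_width_Least by (rule LeastI)
qed

lemma modular_width_le: "mw_split G \<mu> \<Longrightarrow> modular_width G \<le> \<mu>"
  unfolding modular_width_Least by (rule Least_le)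

lemma verts_induced [simp]: "verts (induced_subgraph G M) = M"
  by (simp add: induced_subgraph_def)

lemma induced_induced: "W \<subseteq> M \<Longrightarrow> induced_subgraph (induced_subgraph G M) W = induced_subgraph G W"
  by (auto simp: induced_subgraph_def)

lemma neighborhood_induced:
  "u \<in> W \<Longrightarrow> neighborhood (induced_subgraph G W) u = neighborhood G u \<inter> W"
  by (auto simp: neighborhood_def induced_subgraph_def)

lemma graph_module_induced:
  assumes "graph_module G M"
  shows "graph_module (induced_subgraph G W) (M \<inter> W)"
  unfolding graph_module_def
proof (intro conjI ballI)
  fix u v
  assume *: "u \<in> M \<inter> W" "v \<in> M \<inter> W"
  then have "neighborhood G u - M = neighborhood G v - M"
    using assms unfolding graph_module_def by blast
  then show "neighborhood (induced_subgraph G W) u - M \<inter> W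
      = neighborhood (induced_subgraph G W) v - M \<inter> W"
    using * neighborhood_induced[of u W G] neighborhood_induced[of v W G] by blast
qed simp

text \<open>Given a decomposition of \<open>G\<close>, either \<open>W\<close> lies in one module,
  and the induction hypothesis for that smaller graph applies, or the traces of the modules on
  \<open>W\<close> are at least two modules of the induced subgraph, with widths bounded by the same
  hypothesis.\<close>

lemma modular_width_induced:
  assumes "finite (verts G)" "W \<subseteq> verts G"
  shows "modular_width (induced_subgraph G W) \<le> modular_width G"
  using assms
proof (induction "card (verts G)" arbitrary: G W rule: less_induct)
  case less
  let ?\<mu> = "modular_width G"
  consider (small) "card (verts G) \<le> ?\<mu>" |
    (split) Ms where "partition_on (verts G) Ms" "\<forall>M\<in>Ms. graph_module G M"
      "2 \<le> card Ms" "card Ms \<le> ?\<mu>" "\<forall>M\<in>Ms. modular_width (induced_subgraph G M) \<le> ?\<mu>"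
    using mw_split_modular_width[of G] unfolding mw_split_def by blast
  then show ?case
  proof cases
    case small
    then have "mw_split (induced_subgraph G W) ?\<mu>"
      using card_mono[OF less.prems] by (simp add: mw_split_def)
    then show ?thesis by (rule modular_width_le)
  next
    case split
    have part: "M \<subseteq> verts G" "modular_width (induced_subgraph G X) \<le> ?\<mu>"
      if "M \<in> Ms" "X \<subseteq> M" for M X
    proof -
      show M: "M \<subseteq> verts G"
        using split(1) that by (auto simp: partition_on_def)
      \<comment> \<open>There are at least two modules, so each is proper and the induction on the
        number of vertices applies.\<close>
      have "M \<noteq> verts G"
      proof
        assume "M = verts G"
        have "M' = M" if "M' \<in> Ms" for M'
        proof -
          have "M' \<subseteq> M" "M' \<noteq> {}"
            using split(1) that \<open>M = _\<close> unfolding partition_on_def by auto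
          then show ?thesis
            using split(1) that \<open>M \<in> Ms\<close> unfolding partition_on_def disjoint_def by blast
        qed
        then have "Ms \<subseteq> {M}" by blast
        then have "card Ms \<le> 1"
          using card_mono[of "{M}" Ms] by simp
        then show False using split(3) by simp
      qed
      then have "card M < card (verts G)"
        using M less.prems(1) by (simp add: psubset_card_mono psubset_eq)
      then have "modular_width (induced_subgraph (induced_subgraph G M) X)
          \<le> modular_width (induced_subgraph G M)"
        using less.hyps[of "induced_subgraph G M" X] that M less.prems(1) finite_subset by auto
      then show "modular_width (induced_subgraph G X) \<le> ?\<mu>"
        using split(5) that by (auto simp: induced_induced)
    qed
    show ?thesis
    proof (cases "\<exists>M\<in>Ms. W \<subseteq> M")
      case True
      then show ?thesis using part by blast
    next
      case False
      define Ms' where "Ms' = {M \<inter> W |M. M \<in> Ms \<and> M \<inter> W \<noteq> {}}"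
      have fin: "finite Ms"
        using split(3) by (metis card.infinite not_numeral_le_zero)
      have part': "partition_on W Ms'"
      proof (rule partition_onI)
        show "\<Union>Ms' = W"
          using split(1) less.prems(2) unfolding partition_on_def Ms'_def by blast
      next
        fix p q
        assume "p \<in> Ms'" "q \<in> Ms'" "p \<noteq> q"
        then show "disjnt p q"
          using split(1) unfolding partition_on_def disjoint_def Ms'_def disjnt_def by blast
      qed (auto simp: Ms'_def)
      have fin': "finite Ms'"
        unfolding Ms'_def using fin by simp
      have Ms': "Ms' \<subseteq> (\<lambda>M. M \<inter> W) ` Ms"
        by (auto simp: Ms'_def)
      have "card Ms' \<le> card Ms"
        using fin Ms' by (meson card_image_le card_mono finite_imageI order_trans)
      moreover have "2 \<le> card Ms'"
      proof (rule ccontr)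
        assume "\<not> 2 \<le> card Ms'"
        then consider "Ms' = {}" | X where "Ms' = {X}"
          using fin' by (metis One_nat_def Suc_1 card_0_eq card_1_singletonE le_antisym
              less_Suc_eq_le not_less_eq_eq not_le bot_nat_0.extremum)
        then show False
        proof cases
          case 1
          then have "W = {}" using part' by (simp add: partition_on_def)
          moreover have "Ms \<noteq> {}" using split(3) by auto
          ultimately show False using False by blast
        next
          case 2
          then have "W = X" "X \<in> Ms'" using part' by (auto simp: partition_on_def)
          then show False using False by (auto simp: Ms'_def)
        qed
      qed
      moreover have "\<forall>M\<in>Ms'. graph_module (induced_subgraph G W) M"
        using split(2) graph_module_induced by (auto simp: Ms'_def)
      moreover have "\<forall>M\<in>Ms'. modular_width (induced_subgraph (induced_subgraph G W) M) \<le> ?\<mu>"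
        using part(2) by (auto simp: Ms'_def induced_induced)
      ultimately have "mw_split (induced_subgraph G W) ?\<mu>"
        unfolding mw_split_def using part' split(4) by (intro disjI2 exI[of _ Ms']) auto
      then show ?thesis by (rule modular_width_le)
    qed
  qed
qed

text \<open>Unions without neighbours have to be exempt: a whole component is homogeneous and a
  union of parts, whatever the partition.\<close>

locale maximal_partition = module_partition +
  assumes maximal: "Q \<subseteq> P \<Longrightarrow> 2 \<le> card Q \<Longrightarrow> homogeneous (\<Union>Q) \<Longrightarrow> nb (\<Union>Q) = {}"
begin

text \<open>The parts in the component of \<open>u\<close>. An interval from \<open>u\<close> stays
  in this component, so only these parts can give branches for a pair with first entry
  \<open>u\<close>.\<close>

definition touched :: "'a \<Rightarrow> 'a set set" where
  "touched u = {c \<in> P. \<exists>x\<in>c. reach u x}"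

text \<open>A vertex of \<open>nb c\<close> is adjacent to all of \<open>c\<close>, so a part with
  neighbours lies in one component even if it induces no edge.\<close>

lemma touched_reach:
  assumes "u \<in> V" "c \<in> touched u" "y \<in> c"
  shows "reach u y"
proof (cases "nb c = {}")
  case True
  then show ?thesis using nb_parts assms by (auto simp: touched_def)
next
  case False
  then obtain z where z: "z \<in> nb c" by blast
  obtain x where x: "x \<in> c" "reach u x" "c \<in> P"
    using assms by (auto simp: touched_def)
  have "adj z x" "adj z y"
    using nb_adj[OF homogeneous_parts[OF x(3)] z] x assms by auto
  then have "reach x z" "reach z y"
    using reach_adj adj_sym by blast+
  then show ?thesis
    using reach_trans assms(1) x(2) by blast
qed

lemma component_connected:
  assumes u: "u \<in> V" and U: "x \<in> U" "\<And>y. y \<in> U \<Longrightarrow> reach u y" and w: "reach u w" "w \<notin> U"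
  shows "nb U \<noteq> {}"
proof
  assume nb: "nb U = {}"
  have "ball x i \<subseteq> U" for i
    using nb U(1) adj_sym by (induction i) (auto simp: nb_def)
  moreover have "reach x w"
    using u U w(1) reach_trans reach_sym reach_V by metis
  ultimately show False
    using w(2) by (auto simp: reach_def)
qed

lemma adj_parts:
  assumes "c \<in> P" "c' \<in> P" "c \<noteq> c'" "x \<in> c" "y \<in> c" "x' \<in> c'" "y' \<in> c'" "adj x x'"
  shows "adj y y'"
proof -
  have "x' \<notin> c" "y \<notin> c'" using parts_eq assms by blast+
  then have "adj x' y"
    using homogeneous_parts[OF assms(1)] assms adj_sym[of x x'] parts_V unfolding homogeneous_def by blast
  then show ?thesis
    using homogeneous_parts[OF assms(2)] assms \<open>y \<notin> c'\<close> adj_sym[of x' y] parts_V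
    unfolding homogeneous_def by blast
qed

text \<open>
  The quotient of a component by its parts is an induced subgraph, so its modular width is at
  most that of the graph; and a nontrivial module of the quotient would lift to a union of parts.
\<close>

lemma card_touched:
  assumes u: "u \<in> V"
  shows "card (touched u) \<le> modular_width G"
proof (rule ccontr)
  assume "\<not> card (touched u) \<le> modular_width G"
  then have big: "modular_width G < card (touched u)" by simp
  have ne: "c \<noteq> {}" if "c \<in> P" for c
    using partition that by (auto simp: partition_on_def)
  define r where "r c = (SOME x. x \<in> c)" for c :: "'a set"
  have r: "r c \<in> c" if "c \<in> P" for c
    using ne[OF that] unfolding r_def by (simp add: some_in_eq)
  have TP: "touched u \<subseteq> P" by (auto simp: touched_def)
  define R where "R = r ` touched u"
  have "inj_on r (touched u)"
    using r TP parts_eq by (metis inj_onI subsetD)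
  then have cardR: "card R = card (touched u)"
    unfolding R_def by (rule card_image)
  have RV: "R \<subseteq> V"
    using TP r parts_V unfolding R_def by blast
  have le: "modular_width (induced_subgraph G R) \<le> modular_width G"
    using modular_width_induced finite_V RV by blast
  \<comment> \<open>There are more representatives than the width, so the first alternative of
    \<open>mw_split\<close> is out and a partition into modules must exist.\<close>
  obtain Ms where Ms: "partition_on R Ms" "\<And>M. M \<in> Ms \<Longrightarrow> graph_module (induced_subgraph G R) M"
      "2 \<le> card Ms" "card Ms \<le> modular_width (induced_subgraph G R)"
    using mw_split_modular_width[of "induced_subgraph G R"] le big cardR
    unfolding mw_split_def by auto
  have finR: "finite R" using RV finite_V finite_subset by blast
  have finMs: "finite Ms" using finite_elements[OF finR Ms(1)] .
  \<comment> \<open>Pigeonhole: the modules are fewer than the representatives they contain.\<close>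
  have "\<exists>D\<in>Ms. 2 \<le> card D"
  proof (rule ccontr)
    assume *: "\<not> (\<exists>D\<in>Ms. 2 \<le> card D)"
    have "card R = card (\<Union>Ms)"
      using Ms(1) by (simp add: partition_on_def)
    also have "\<dots> \<le> (\<Sum>D\<in>Ms. card D)"
      by (rule card_Union_le_sum_card)
    also have "\<dots> \<le> (\<Sum>D\<in>Ms. 1)"
      using * by (intro sum_mono) (auto simp: not_le)
    finally show False
      using Ms(4) le big cardR by simp
  qed
  then obtain D where D: "D \<in> Ms" "2 \<le> card D" by blast
  have DR: "D \<subseteq> R" using Ms(1) D by (auto simp: partition_on_def)
  obtain w where w: "w \<in> R" "w \<notin> D"
  proof -
    have "Ms \<noteq> {D}" using Ms(3) by auto
    then obtain D' where "D' \<in> Ms" "D' \<noteq> D" using D by blast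
    then have "D' \<inter> D = {}" "D' \<noteq> {}" "D' \<subseteq> R"
      using Ms(1) D by (auto simp: partition_on_def disjoint_def)
    then show ?thesis using that by blast
  qed
  define Q where "Q = {c \<in> touched u. r c \<in> D}"
  have QP: "Q \<subseteq> P" using TP by (auto simp: Q_def)
  have "r ` Q = D" using DR by (auto simp: Q_def R_def)
  then have "2 \<le> card Q"
    using D(2) card_image_le[of Q r] finite_P QP finite_subset by (metis order_trans)
  have edge: "adj (r c) y \<longleftrightarrow> adj (r c') y" if "c \<in> Q" "c' \<in> Q" "y \<in> R - D" for c c' y
  proof -
    have "r c \<in> D" "r c' \<in> D" "r c \<in> R" "r c' \<in> R"
      using that DR by (auto simp: Q_def)
    then have "neighborhood G (r c) \<inter> R - D = neighborhood G (r c') \<inter> R - D"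
      using Ms(2)[OF D(1)] neighborhood_induced unfolding graph_module_def by metis
    then show ?thesis
      using that(3) by (auto simp: neighborhood_def adj_def set_eq_iff)
  qed
  have Qr: "reach u x" if "x \<in> \<Union>Q" for x
    using that touched_reach[OF u] by (auto simp: Q_def)
  have "homogeneous (\<Union>Q)"
    unfolding homogeneous_def
  proof (intro conjI ballI impI)
    show "\<Union>Q \<subseteq> V" using QP parts_V by blast
    fix y a b
    assume y: "y \<in> V - \<Union>Q" and ab: "a \<in> \<Union>Q" "b \<in> \<Union>Q" and adj: "adj y a"
    obtain ca cb where c: "ca \<in> Q" "a \<in> ca" "cb \<in> Q" "b \<in> cb" using ab by blast
    obtain cy where cy: "cy \<in> P" "y \<in> cy" using parts_ex y by blast
    then have "cy \<notin> Q" using y by blast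
    have "reach u y"
      using Qr[OF ab(1)] adj adj_sym reach_adj reach_trans u by blast
    then have "cy \<in> touched u" using cy by (auto simp: touched_def)
    then have ry: "r cy \<in> R - D" using \<open>cy \<notin> Q\<close> by (auto simp: Q_def R_def)
    have ne: "cy \<noteq> ca" "cy \<noteq> cb" using c \<open>cy \<notin> Q\<close> by auto
    have "adj (r cy) (r ca)"
      using adj_parts[OF cy(1) _ ne(1) cy(2) r[OF cy(1)] c(2) r adj] c QP by blast
    then have "adj (r cy) (r cb)"
      using edge[OF c(1,3) ry] adj_sym by blast
    then show "adj y b"
      using adj_parts[OF cy(1) _ ne(2) r[OF cy(1)] cy(2) r c(4)] c QP by blast
  qed
  then have "nb (\<Union>Q) = {}"
    using maximal QP \<open>2 \<le> card Q\<close> by blast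
  \<comment> \<open>The representative \<open>w\<close> lies in the same component but outside the
    union of \<open>Q\<close>, so an edge must leave this union.\<close>
  moreover have "nb (\<Union>Q) \<noteq> {}"
  proof -
    obtain cw where cw: "cw \<in> touched u" "w = r cw" using w by (auto simp: R_def)
    then have "reach u w" using touched_reach[OF u] r TP by blast
    moreover have "w \<notin> \<Union>Q"
    proof
      assume "w \<in> \<Union>Q"
      then obtain c where "c \<in> Q" "w \<in> c" by blast
      then have "c = cw"
        using parts_eq[of c cw w] QP TP cw r by blast
      then show False using \<open>c \<in> Q\<close> w cw by (auto simp: Q_def)
    qed
    moreover obtain c where "c \<in> Q"
      using \<open>2 \<le> card Q\<close> by fastforce
    then have "r c \<in> \<Union>Q"
      using r QP by blast
    ultimately show ?thesis
      using component_connected[OF u _ Qr] by blast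
  qed
  ultimately show False by blast
qed

end

section \<open>Bounded search and the guesses it makes\<close>

section \<open>The token search\<close>

definition unhit :: "nat list list \<Rightarrow> nat list \<Rightarrow> nat list list" where
  "unhit obs Z = filter (\<lambda>ob. set ob \<inter> set Z = {}) obs"

primrec search :: "nat list list \<Rightarrow> (nat list \<Rightarrow> bool) \<Rightarrow> nat \<Rightarrow> nat list \<Rightarrow> bool" where
  "search obs L 0 Z = (case unhit obs Z of [] \<Rightarrow> L Z | ob # _ \<Rightarrow> False)"
| "search obs L (Suc n) Z =
    (case unhit obs Z of [] \<Rightarrow> L Z | ob # _ \<Rightarrow> \<exists>x\<in>set ob. search obs L n (x # Z))"

text \<open>A leaf succeeds only after its candidate passes the test \<open>L\<close>, so wrong
  guesses are harmless and the choice of branches matters for completeness alone.\<close>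

lemma search_sound: "search obs L n Z \<Longrightarrow> \<exists>Z. L Z"
  by (induction n arbitrary: Z) (auto split: list.splits)

text \<open>\<open>W\<close> is a set of true guesses. The run that always follows an element of
  \<open>W\<close> gains a new one each time, because the branching list is disjoint from
  \<open>Z\<close>; once \<open>Z\<close> exhausts \<open>W\<close>, nothing is unhit.\<close>

lemma search_complete:
  assumes "finite W" "\<And>ob. ob \<in> set obs \<Longrightarrow> set ob \<inter> W \<noteq> {}"
    and "\<And>Z. set Z \<subseteq> W \<Longrightarrow> unhit obs Z = [] \<Longrightarrow> L Z"
    and "set Z \<subseteq> W" "distinct Z" "card W \<le> n + length Z"
  shows "search obs L n Z"
  using assms(4-6)
proof (induction n arbitrary: Z)
  case (0 Z)
  then have "set Z = W"
    using assms(1) by (metis add_0 card_seteq distinct_card)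
  then have "unhit obs Z = []"
    using assms(2) by (auto simp: unhit_def filter_empty_conv)
  then show ?case using assms(3) 0 by simp
next
  case (Suc n Z)
  show ?case
  proof (cases "unhit obs Z")
    case (Cons ob obs')
    then have "ob \<in> set obs" "set ob \<inter> set Z = {}"
      using filter_eq_ConsD[of "\<lambda>ob. set ob \<inter> set Z = {}" obs] by (auto simp: unhit_def)
    then obtain x where "x \<in> set ob" "x \<in> W" "x \<notin> set Z"
      using assms(2) by blast
    then have "search obs L n (x # Z)"
      using Suc by auto
    then show ?thesis using Cons \<open>x \<in> set ob\<close> by auto
  qed (use assms(3) Suc in simp)
qed

text \<open>
  The tokens \<open>3 * x\<close>, \<open>3 * r + 1\<close> and \<open>3 * r + 2\<close> stand for the guesses that \<open>x\<close> belongs to the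
  hitting set, that the hitting set meets the part with representative \<open>r\<close>, and that moreover it
  misses the neighbourhood of this part.
\<close>

locale token_search = maximal_partition G P for G :: "nat graph" and P +
  fixes ps :: "nat list list" and ts :: "(nat \<times> nat) list"
  assumes ps: "set ` set ps = P" and distinct_ps: "distinct (map set ps)"
    and ts: "set ts \<subseteq> V \<times> V"
    and representative: "c \<in> set ps \<Longrightarrow> x \<in> set c \<Longrightarrow>
      (\<And>u v. (u, v) \<in> set ts \<Longrightarrow> inner (set c) u v \<Longrightarrow> x \<in> interval u v) \<Longrightarrow>
      (\<And>u v. (u, v) \<in> set ts \<Longrightarrow> inner (set c) u v \<Longrightarrow> hd c \<in> interval u v)"
begin

definition option_step :: "nat \<times> nat \<Rightarrow> nat list \<Rightarrow> nat list \<Rightarrow> nat list" where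
  "option_step = (\<lambda>(u, v) c acc. if inner (set c) u v then (3 * hd c + 2) # acc
    else if \<exists>w\<in>set c. w \<noteq> u \<and> w \<noteq> v \<and> w \<in> interval u v then (3 * hd c + 1) # acc else acc)"

definition opts :: "nat \<times> nat \<Rightarrow> nat list" where
  "opts = (\<lambda>(u, v). fold (option_step (u, v)) ps [3 * u, 3 * v])"

text \<open>The representative enters only if no vertex of its part was guessed explicitly;
  otherwise the part is met already, and a further vertex could make the set larger than the hitting
  set the guesses describe.\<close>

definition chosen :: "nat list \<Rightarrow> nat set" where
  "chosen Z = {v \<in> V. 3 * v \<in> set Z \<or> (\<exists>c\<in>set ps. v = hd c \<and>
    (3 * v + 1 \<in> set Z \<or> 3 * v + 2 \<in> set Z) \<and> \<not> (\<exists>x\<in>set c. 3 * x \<in> set Z))}"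

definition accepts :: "nat \<Rightarrow> nat list \<Rightarrow> bool" where
  "accepts k Z \<longleftrightarrow> card (chosen Z) \<le> k \<and> hits (set ts) (chosen Z)"

lemma hitsD: "hits T S \<Longrightarrow> (u, v) \<in> T \<Longrightarrow> S \<inter> interval u v \<noteq> {}"
  by (auto simp: hits_def)

lemma ps_P: "c \<in> set ps \<Longrightarrow> set c \<in> P"
  using ps by blast

lemma ps_ne: "c \<in> set ps \<Longrightarrow> hd c \<in> set c"
  using ps_P[of c] partition by (cases c) (auto simp: partition_on_def)

lemma ps_eq: "c \<in> set ps \<Longrightarrow> c' \<in> set ps \<Longrightarrow> x \<in> set c \<Longrightarrow> x \<in> set c' \<Longrightarrow> c = c'"
  using parts_eq ps_P distinct_ps by (metis distinct_map inj_onD)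

lemma ps_ex: "x \<in> V \<Longrightarrow> \<exists>c\<in>set ps. x \<in> set c"
  using parts_ex ps by blast

lemma ps_hd_eq: "c \<in> set ps \<Longrightarrow> c' \<in> set ps \<Longrightarrow> hd c = hd c' \<Longrightarrow> c = c'"
  using ps_eq ps_ne by metis

lemma set_opts:
  "set (opts (u, v)) = {3 * u, 3 * v} \<union> (\<lambda>c. 3 * hd c + 2) ` {c \<in> set ps. inner (set c) u v} \<union>
    (\<lambda>c. 3 * hd c + 1) ` {c \<in> set ps. \<not> inner (set c) u v \<and>
      (\<exists>w\<in>set c. w \<noteq> u \<and> w \<noteq> v \<and> w \<in> interval u v)}"
proof -
  have "set (fold (option_step (u, v)) cs acc) = set acc \<union>
    (\<lambda>c. 3 * hd c + 2) ` {c \<in> set cs. inner (set c) u v} \<union>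
    (\<lambda>c. 3 * hd c + 1) ` {c \<in> set cs. \<not> inner (set c) u v \<and>
      (\<exists>w\<in>set c. w \<noteq> u \<and> w \<noteq> v \<and> w \<in> interval u v)}" for cs acc
    by (induction cs arbitrary: acc) (auto simp: option_step_def)
  then show ?thesis by (auto simp: opts_def)
qed

text \<open>The summand 2 stands for the two ends. A part adds at most one token, and only if it
  contains a vertex reachable from \<open>u\<close>; distinctness of the parts turns the list length
  into the cardinality bounded by \<open>card_touched\<close>.\<close>

lemma length_opts:
  assumes "u \<in> V" "v \<in> V"
  shows "length (opts (u, v)) \<le> 2 + modular_width G"
proof -
  have "length (fold (option_step (u, v)) cs acc) \<le>
    length acc + length (filter (\<lambda>c. set c \<in> touched u) cs)" if "set cs \<subseteq> set ps" for cs acc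
    using that
  proof (induction cs arbitrary: acc)
    case (Cons c cs)
    have "set c \<in> touched u" if "inner (set c) u v \<or> (\<exists>w\<in>set c. w \<in> interval u v)"
      using that ps_P[of c] Cons.prems assms reach_refl
      by (auto simp: touched_def inner_def geodesic_interval_iff)
    then have "length (option_step (u, v) c acc) \<le>
      length acc + (if set c \<in> touched u then 1 else 0)"
      by (auto simp: option_step_def)
    then show ?case
      using Cons.IH[of "option_step (u, v) c acc"] Cons.prems
      by (auto split: if_splits)
  qed simp
  from this[OF order_refl, of "[3 * u, 3 * v]"]
  have "length (opts (u, v)) \<le> 2 + length (filter (\<lambda>c. set c \<in> touched u) ps)"
    by (simp add: opts_def)
  also have "length (filter (\<lambda>c. set c \<in> touched u) ps)
      = card (set (map set (filter (\<lambda>c. set c \<in> touched u) ps)))"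
    using distinct_card[OF distinct_map_filter[OF distinct_ps], of "\<lambda>c. set c \<in> touched u"]
    by (simp del: set_map)
  also have "\<dots> \<le> card (touched u)"
    using finite_P by (intro card_mono) (auto simp: touched_def)
  also have "\<dots> \<le> modular_width G"
    using card_touched assms by blast
  finally show ?thesis by simp
qed

text \<open>The guesses that are true of \<open>S\<close>. The third kind records the missed
  neighbourhood because this forces every inner pair of the part to be hit from inside it.\<close>

definition tokens :: "nat set \<Rightarrow> nat set" where
  "tokens S = (\<lambda>x. 3 * x) ` S \<union> (\<lambda>c. 3 * hd c + 1) ` {c \<in> set ps. S \<inter> set c \<noteq> {}} \<union>
    (\<lambda>c. 3 * hd c + 2) ` {c \<in> set ps. S \<inter> set c \<noteq> {} \<and> nb (set c) \<inter> S = {}}"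

lemma tokens_vertex: "3 * x \<in> tokens S \<longleftrightarrow> x \<in> S"
  unfolding tokens_def by (auto, presburger+)

lemma tokens_part:
  assumes "c \<in> set ps" "3 * hd c + 1 \<in> tokens S"
  shows "S \<inter> set c \<noteq> {}"
proof -
  consider x where "3 * hd c + 1 = 3 * x"
    | c' where "c' \<in> set ps" "S \<inter> set c' \<noteq> {}" "3 * hd c + 1 = 3 * hd c' + 1"
    | c' where "3 * hd c + 1 = 3 * hd c' + 2"
    using assms(2) unfolding tokens_def by blast
  then show ?thesis
  proof cases
    case 2
    then show ?thesis using ps_hd_eq[OF assms(1) 2(1)] by simp
  qed presburger+
qed

lemma tokens_inner:
  assumes "c \<in> set ps" "3 * hd c + 2 \<in> tokens S"
  shows "S \<inter> set c \<noteq> {} \<and> nb (set c) \<inter> S = {}"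
proof -
  consider x where "3 * hd c + 2 = 3 * x"
    | c' where "3 * hd c + 2 = 3 * hd c' + 1"
    | c' where "c' \<in> set ps" "S \<inter> set c' \<noteq> {} \<and> nb (set c') \<inter> S = {}"
      "3 * hd c + 2 = 3 * hd c' + 2"
    using assms(2) unfolding tokens_def by blast
  then show ?thesis
  proof cases
    case 3
    then show ?thesis using ps_hd_eq[OF assms(1) 3(1)] by simp
  qed presburger+
qed

text \<open>Different parts met by \<open>S\<close> contain different vertices of \<open>S\<close>,
  so each of the three kinds contributes at most \<open>card S\<close> tokens.\<close>

lemma card_tokens:
  assumes "S \<subseteq> V"
  shows "finite (tokens S)" "card (tokens S) \<le> 3 * card S"
proof -
  have fin: "finite S" using assms finite_V finite_subset by blast
  show "finite (tokens S)" using fin by (simp add: tokens_def)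
  define p where "p x = (SOME c. c \<in> set ps \<and> x \<in> set c)" for x
  have "\<exists>c. c \<in> set ps \<and> x \<in> set c" if "x \<in> S" for x
    using ps_ex assms that by blast
  then have p: "p x \<in> set ps \<and> x \<in> set (p x)" if "x \<in> S" for x
    using that unfolding p_def by (metis (mono_tags, lifting) someI_ex)
  have "{c \<in> set ps. S \<inter> set c \<noteq> {}} \<subseteq> p ` S"
    using p ps_eq by blast
  then have "card {c \<in> set ps. S \<inter> set c \<noteq> {}} \<le> card S"
    using fin by (meson card_image_le card_mono finite_imageI order_trans)
  moreover have "card {c \<in> set ps. S \<inter> set c \<noteq> {} \<and> nb (set c) \<inter> S = {}} \<le>
      card {c \<in> set ps. S \<inter> set c \<noteq> {}}"
    by (rule card_mono) auto
  moreover have "card (tokens S) \<le> card ((\<lambda>x. 3 * x) ` S) +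
      card ((\<lambda>c. 3 * hd c + 1) ` {c \<in> set ps. S \<inter> set c \<noteq> {}}) +
      card ((\<lambda>c. 3 * hd c + 2) ` {c \<in> set ps. S \<inter> set c \<noteq> {} \<and> nb (set c) \<inter> S = {}})"
    unfolding tokens_def by (meson add_le_mono card_Un_le le_refl order_trans)
  moreover have "card ((\<lambda>x. 3 * x) ` S) \<le> card S"
    using fin by (rule card_image_le)
  moreover have "card ((\<lambda>c. 3 * hd c + 1) ` {c \<in> set ps. S \<inter> set c \<noteq> {}}) \<le>
      card {c \<in> set ps. S \<inter> set c \<noteq> {}}"
    by (rule card_image_le) simp
  moreover have "card ((\<lambda>c. 3 * hd c + 2) ` {c \<in> set ps. S \<inter> set c \<noteq> {} \<and> nb (set c) \<inter> S = {}}) \<le>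
      card {c \<in> set ps. S \<inter> set c \<noteq> {} \<and> nb (set c) \<inter> S = {}}"
    by (rule card_image_le) simp
  ultimately show "card (tokens S) \<le> 3 * card S" by linarith
qed

text \<open>The delicate case is an inner pair in \<open>c0\<close>. If \<open>S\<close> meets
  \<open>nb c0\<close>, the vertex found there lies strictly inside the interval and in another
  part, whose ordinary token is both offered and true; otherwise \<open>S\<close> hits the pair from
  within \<open>c0\<close> and the third token is true.\<close>

lemma tokens_hit_opts:
  assumes S: "hits (set ts) S" and uv: "(u, v) \<in> set ts"
  shows "set (opts (u, v)) \<inter> tokens S \<noteq> {}"
proof -
  have V: "u \<in> V" "v \<in> V" using ts uv by auto
  obtain w where w: "w \<in> S" "w \<in> interval u v" using hitsD[OF S uv] by blast
  have SV: "S \<subseteq> V" using S by (simp add: hits_def)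
  have part: "3 * hd c + 1 \<in> set (opts (u, v)) \<inter> tokens S"
    if "c \<in> set ps" "\<not> inner (set c) u v" "y \<in> set c" "y \<in> S" "y \<in> interval u v" "y \<noteq> u" "y \<noteq> v"
    for c y
    using that by (auto simp: set_opts tokens_def)
  show ?thesis
  proof (cases "w = u \<or> w = v")
    case True
    then have "3 * w \<in> set (opts (u, v)) \<inter> tokens S"
      using w by (auto simp: set_opts tokens_def)
    then show ?thesis by blast
  next
    case False
    obtain c where c: "c \<in> set ps" "w \<in> set c" using ps_ex SV w by blast
    show ?thesis
    proof (cases "\<exists>c\<in>set ps. inner (set c) u v")
      case False
      then show ?thesis using part c w \<open>\<not> (w = u \<or> w = v)\<close> by blast
    next
      case True
      then obtain c0 where c0: "c0 \<in> set ps" "inner (set c0) u v" by blast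
      note P0 = ps_P[OF c0(1)]
      note I = interval_inner[OF homogeneous_parts[OF P0] c0(2) inner_nb[OF P0 c0(2)]]
      show ?thesis
      proof (cases "nb (set c0) \<inter> S = {}")
        case True
        then have "w \<in> set c0" using I w by blast
        then have "3 * hd c0 + 2 \<in> set (opts (u, v)) \<inter> tokens S"
          using True c0 w by (auto simp: set_opts tokens_def)
        then show ?thesis by blast
      next
        case False
        then obtain y where y: "y \<in> nb (set c0)" "y \<in> S" by blast
        obtain c1 where c1: "c1 \<in> set ps" "y \<in> set c1" using ps_ex SV y by blast
        have "y \<notin> set c0" using y nb_disjoint by blast
        then have "\<not> inner (set c1) u v" "y \<noteq> u" "y \<noteq> v"
          using c0 c1 ps_eq by (auto simp: inner_def)
        then show ?thesis using part c1 y I by blast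
      qed
    qed
  qed
qed

lemma card_parts:
  assumes "S \<subseteq> V"
  shows "card S = (\<Sum>c\<in>P. card (S \<inter> c))"
proof -
  have "S = (\<Union>c\<in>P. S \<inter> c)" using assms parts_ex by blast
  moreover have "card (\<Union>c\<in>P. S \<inter> c) = (\<Sum>c\<in>P. card (S \<inter> c))"
    using finite_P parts_finite parts_eq by (intro card_UN_disjoint) blast+
  ultimately show ?thesis by metis
qed

text \<open>Sizes are compared part by part. A guessed end hits its pair, and so does any vertex of
  a guessed part. With a third token, \<open>S\<close> misses the neighbourhood and hits all inner
  pairs of the part from within; by normality its vertices there are all critical, hence guessed
  explicitly, or there is only one, which the representative replaces.\<close>

lemma tokens_accepted:
  assumes S: "hits (set ts) S" "normal (set ts) S" "card S \<le> k"
    and Z: "set Z \<subseteq> tokens S" "\<And>p. p \<in> set ts \<Longrightarrow> set (opts p) \<inter> set Z \<noteq> {}"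
  shows "accepts k Z"
proof -
  let ?S = "chosen Z"
  have V: "S \<subseteq> V" "?S \<subseteq> V" using S by (auto simp: hits_def chosen_def)
  have hard: "x \<in> S" "x \<in> ?S" if "3 * x \<in> set Z" for x
    using that Z(1) tokens_vertex V by (auto simp: chosen_def)
  have part: "card (?S \<inter> set c) \<le> card (S \<inter> set c)" if c: "c \<in> set ps" for c
  proof (cases "\<exists>x\<in>set c. 3 * x \<in> set Z")
    case True
    then have "?S \<inter> set c \<subseteq> S \<inter> set c"
      using hard c ps_eq ps_ne unfolding chosen_def by blast
    then show ?thesis by (intro card_mono) auto
  next
    case False
    then have sub: "?S \<inter> set c \<subseteq> {hd c}"
      using c ps_eq ps_ne unfolding chosen_def by blast
    show ?thesis
    proof (cases "?S \<inter> set c = {}")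
      case False
      then have "hd c \<in> ?S" using sub by blast
      then have "3 * hd c + 1 \<in> set Z \<or> 3 * hd c + 2 \<in> set Z"
        using \<open>\<not> (\<exists>x\<in>set c. 3 * x \<in> set Z)\<close> c ps_ne unfolding chosen_def by blast
      then have "S \<inter> set c \<noteq> {}"
        using c tokens_part tokens_inner Z(1) by blast
      then have "1 \<le> card (S \<inter> set c)" by (simp add: Suc_le_eq card_gt_0_iff)
      moreover have "card (?S \<inter> set c) \<le> 1" using sub card_mono[of "{hd c}"] by simp
      ultimately show ?thesis by simp
    qed simp
  qed
  have "card ?S = (\<Sum>c\<in>P. card (?S \<inter> c))" using card_parts V by blast
  also have "\<dots> \<le> (\<Sum>c\<in>P. card (S \<inter> c))"
    using part ps by (intro sum_mono) blast
  also have "\<dots> = card S" using card_parts V by simp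
  finally have "card ?S \<le> k" using S(3) by simp
  moreover have meets: "?S \<inter> set c \<noteq> {}"
    if "c \<in> set ps" "3 * hd c + 1 \<in> set Z \<or> 3 * hd c + 2 \<in> set Z" for c
  proof (cases "\<exists>x\<in>set c. 3 * x \<in> set Z")
    case False
    then have "hd c \<in> ?S"
      using that ps_ne parts_V ps_P unfolding chosen_def by blast
    then show ?thesis using ps_ne that by blast
  qed (use hard in blast)
  have "?S \<inter> interval u v \<noteq> {}" if uv: "(u, v) \<in> set ts" for u v
  proof -
    have uvV: "u \<in> V" "v \<in> V" using ts uv by auto
    have Iuv: "u \<in> interval u v" "v \<in> interval u v"
      using interval_ends[OF uvV(1)] hitsD[OF S(1) uv] by blast+
    have "\<exists>t. t \<in> set (opts (u, v)) \<and> t \<in> set Z" using Z(2)[OF uv] by blast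
    then consider (hard) x where "x = u \<or> x = v" "3 * x \<in> set Z"
      | (part) c w where "c \<in> set ps" "\<not> inner (set c) u v" "w \<in> set c" "w \<noteq> u" "w \<noteq> v"
        "w \<in> interval u v" "3 * hd c + 1 \<in> set Z"
      | (inner) c where "c \<in> set ps" "inner (set c) u v" "3 * hd c + 2 \<in> set Z"
      unfolding set_opts by blast
    then show ?thesis
    proof cases
      case hard
      then show ?thesis using \<open>\<And>x. 3 * x \<in> set Z \<Longrightarrow> x \<in> ?S\<close> Iuv by blast
    next
      case part
      then have "set c \<subseteq> interval u v"
        using interval_interior[OF homogeneous_parts[OF ps_P]] uvV by blast
      then show ?thesis using meets part by blast
    next
      case inner
      have tok: "S \<inter> set c \<noteq> {}" "nb (set c) \<inter> S = {}"
        using tokens_inner inner Z(1) by blast+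
      have "interval x y \<subseteq> set c \<union> nb (set c)" if "inner (set c) x y" for x y
        using interval_inner(2)[OF homogeneous_parts[OF ps_P]] inner_nb[OF ps_P] inner(1) that
        by blast
      then have hit: "S \<inter> set c \<inter> interval x y \<noteq> {}" if "inner (set c) x y" "(x, y) \<in> set ts" for x y
        using that hitsD[OF S(1) that(2)] tok by blast
      \<comment> \<open>The pair that makes \<open>x\<close> critical is hit only by
        \<open>x\<close>. A guessed end belongs to \<open>S\<close>, so it is \<open>x\<close>; a
        guessed part would put another vertex of \<open>S\<close> into the interval.\<close>
      have crit: "3 * x \<in> set Z" if x: "x \<in> S \<inter> set c" "critical (set ts) S x" for x
      proof -
        obtain a b where ab: "(a, b) \<in> set ts" "x = a \<or> x = b" "\<forall>c\<in>P. \<not> inner c a b"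
          "S \<inter> interval a b \<subseteq> {x}"
          using x(2) unfolding critical_def by blast
        have abV: "a \<in> V" "b \<in> V" using ts ab by auto
        have Iab: "a \<in> interval a b" "b \<in> interval a b"
          using interval_ends[OF abV(1)] hitsD[OF S(1) ab(1)] by blast+
        have "\<exists>t. t \<in> set (opts (a, b)) \<and> t \<in> set Z" using Z(2)[OF ab(1)] by blast
        moreover have "\<not> inner (set c) a b" if "c \<in> set ps" for c using ab(3) ps_P that by blast
        ultimately consider (hard) y where "y = a \<or> y = b" "3 * y \<in> set Z"
          | (part) c w where "c \<in> set ps" "w \<in> set c" "w \<noteq> a" "w \<noteq> b"
            "w \<in> interval a b" "3 * hd c + 1 \<in> set Z"
          unfolding set_opts by blast
        then show ?thesis
        proof cases
          case hard
          then show ?thesis using \<open>\<And>x. 3 * x \<in> set Z \<Longrightarrow> x \<in> S\<close> Iab ab(4) by blast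
        next
          case part
          then have "a \<notin> set c \<and> b \<notin> set c \<and> set c \<subseteq> interval a b"
            using interval_interior[OF homogeneous_parts[OF ps_P]] abV ab(3) ps_P by blast
          moreover have "S \<inter> set c \<noteq> {}" using tokens_part part Z(1) by blast
          ultimately show ?thesis using ab by blast
        qed
      qed
      show ?thesis
      proof (cases "\<forall>x\<in>S \<inter> set c. critical (set ts) S x")
        case True
        then have "S \<inter> set c \<subseteq> ?S" using crit hard by blast
        then show ?thesis using hit[OF inner(2) uv] by blast
      next
        case False
        then have "card (S \<inter> set c) \<le> 1"
          using S(2) ps_P[OF inner(1)] unfolding normal_def by blast
        then have "card (S \<inter> set c) = 1"
          using tok(1) by (simp add: le_Suc_eq)
        then obtain x where x: "S \<inter> set c = {x}"
          by (auto simp: card_1_singleton_iff)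
        then have xI: "x \<in> interval u v"
          using hit[OF inner(2) uv] by auto
        \<comment> \<open>An explicit guess in this part can only be \<open>x\<close>; without one,
          \<open>chosen\<close> supplies the head, which hits all inner pairs of the part because
          \<open>x\<close> does.\<close>
        show ?thesis
        proof (cases "\<exists>y\<in>set c. 3 * y \<in> set Z")
          case True
          then obtain y where "y \<in> S \<inter> set c" "y \<in> ?S" using hard by blast
          then have "x \<in> ?S" using x by simp
          then show ?thesis using xI by blast
        next
          case False
          then have "hd c \<in> ?S"
            using inner ps_ne parts_V ps_P unfolding chosen_def by blast
          moreover have "hd c \<in> interval u v"
            using representative[OF inner(1), of x] x hit uv inner(2) by auto
          ultimately show ?thesis by blast
        qed
      qed
    qed
  qed
  ultimately show ?thesis
    using V by (auto simp: accepts_def hits_def)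
qed

theorem search_iff:
  "search (map opts ts) (accepts k) (3 * k) [] \<longleftrightarrow> (\<exists>S. hits (set ts) S \<and> card S \<le> k)"
proof
  assume "search (map opts ts) (accepts k) (3 * k) []"
  then show "\<exists>S. hits (set ts) S \<and> card S \<le> k"
    using search_sound accepts_def by blast
next
  assume "\<exists>S. hits (set ts) S \<and> card S \<le> k"
  then obtain S where S: "hits (set ts) S" "card S \<le> k" "normal (set ts) S"
    using ex_normal[OF ts] order_trans by metis
  show "search (map opts ts) (accepts k) (3 * k) []"
  proof (rule search_complete[of "tokens S"])
    have "S \<subseteq> V" using S by (simp add: hits_def)
    then show "finite (tokens S)" "card (tokens S) \<le> 3 * k + length []"
      using card_tokens[of S] S(2) by auto
    show "set ob \<inter> tokens S \<noteq> {}" if "ob \<in> set (map opts ts)" for ob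
      using that tokens_hit_opts[OF S(1)] by auto
    show "accepts k Z" if "set Z \<subseteq> tokens S" "unhit (map opts ts) Z = []" for Z
      using tokens_accepted[OF S(1,3,2) that(1)] that(2)
      by (auto simp: unhit_def filter_empty_conv)
  qed auto
qed

end

section \<open>Iterative computation of distances, module closures and a greedy partition\<close>

section \<open>Computing distances, closures and parts\<close>

lemma fold_const: "fold (\<lambda>_. f) xs a = (f ^^ length xs) a"
  by (induction xs arbitrary: a) (simp_all add: funpow_swap1)

text \<open>A round that is not stationary adds an element, so after \<open>i\<close> rounds the set
  is stationary or has at least \<open>i\<close> elements; \<open>card V\<close> rounds are
  enough.\<close>

lemma funpow_extensive_fixpoint:
  assumes "finite V" "X \<subseteq> V" and F: "\<And>X. X \<subseteq> V \<Longrightarrow> X \<subseteq> F X \<and> F X \<subseteq> V"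
  shows "(F ^^ i) X \<subseteq> V" "X \<subseteq> (F ^^ i) X" "F ((F ^^ card V) X) = (F ^^ card V) X"
proof -
  show V: "(F ^^ i) X \<subseteq> V" for i
    using assms by (induction i) auto
  show "X \<subseteq> (F ^^ i) X"
  proof (induction i)
    case (Suc i)
    then show ?case using F[OF V[of i]] by auto
  qed simp
  have "F ((F ^^ i) X) = (F ^^ i) X \<or> i \<le> card ((F ^^ i) X)" for i
  proof (induction i)
    case (Suc i)
    show ?case
    proof (cases "F ((F ^^ i) X) = (F ^^ i) X")
      case False
      then have "(F ^^ i) X \<subset> F ((F ^^ i) X)" using F V by blast
      then have "card ((F ^^ i) X) < card (F ((F ^^ i) X))"
        using F V assms(1) by (meson finite_subset psubset_card_mono)
      then show ?thesis using Suc False by auto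
    qed simp
  qed simp
  moreover have "F ((F ^^ card V) X) = (F ^^ card V) X" if "card V \<le> card ((F ^^ card V) X)"
    using that V F assms(1) by (metis card_seteq subset_antisym)
  ultimately show "F ((F ^^ card V) X) = (F ^^ card V) X" by blast
qed

locale listed_graph = fin_graph G for G :: "'a graph" +
  fixes vs :: "'a list"
  assumes distinct_vs: "distinct vs" and set_vs: "set vs = V"
begin

lemma length_vs: "length vs = card V"
  using distinct_vs set_vs distinct_card by metis

definition ball_step :: "'a list \<Rightarrow> 'a list" where
  "ball_step B = filter (\<lambda>w. \<exists>x\<in>set B. x = w \<or> adj x w) vs"

definition bfs_step :: "'a \<Rightarrow> 'a list \<times> nat \<Rightarrow> 'a list \<times> nat" where
  "bfs_step v = (\<lambda>(B, c). if v \<in> set B then (B, c) else (ball_step B, c + 1))"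

definition bfs :: "'a \<Rightarrow> 'a \<Rightarrow> 'a list \<times> nat" where
  "bfs u v = fold (\<lambda>_. bfs_step v) vs ([u], 0)"

text \<open>The counter freezes as soon as \<open>v\<close> is absorbed. If that never happens it
  ends at \<open>card V\<close>, which is above every finite distance.\<close>

lemma bfs:
  assumes "u \<in> V"
  shows "v \<in> set (fst (bfs u v)) \<longleftrightarrow> reach u v"
    "snd (bfs u v) = (if reach u v then dst u v else card V)"
proof -
  define st where "st i = (bfs_step v ^^ i) ([u], 0)" for i
  have st: "set (fst (st i)) = ball u (snd (st i)) \<and>
      snd (st i) = (if reach u v then min i (dst u v) else i)" for i
  proof (induction i)
    case (Suc i)
    have Suc_st: "st (Suc i) = bfs_step v (st i)" by (simp add: st_def)
    have "v \<in> set (fst (st i)) \<longleftrightarrow> reach u v \<and> dst u v \<le> i"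
      using Suc in_ball_iff[OF assms, of v "snd (st i)"] by auto
    moreover have "set (ball_step (fst (st i))) = ball u (Suc (snd (st i)))"
      using Suc set_vs by (auto simp: ball_step_def)
    ultimately show ?case
      using Suc unfolding Suc_st bfs_step_def by (auto simp: case_prod_beta)
  qed (simp add: st_def)
  have "bfs u v = st (card V)"
    by (simp add: bfs_def fold_const st_def length_vs)
  then show "v \<in> set (fst (bfs u v)) \<longleftrightarrow> reach u v"
    "snd (bfs u v) = (if reach u v then dst u v else card V)"
    using st[of "card V"] dst_less_card[OF assms, of v] in_ball_iff[OF assms, of v "snd (st (card V))"]
    by auto
qed

text \<open>Reachability is tested for \<open>v\<close> only: if \<open>v\<close> is reachable but
  \<open>w\<close> is not, a summand equal to \<open>card V\<close> makes the equation fail.\<close>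

lemma interval_bfs:
  assumes "u \<in> V" "v \<in> V" "w \<in> V"
  shows "w \<in> interval u v \<longleftrightarrow> v \<in> set (fst (bfs u v)) \<and>
    snd (bfs u w) + snd (bfs w v) = snd (bfs u v)"
  using bfs[OF assms(1)] bfs[OF assms(3)] dst_less_card[OF assms(1), of v]
    reach_trans[OF assms(1), of w v] geodesic_interval_iff[OF assms(1), of w v]
  by auto

text \<open>The vertices added are the splitters of \<open>W\<close>, those that see two elements of
  \<open>W\<close> differently.\<close>

definition closure_step :: "'a list \<Rightarrow> 'a list" where
  "closure_step W = filter (\<lambda>w. w \<in> set W \<or> (\<exists>a\<in>set W. adj a w) \<and> (\<exists>a\<in>set W. \<not> adj a w)) vs"

definition closure :: "'a list \<Rightarrow> 'a list" where
  "closure W = fold (\<lambda>_. closure_step) vs W"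

text \<open>The result is the least module containing \<open>W\<close>: a splitter of a subset of a
  module \<open>U\<close> cannot lie outside \<open>U\<close>, and a set without outer splitters is
  a module.\<close>

lemma closure:
  assumes "set W \<subseteq> V"
  shows "set W \<subseteq> set (closure W)" "homogeneous (set (closure W))"
    "homogeneous U \<Longrightarrow> set W \<subseteq> U \<Longrightarrow> set (closure W) \<subseteq> U"
proof -
  define F where "F X = {w \<in> V. w \<in> X \<or> (\<exists>a\<in>X. adj a w) \<and> (\<exists>a\<in>X. \<not> adj a w)}" for X
  have step: "set (closure_step W) = F (set W)" for W
    by (auto simp: closure_step_def F_def set_vs)
  have "set ((closure_step ^^ i) W) = (F ^^ i) (set W)" for i
    by (induction i) (simp_all add: step)
  then have eq: "set (closure W) = (F ^^ card V) (set W)"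
    by (simp add: closure_def fold_const length_vs)
  have F: "X \<subseteq> F X \<and> F X \<subseteq> V" if "X \<subseteq> V" for X
    using that by (auto simp: F_def)
  note fix_F = funpow_extensive_fixpoint[OF finite_V assms, of F, OF F]
  show "set W \<subseteq> set (closure W)"
    unfolding eq by (rule fix_F)
  define X where "X = (F ^^ card V) (set W)"
  have X: "F X = X" "X \<subseteq> V" using fix_F by (simp_all add: X_def)
  show "homogeneous (set (closure W))"
    unfolding eq X_def[symmetric] homogeneous_def
  proof (intro conjI ballI impI)
    fix y a b
    assume "y \<in> V - X" "a \<in> X" "b \<in> X" "adj y a"
    then have "adj b y" using X(1) adj_sym[of y a] unfolding F_def by blast
    then show "adj y b" using adj_sym by blast
  qed (use X in simp)
  show "set (closure W) \<subseteq> U" if "homogeneous U" "set W \<subseteq> U"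
  proof -
    have "F X \<subseteq> U" if "X \<subseteq> U" for X
    proof
      fix w
      assume w: "w \<in> F X"
      show "w \<in> U"
      proof (rule ccontr)
        assume "w \<notin> U"
        then have "w \<notin> X" using that by blast
        then obtain a b where "a \<in> X" "adj a w" "b \<in> X" "\<not> adj b w" "w \<in> V"
          using w unfolding F_def by auto
        then have "a \<in> U" "adj a w" "b \<in> U" "\<not> adj b w" "w \<in> V"
          using that by auto
        then show False
          using \<open>homogeneous U\<close> \<open>w \<notin> U\<close> adj_sym[of _ w] unfolding homogeneous_def by blast
      qed
    qed
    then have "(F ^^ i) (set W) \<subseteq> U" for i
      using \<open>set W \<subseteq> U\<close> by (induction i) auto
    then show ?thesis unfolding eq .
  qed
qed

definition covered :: "'a list list \<Rightarrow> 'a set" where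
  "covered acc = (\<Union>A\<in>set acc. set A)"

definition grow_step :: "'a list list \<Rightarrow> 'a \<Rightarrow> 'a list \<Rightarrow> 'a list" where
  "grow_step acc u W = (let U = closure (u # W) in
    if nb (set U) \<noteq> {} \<and> set U \<inter> covered acc = {} then U else W)"

definition grow :: "'a list list \<Rightarrow> 'a \<Rightarrow> 'a list" where
  "grow acc v = fold (grow_step acc) vs [v]"

definition part_ok :: "'a list list \<Rightarrow> 'a list \<Rightarrow> bool" where
  "part_ok acc A \<longleftrightarrow> A \<noteq> [] \<and> homogeneous (set A) \<and> (nb (set A) = {} \<longrightarrow> (\<exists>x. set A = {x})) \<and>
    set A \<inter> covered acc = {}"

lemma grow_step_ok:
  assumes "part_ok acc W" "u \<in> V"
  shows "part_ok acc (grow_step acc u W)" "set W \<subseteq> set (grow_step acc u W)"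
proof -
  have "set (u # W) \<subseteq> V" using assms by (auto simp: part_ok_def homogeneous_def)
  note cl = closure(1,2)[OF this]
  show "set W \<subseteq> set (grow_step acc u W)"
    using cl(1) by (auto simp: grow_step_def Let_def)
  show "part_ok acc (grow_step acc u W)"
    using assms(1) cl by (auto simp: grow_step_def Let_def part_ok_def)
qed

lemma fold_grow_step:
  assumes "part_ok acc W" "set us \<subseteq> V"
  shows "part_ok acc (fold (grow_step acc) us W)" "set W \<subseteq> set (fold (grow_step acc) us W)"
  using assms
proof (induction us arbitrary: W)
  case (Cons u us)
  {
    case 1
    then show ?case using Cons.IH(1) grow_step_ok[of acc W u] by auto
  next
    case 2
    then show ?case using Cons.IH(2) grow_step_ok[of acc W u] by fastforce
  }
qed simp_all

text \<open>This is why one pass over the vertices suffices. An admissible module \<open>U\<close>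
  around the result contains every intermediate \<open>W\<close>; when \<open>u\<close> in
  \<open>U\<close> is inspected, the closure of \<open>u # W\<close> stays inside \<open>U\<close>,
  so it avoids the covered vertices, keeps a neighbour and is accepted.\<close>

lemma fold_grow_step_max:
  assumes "part_ok acc W" "set us \<subseteq> V"
    and U: "homogeneous U" "nb U \<noteq> {}" "U \<inter> covered acc = {}"
    and "set (fold (grow_step acc) us W) \<subseteq> U"
  shows "set us \<inter> U \<subseteq> set (fold (grow_step acc) us W)"
  using assms(1,2,6)
proof (induction us arbitrary: W)
  case (Cons u us)
  let ?W = "grow_step acc u W"
  have ok: "part_ok acc ?W" "set W \<subseteq> set ?W"
    using grow_step_ok Cons.prems by auto
  have sub: "set ?W \<subseteq> set (fold (grow_step acc) us ?W)"
    using fold_grow_step(2)[OF ok(1)] Cons.prems(2) by auto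
  have "u \<in> set ?W" if "u \<in> U"
  proof -
    have WU: "set (u # W) \<subseteq> U" "set (u # W) \<subseteq> V"
    proof -
      show "set (u # W) \<subseteq> U"
        using that ok(2) sub Cons.prems(3) by auto
      then show "set (u # W) \<subseteq> V"
        using U(1) unfolding homogeneous_def by blast
    qed
    note cl = closure(1)[OF WU(2)] closure(3)[OF WU(2) U(1) WU(1)]
    \<comment> \<open>A neighbour of \<open>U\<close> is adjacent to all of \<open>U\<close>, so it
      remains a neighbour of the smaller closure.\<close>
    obtain y where y: "y \<in> nb U" using U(2) by blast
    then have "adj y u" "y \<in> V - set (closure (u # W))"
      using nb_adj[OF U(1) y that] cl(2) by (auto simp: nb_def)
    then have "nb (set (closure (u # W))) \<noteq> {}"
      using cl(1) by (auto simp: nb_def)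
    then show ?thesis
      using cl U(3) by (auto simp: grow_step_def Let_def)
  qed
  moreover have "set us \<inter> U \<subseteq> set (fold (grow_step acc) us ?W)"
    using Cons.IH[OF ok(1)] Cons.prems by auto
  ultimately show ?case using sub by auto
qed simp

text \<open>The list grows at its head, so the maximality of \<open>A\<close> refers only to the
  parts in \<open>acc\<close>, which existed when \<open>A\<close> was grown.\<close>

primrec valid :: "'a list list \<Rightarrow> bool" where
  "valid [] = True"
| "valid (A # acc) = (valid acc \<and> part_ok acc A \<and>
    (\<forall>U. homogeneous U \<longrightarrow> nb U \<noteq> {} \<longrightarrow> U \<inter> covered acc = {} \<longrightarrow> set A \<subseteq> U \<longrightarrow> U \<subseteq> set A))"

definition part_step :: "'a \<Rightarrow> 'a list list \<Rightarrow> 'a list list" where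
  "part_step v acc = (if v \<in> covered acc then acc else grow acc v # acc)"

definition parts :: "'a list list" where
  "parts = fold part_step vs []"

lemma part_step_valid:
  assumes "valid acc" "v \<in> V"
  shows "valid (part_step v acc)" "insert v (covered acc) \<subseteq> covered (part_step v acc)"
proof -
  have "valid (grow acc v # acc)" "v \<in> set (grow acc v)" if "v \<notin> covered acc"
  proof -
    have ok: "part_ok acc [v]"
      using that assms(2) by (auto simp: part_ok_def homogeneous_def)
    note gr = fold_grow_step[OF ok, of vs, folded grow_def]
    show "v \<in> set (grow acc v)" using gr(2) set_vs by auto
    have "U \<subseteq> set (grow acc v)"
      if "homogeneous U" "nb U \<noteq> {}" "U \<inter> covered acc = {}" "set (grow acc v) \<subseteq> U" for U
    proof -
      have "set vs \<inter> U \<subseteq> set (grow acc v)"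
        unfolding grow_def
        by (rule fold_grow_step_max[OF ok _ that(1-3)]) (use that(4) set_vs in \<open>simp_all add: grow_def\<close>)
      then show ?thesis using that(1) set_vs unfolding homogeneous_def by blast
    qed
    then show "valid (grow acc v # acc)"
      using assms(1) gr(1) set_vs by auto
  qed
  then show "valid (part_step v acc)" "insert v (covered acc) \<subseteq> covered (part_step v acc)"
    using assms(1) by (auto simp: part_step_def covered_def)
qed

lemma parts_valid: "valid parts" "covered parts = V"
proof -
  have *: "valid (fold part_step us acc) \<and>
      set us \<union> covered acc \<subseteq> covered (fold part_step us acc)"
    if "valid acc" "set us \<subseteq> V" for us acc
    using that
  proof (induction us arbitrary: acc)
    case (Cons u us)
    then have "valid (part_step u acc)" "insert u (covered acc) \<subseteq> covered (part_step u acc)"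
      using part_step_valid[of acc u] by auto
    then show ?case
      using Cons.IH[of "part_step u acc"] Cons.prems(2) by auto
  qed simp
  show "valid parts"
    using *[of "[]" vs] set_vs by (simp add: parts_def)
  moreover have "covered acc \<subseteq> V" if "valid acc" for acc
    using that by (induction acc) (auto simp: covered_def part_ok_def homogeneous_def)
  moreover have "V \<subseteq> covered parts"
    using *[of "[]" vs] set_vs by (simp add: parts_def)
  ultimately show "covered parts = V" by blast
qed

lemma valid_part: "valid acc \<Longrightarrow> A \<in> set acc \<Longrightarrow>
    A \<noteq> [] \<and> homogeneous (set A) \<and> (nb (set A) = {} \<longrightarrow> (\<exists>x. set A = {x}))"
  by (induction acc) (auto simp: part_ok_def)

lemma valid_disjoint:
  "valid acc \<Longrightarrow> distinct (map set acc) \<and> disjoint (set ` set acc)"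
proof (induction acc)
  case (Cons A acc)
  then have "set A \<noteq> {}" "set A \<inter> set B = {}" if "B \<in> set acc" for B
    using that by (auto simp: part_ok_def covered_def)
  note A = this
  have "set A \<notin> set ` set acc"
    using A by (metis Int_absorb imageE)
  moreover have "pairwise disjnt (insert (set A) (set ` set acc))"
    using Cons A(2) unfolding pairwise_insert disjnt_def by auto
  ultimately show ?case using Cons by simp
qed simp

text \<open>Take the earliest part inside \<open>U\<close>. When it was grown, no vertex of
  \<open>U\<close> was covered, so its maximality applies to \<open>U\<close>. Thus maximality at
  construction time becomes maximality among all parts.\<close>

lemma valid_maximal:
  assumes "valid acc" "homogeneous U" "nb U \<noteq> {}"
    and "\<And>B. B \<in> set acc \<Longrightarrow> set B \<subseteq> U \<or> set B \<inter> U = {}"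
    and "\<exists>B\<in>set acc. set B \<subseteq> U"
  shows "\<exists>B\<in>set acc. U \<subseteq> set B"
  using assms(1,4,5)
proof (induction acc)
  case (Cons A acc)
  show ?case
  proof (cases "\<exists>B\<in>set acc. set B \<subseteq> U")
    case False
    then have "U \<inter> covered acc = {}" "set A \<subseteq> U"
      using Cons.prems by (auto simp: covered_def)
    then show ?thesis using Cons.prems(1) assms(2,3) by auto
  qed (use Cons in auto)
qed simp

lemma maximal_partition_parts: "maximal_partition G (set ` set parts)"
proof unfold_locales
  have ok: "A \<noteq> [] \<and> homogeneous (set A) \<and> (nb (set A) = {} \<longrightarrow> (\<exists>x. set A = {x}))"
    if "A \<in> set parts" for A
    using valid_part[OF parts_valid(1) that] .
  have disj: "disjoint (set ` set parts)"
    using valid_disjoint parts_valid by blast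
  show "partition_on V (set ` set parts)"
    using disj parts_valid(2) ok by (auto simp: partition_on_def covered_def)
  show "homogeneous c" if "c \<in> set ` set parts" for c
    using ok that by blast
  show "\<exists>x. c = {x}" if "c \<in> set ` set parts" "nb c = {}" for c
    using ok that by blast
  show "nb (\<Union>Q) = {}"
    if Q: "Q \<subseteq> set ` set parts" "2 \<le> card Q" "homogeneous (\<Union>Q)" for Q
  proof (rule ccontr)
    assume "nb (\<Union>Q) \<noteq> {}"
    moreover have "set B \<subseteq> \<Union>Q \<or> set B \<inter> \<Union>Q = {}" if "B \<in> set parts" for B
    proof (cases "set B \<in> Q")
      case False
      have "set B \<inter> q = {}" if "q \<in> Q" for q
      proof -
        have "q \<in> set ` set parts" "set B \<noteq> q" using that Q(1) False by blast+
        then show ?thesis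
          using disjointD[OF disj] \<open>B \<in> set parts\<close> by blast
      qed
      then show ?thesis by blast
    qed blast
    moreover obtain q where "q \<in> Q" using Q(2) by fastforce
    then have "\<exists>B\<in>set parts. set B \<subseteq> \<Union>Q" using Q(1) by blast
    ultimately obtain B where B: "B \<in> set parts" "\<Union>Q \<subseteq> set B"
      using valid_maximal[OF parts_valid(1) Q(3)] by blast
    have "q = set B" if "q \<in> Q" for q
    proof -
      obtain A where A: "A \<in> set parts" "q = set A" using \<open>q \<in> Q\<close> Q(1) by blast
      then have "q \<noteq> {}" "q \<subseteq> set B" using ok B(2) that by auto
      then show ?thesis using disjointD[OF disj, of q "set B"] A B(1) by blast
    qed
    then have "Q \<subseteq> {set B}" by blast
    then have "card Q \<le> 1" using card_mono[of "{set B}" Q] by simp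
    then show False using Q(2) by simp
  qed
qed

definition good :: "('a \<times> 'a) list \<Rightarrow> 'a list \<Rightarrow> 'a \<Rightarrow> bool" where
  "good ts c x \<longleftrightarrow> \<not> (\<exists>(u, v)\<in>set ts. inner (set c) u v \<and> x \<notin> interval u v)"

text \<open>The representative is prepended and also stays in its old place: correctness depends
  only on the head and the set of the list. If no vertex is good, any head will do.\<close>

definition with_rep :: "('a \<times> 'a) list \<Rightarrow> 'a list \<Rightarrow> 'a list" where
  "with_rep ts c = (case filter (good ts c) c of [] \<Rightarrow> hd c | x # _ \<Rightarrow> x) # c"

lemma set_with_rep: "c \<noteq> [] \<Longrightarrow> set (with_rep ts c) = set c"
proof -
  assume "c \<noteq> []"
  moreover have "x \<in> set c" if "filter (good ts c) c = x # xs" for x xs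
    using arg_cong[OF that, of set] by auto
  ultimately show ?thesis
    by (auto simp: with_rep_def split: list.splits)
qed

lemma good_with_rep:
  assumes "x \<in> set c" "good ts c x"
  shows "good ts c (hd (with_rep ts c))"
proof -
  have "filter (good ts c) c \<noteq> []" using assms by (auto simp: filter_empty_conv)
  then obtain y ys where y: "filter (good ts c) c = y # ys" by (cases "filter (good ts c) c") auto
  then have "good ts c y" using filter_eq_ConsD[OF y] by auto
  then show ?thesis using y by (simp add: with_rep_def)
qed

end

locale listed_nat_graph = listed_graph G vs for G :: "nat graph" and vs +
  fixes ts :: "(nat \<times> nat) list"
  assumes ts_V: "set ts \<subseteq> V \<times> V"
begin

definition ps :: "nat list list" where
  "ps = map (with_rep ts) parts"

sublocale token_search G "set ` set parts" ps ts
proof -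
  interpret maximal_partition G "set ` set parts"
    by (rule maximal_partition_parts)
  have swr: "set (with_rep ts c) = set c" if "c \<in> set parts" for c
    using set_with_rep valid_part[OF parts_valid(1) that] by blast
  show "token_search G (set ` set parts) ps ts"
  proof unfold_locales
    show "set ` set ps = set ` set parts"
      using swr by (simp add: image_image ps_def)
    have "map set ps = map set parts"
      using swr by (simp add: ps_def)
    then show "distinct (map set ps)"
      using valid_disjoint parts_valid(1) by metis
    show "hd c \<in> interval u v"
      if c: "c \<in> set ps" "x \<in> set c"
        and x: "\<And>u v. (u, v) \<in> set ts \<Longrightarrow> inner (set c) u v \<Longrightarrow> x \<in> interval u v"
        and uv: "(u, v) \<in> set ts" "inner (set c) u v" for c x u v
    proof -
      obtain c' where c': "c' \<in> set parts" "c = with_rep ts c'" using c by (auto simp: ps_def)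
      then have "set c = set c'" using swr by blast
      then have "good ts c' x" using x by (auto simp: good_def)
      then have "good ts c' (hd c)"
        using good_with_rep c' c(2) \<open>set c = set c'\<close> by metis
      then show ?thesis using uv \<open>set c = set c'\<close> by (auto simp: good_def)
    qed
  qed (rule ts_V)
qed

end

section \<open>From values of expressions to step counts\<close>

section \<open>Deriving running times\<close>

fun esize :: "expr \<Rightarrow> nat" where
  "esize (Var i) = 1"
| "esize (Lit m) = 1"
| "esize (Add a b) = esize a + esize b + 1"
| "esize (Sub a b) = esize a + esize b + 1"
| "esize (MkCell a b) = esize a + esize b + 1"
| "esize (Fst a) = esize a + 1"
| "esize (Snd a) = esize a + 1"
| "esize (IsCell a) = esize a + 1"
| "esize (IfNonzero a b c) = esize a + esize b + esize c + 1"
| "esize (LetIn a b) = esize a + esize b + 1"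
| "esize (Call f es) = sum_list (map esize es) + 1"

definition computes :: "prog \<Rightarrow> nat \<Rightarrow> nat \<Rightarrow> val list \<Rightarrow> val \<Rightarrow> bool" where
  "computes P K f args v \<longleftrightarrow> f < length P \<and> (\<exists>t\<le>K. eval P args (P ! f) v t)"

lemma computes_mono: "computes P K f args v \<Longrightarrow> K \<le> K' \<Longrightarrow> computes P K' f args v"
  unfolding computes_def using order_trans by blast

text \<open>By determinism a bounded computation has at most one value, so calls can be treated as a
  partial function; this form is what makes \<open>den\<close> executable by rewriting.\<close>

definition res :: "prog \<Rightarrow> nat \<Rightarrow> nat \<Rightarrow> val list \<Rightarrow> val option" where
  "res P K f args =
    (if \<exists>v. computes P K f args v then Some (THE v. computes P K f args v) else None)"

lemma res_Some: "res P K f args = Some v \<longleftrightarrow> computes P K f args v"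
proof -
  have "v = w" if "computes P K f args v" "computes P K f args w" for v w
    using that eval_deterministic(1) unfolding computes_def by blast
  then have "computes P K f args v \<Longrightarrow> (THE v. computes P K f args v) = v" for v
    by blast
  then show ?thesis by (auto simp: res_def)
qed

text \<open>
  Evaluation of an expression in which every call is charged at most \<open>K\<close> steps; it is a
  function, so that bodies without recursion can be evaluated by the simplifier.
\<close>

fun den :: "prog \<Rightarrow> nat \<Rightarrow> val list \<Rightarrow> expr \<Rightarrow> val option" where
  "den P K env (Var i) = (if i < length env then Some (env ! i) else None)"
| "den P K env (Lit m) = Some (N m)"
| "den P K env (Add a b) = (case den P K env a of Some (N x) \<Rightarrow>
    (case den P K env b of Some (N y) \<Rightarrow> Some (N (x + y)) | _ \<Rightarrow> None) | _ \<Rightarrow> None)"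
| "den P K env (Sub a b) = (case den P K env a of Some (N x) \<Rightarrow>
    (case den P K env b of Some (N y) \<Rightarrow> Some (N (x - y)) | _ \<Rightarrow> None) | _ \<Rightarrow> None)"
| "den P K env (MkCell a b) = (case den P K env a of Some v \<Rightarrow>
    (case den P K env b of Some w \<Rightarrow> Some (Cell v w) | _ \<Rightarrow> None) | _ \<Rightarrow> None)"
| "den P K env (Fst a) = (case den P K env a of Some (Cell v w) \<Rightarrow> Some v | _ \<Rightarrow> None)"
| "den P K env (Snd a) = (case den P K env a of Some (Cell v w) \<Rightarrow> Some w | _ \<Rightarrow> None)"
| "den P K env (IsCell a) = (case den P K env a of Some (Cell v w) \<Rightarrow> Some (N 1)
    | Some (N m) \<Rightarrow> Some (N 0) | _ \<Rightarrow> None)"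
| "den P K env (IfNonzero a b c) = (case den P K env a of Some (N x) \<Rightarrow>
    (if x \<noteq> 0 then den P K env b else den P K env c) | _ \<Rightarrow> None)"
| "den P K env (LetIn a b) = (case den P K env a of Some v \<Rightarrow> den P K (v # env) b | _ \<Rightarrow> None)"
| "den P K env (Call f es) = (case those (map (den P K env) es) of Some vs \<Rightarrow> res P K f vs | _ \<Rightarrow> None)"

lemma eval_args_bound:
  assumes "\<And>e v. e \<in> set es \<Longrightarrow> den P K env e = Some v \<Longrightarrow> \<exists>t\<le>esize e * c. eval P env e v t"
    and "those (map (den P K env) es) = Some vs"
  shows "\<exists>t\<le>sum_list (map esize es) * c. eval_args P env es vs t"
  using assms
proof (induction es arbitrary: vs)
  case Nil
  then show ?case by (auto intro: Args_Nil)
next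
  case (Cons e es)
  from Cons.prems(2) obtain v vs' where v: "den P K env e = Some v"
    "those (map (den P K env) es) = Some vs'" "vs = v # vs'"
    by (auto split: option.splits)
  from Cons.prems(1)[OF _ v(1)] obtain s where s: "s \<le> esize e * c" "eval P env e v s" by auto
  from Cons.IH[OF Cons.prems(1) v(2)] obtain t where
    t: "t \<le> sum_list (map esize es) * c" "eval_args P env es vs' t" by auto
  have "eval_args P env (e # es) vs (s + t)" using s t v by (auto intro: Args_Cons)
  moreover have "s + t \<le> sum_list (map esize (e # es)) * c"
    using s t by (simp add: add_mult_distrib)
  ultimately show ?case by blast
qed

text \<open>Each node is evaluated at most once at a cost of one step, and a call adds at most
  \<open>K\<close>.\<close>

lemma den_eval:
  "den P K env e = Some v \<Longrightarrow> \<exists>t\<le>esize e * Suc K. eval P env e v t"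
proof (induction e arbitrary: env v)
  case (Var i)
  then show ?case using eval_eval_args.Var[of i env P] by (auto split: if_splits)
next
  case (Lit m)
  then show ?case using eval_eval_args.Lit[of P env m] by auto
next
  case (Add a b)
  then obtain x y where xy: "den P K env a = Some (N x)" "den P K env b = Some (N y)" "v = N (x + y)"
    by (auto split: option.splits val.splits)
  obtain s t where "s \<le> esize a * Suc K" "eval P env a (N x) s"
    "t \<le> esize b * Suc K" "eval P env b (N y) t"
    using Add.IH xy by meson
  then show ?case
    using xy by (intro exI[of _ "s + t + 1"]) (auto intro: eval_eval_args.Add[simplified] simp: add_mult_distrib)
next
  case (Sub a b)
  then obtain x y where xy: "den P K env a = Some (N x)" "den P K env b = Some (N y)" "v = N (x - y)"
    by (auto split: option.splits val.splits)
  obtain s t where "s \<le> esize a * Suc K" "eval P env a (N x) s"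
    "t \<le> esize b * Suc K" "eval P env b (N y) t"
    using Sub.IH xy by meson
  then show ?case
    using xy by (intro exI[of _ "s + t + 1"]) (auto intro: eval_eval_args.Sub[simplified] simp: add_mult_distrib)
next
  case (MkCell a b)
  then obtain x y where xy: "den P K env a = Some x" "den P K env b = Some y" "v = Cell x y"
    by (auto split: option.splits val.splits)
  obtain s t where "s \<le> esize a * Suc K" "eval P env a x s"
    "t \<le> esize b * Suc K" "eval P env b y t"
    using MkCell.IH xy by meson
  then show ?case
    using xy by (intro exI[of _ "s + t + 1"]) (auto intro: eval_eval_args.MkCell[simplified] simp: add_mult_distrib)
next
  case (Fst a)
  then obtain w where w: "den P K env a = Some (Cell v w)"
    by (auto split: option.splits val.splits)
  obtain s where "s \<le> esize a * Suc K" "eval P env a (Cell v w) s"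
    using Fst.IH w by meson
  then show ?case
    by (intro exI[of _ "s + 1"]) (auto intro: eval_eval_args.Fst[simplified])
next
  case (Snd a)
  then obtain w where w: "den P K env a = Some (Cell w v)"
    by (auto split: option.splits val.splits)
  obtain s where "s \<le> esize a * Suc K" "eval P env a (Cell w v) s"
    using Snd.IH w by meson
  then show ?case
    by (intro exI[of _ "s + 1"]) (auto intro: eval_eval_args.Snd[simplified])
next
  case (IsCell a)
  then consider x y where "den P K env a = Some (Cell x y)" "v = N 1"
    | m where "den P K env a = Some (N m)" "v = N 0"
    by (auto split: option.splits val.splits)
  then show ?case
  proof cases
    case 1
    obtain s where "s \<le> esize a * Suc K" "eval P env a (Cell x y) s"
      using IsCell.IH 1 by meson
    then show ?thesis
      using 1 by (intro exI[of _ "s + 1"]) (auto intro: eval_eval_args.IsCell_True[simplified])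
  next
    case 2
    obtain s where "s \<le> esize a * Suc K" "eval P env a (N m) s"
      using IsCell.IH 2 by meson
    then show ?thesis
      using 2 by (intro exI[of _ "s + 1"]) (auto intro: eval_eval_args.IsCell_False[simplified])
  qed
next
  case (IfNonzero a b c)
  then obtain x where x: "den P K env a = Some (N x)"
    "den P K env (if x \<noteq> 0 then b else c) = Some v"
    by (auto split: option.splits val.splits if_splits)
  obtain s where s: "s \<le> esize a * Suc K" "eval P env a (N x) s"
    using IfNonzero.IH(1) x by meson
  show ?case
  proof (cases "x = 0")
    case False
    then obtain t where "t \<le> esize b * Suc K" "eval P env b v t"
      using IfNonzero.IH(2) x(2) by auto
    then show ?thesis
      using s False by (intro exI[of _ "s + t + 1"])
        (auto intro: eval_eval_args.If_True[simplified] simp: add_mult_distrib)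
  next
    case True
    then obtain t where "t \<le> esize c * Suc K" "eval P env c v t"
      using IfNonzero.IH(3) x(2) by auto
    then show ?thesis
      using s True by (intro exI[of _ "s + t + 1"])
        (auto intro: eval_eval_args.If_False[simplified] simp: add_mult_distrib)
  qed
next
  case (LetIn a b)
  then obtain x where x: "den P K env a = Some x" "den P K (x # env) b = Some v"
    by (auto split: option.splits)
  obtain s t where "s \<le> esize a * Suc K" "eval P env a x s"
    "t \<le> esize b * Suc K" "eval P (x # env) b v t"
    using LetIn.IH x by meson
  then show ?case
    by (intro exI[of _ "s + t + 1"])
      (auto intro: eval_eval_args.LetIn[simplified] simp: add_mult_distrib)
next
  case (Call f es)
  then obtain vs where vs: "those (map (den P K env) es) = Some vs" "computes P K f vs v"
    by (auto split: option.splits simp: res_Some)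
  obtain s where s: "s \<le> sum_list (map esize es) * Suc K" "eval_args P env es vs s"
    using eval_args_bound[OF _ vs(1), of "Suc K"] Call.IH by blast
  obtain t where "f < length P" "t \<le> K" "eval P vs (P ! f) v t"
    using vs(2) by (auto simp: computes_def)
  then show ?case
    using s by (intro exI[of _ "s + t + 1"]) (auto intro: eval_eval_args.Call[simplified])
qed

lemma computes_den:
  "f < length P \<Longrightarrow> den P K env (P ! f) = Some v \<Longrightarrow> esize (P ! f) * Suc K \<le> K' \<Longrightarrow>
    computes P K' f env v"
  using den_eval[of P K env "P ! f" v] order_trans unfolding computes_def by blast

section \<open>Loops over lists\<close>

text \<open>
  \<open>i\<close> is the position of the loop itself in the program.
\<close>

definition any_loop :: "nat \<Rightarrow> nat \<Rightarrow> expr" where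
  "any_loop i j = IfNonzero (IsCell (Var 0))
    (IfNonzero (Call j [Fst (Var 0), Var 1]) (Lit 1) (Call i [Snd (Var 0), Var 1])) (Lit 0)"

definition filter_loop :: "nat \<Rightarrow> nat \<Rightarrow> expr" where
  "filter_loop i j = IfNonzero (IsCell (Var 0))
    (IfNonzero (Call j [Fst (Var 0), Var 1])
      (MkCell (Fst (Var 0)) (Call i [Snd (Var 0), Var 1])) (Call i [Snd (Var 0), Var 1])) (Lit 0)"

definition map_loop :: "nat \<Rightarrow> nat \<Rightarrow> expr" where
  "map_loop i j = IfNonzero (IsCell (Var 0))
    (MkCell (Call j [Fst (Var 0), Var 1]) (Call i [Snd (Var 0), Var 1])) (Lit 0)"

definition fold_loop :: "nat \<Rightarrow> nat \<Rightarrow> expr" where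
  "fold_loop i j = IfNonzero (IsCell (Var 0))
    (Call i [Snd (Var 0), Call j [Fst (Var 0), Var 1, Var 2], Var 2]) (Var 1)"

abbreviation bv :: "bool \<Rightarrow> val" where
  "bv b \<equiv> N (of_bool b)"

lemma eval_weaken:
  assumes "eval P env e v t" "v = v'" "t = t'"
  shows "eval P env e v' t'"
  using assms by simp

lemma loop_end:
  assumes "i < length P" "P ! i = IfNonzero (IsCell (Var 0)) a b" "eval P env b v 1"
    "env \<noteq> []" "hd env = N 0"
  shows "computes P 4 i env v"
proof -
  have "eval P env (Var 0) (N 0) 1"
    using Var[of 0 env P] assms(4,5) by (simp add: hd_conv_nth)
  note If_False[OF IsCell_False[OF this] assms(3), of a]
  then show ?thesis
    unfolding computes_def using assms(1,2) by (intro conjI exI[of _ 4]) (auto simp: eval_nat_numeral)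
qed

lemma loop_cell:
  assumes "i < length P" "P ! i = IfNonzero (IsCell (Var 0)) a b" "eval P (Cell x xs # env) a v t"
  shows "computes P (t + 3) i (Cell x xs # env) v"
proof -
  have "eval P (Cell x xs # env) (Var 0) (Cell x xs) 1"
    using Var[of 0 "Cell x xs # env" P] by simp
  note If_True[OF IsCell_True[OF this] _ assms(3), of b]
  then show ?thesis
    unfolding computes_def using assms(1,2) by (intro conjI exI[of _ "t + 3"]) (auto simp: eval_nat_numeral)
qed

lemma call_computes:
  assumes "computes P K f vs v" "eval_args P env es vs s"
  obtains t where "t \<le> K" "eval P env (Call f es) v (s + t + 1)"
proof -
  obtain t where t: "t \<le> K" "f < length P" "eval P vs (P ! f) v t"
    using assms(1) by (auto simp: computes_def)
  then show ?thesis
    using that[OF t(1)] Call[OF t(2) assms(2) t(3)] by blast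
qed

lemma loop_args:
  "eval_args P [Cell x xs, c] [Fst (Var 0), Var 1] [x, c] 3"
  "eval_args P [Cell x xs, c] [Snd (Var 0), Var 1] [xs, c] 3"
  "eval_args P [Cell x xs, a, c] [Fst (Var 0), Var 1, Var 2] [x, a, c] 4"
proof -
  have v: "eval P [Cell x xs, c] (Var 0) (Cell x xs) 1" "eval P [Cell x xs, c] (Var 1) c 1"
    using Var[of 0 "[Cell x xs, c]" P] Var[of 1 "[Cell x xs, c]" P] by simp_all
  have w: "eval P [Cell x xs, a, c] (Var 0) (Cell x xs) 1" "eval P [Cell x xs, a, c] (Var 1) a 1"
    "eval P [Cell x xs, a, c] (Var 2) c 1"
    using Var[of 0 "[Cell x xs, a, c]" P] Var[of 1 "[Cell x xs, a, c]" P]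
      Var[of 2 "[Cell x xs, a, c]" P] by simp_all
  show "eval_args P [Cell x xs, c] [Fst (Var 0), Var 1] [x, c] 3"
    using Args_Cons[OF Fst[OF v(1)] Args_Cons[OF v(2) Args_Nil]] by (simp add: eval_nat_numeral)
  show "eval_args P [Cell x xs, c] [Snd (Var 0), Var 1] [xs, c] 3"
    using Args_Cons[OF Snd[OF v(1)] Args_Cons[OF v(2) Args_Nil]] by (simp add: eval_nat_numeral)
  show "eval_args P [Cell x xs, a, c] [Fst (Var 0), Var 1, Var 2] [x, a, c] 4"
    using Args_Cons[OF Fst[OF w(1)] Args_Cons[OF w(2) Args_Cons[OF w(3) Args_Nil]]]
    by (simp add: eval_nat_numeral)
qed

text \<open>The constant 15 is shared by all loop schemes and covers testing, argument passing and
  the recursive call for one entry; the filter loop with its additional cell uses all of it.\<close>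

lemma computes_any_loop_exact:
  assumes P: "i < length P" "P ! i = any_loop i j"
    and "\<And>x. x \<in> set xs \<Longrightarrow> computes P K j [h x, c] (bv (Q x))"
  shows "computes P (length xs * (K + 15) + 5) i [enc_list (map h xs), c] (bv (\<exists>x\<in>set xs. Q x))"
  using assms(3)
proof (induction xs)
  case Nil
  show ?case
    by (rule computes_mono[OF loop_end[OF P(1) P(2)[unfolded any_loop_def]]])
      (use Lit[of P _ 0] in auto)
next
  case (Cons x xs)
  let ?L = "enc_list (map h xs)"
  obtain t where t: "t \<le> K" "eval P [Cell (h x) ?L, c] (Call j [Fst (Var 0), Var 1]) (bv (Q x)) (3 + t + 1)"
    using call_computes[OF Cons.prems loop_args(1)] by auto
  show ?case
  proof (cases "Q x")
    case True
    then have "eval P [Cell (h x) ?L, c]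
      (IfNonzero (Call j [Fst (Var 0), Var 1]) (Lit 1) (Call i [Snd (Var 0), Var 1])) (N 1) (t + 6)"
      using If_True[OF t(2) _ Lit[of P _ 1]] by (simp add: eval_nat_numeral)
    from computes_mono[OF loop_cell[OF P(1) P(2)[unfolded any_loop_def] this]] t(1) True
    show ?thesis by simp
  next
    case False
    then have False_bv: "bv (Q x) = N 0" by simp
    have IH: "computes P (length xs * (K + 15) + 5) i [?L, c] (bv (\<exists>x\<in>set (x # xs). Q x))"
      using Cons False by auto
    obtain s where s: "s \<le> length xs * (K + 15) + 5"
      "eval P [Cell (h x) ?L, c] (Call i [Snd (Var 0), Var 1]) (bv (\<exists>x\<in>set (x # xs). Q x)) (3 + s + 1)"
      using call_computes[OF IH loop_args(2)] by auto
    have "eval P [Cell (h x) ?L, c]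
      (IfNonzero (Call j [Fst (Var 0), Var 1]) (Lit 1) (Call i [Snd (Var 0), Var 1]))
      (bv (\<exists>x\<in>set (x # xs). Q x)) (t + s + 9)"
      using eval_weaken[OF If_False[OF t(2)[unfolded False_bv] s(2)], where t' = "t + s + 9"] by simp
    from computes_mono[OF loop_cell[OF P(1) P(2)[unfolded any_loop_def] this]] t(1) s(1)
    show ?thesis by simp
  qed
qed

lemma computes_filter_loop_exact:
  assumes P: "i < length P" "P ! i = filter_loop i j"
    and "\<And>x. x \<in> set xs \<Longrightarrow> computes P K j [h x, c] (bv (Q x))"
  shows "computes P (length xs * (K + 15) + 5) i [enc_list (map h xs), c]
    (enc_list (map h (filter Q xs)))"
  using assms(3)
proof (induction xs)
  case Nil
  show ?case
    by (rule computes_mono[OF loop_end[OF P(1) P(2)[unfolded filter_loop_def]]])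
      (use Lit[of P _ 0] in auto)
next
  case (Cons x xs)
  let ?L = "enc_list (map h xs)" and ?R = "enc_list (map h (filter Q xs))"
  let ?env = "[Cell (h x) ?L, c]"
  let ?e = "IfNonzero (Call j [Fst (Var 0), Var 1])
      (MkCell (Fst (Var 0)) (Call i [Snd (Var 0), Var 1])) (Call i [Snd (Var 0), Var 1])"
  obtain t where t: "t \<le> K" "eval P ?env (Call j [Fst (Var 0), Var 1]) (bv (Q x)) (3 + t + 1)"
    using call_computes[OF Cons.prems loop_args(1)] by auto
  have IH: "computes P (length xs * (K + 15) + 5) i [?L, c] ?R"
    using Cons by auto
  obtain s where s: "s \<le> length xs * (K + 15) + 5"
    "eval P ?env (Call i [Snd (Var 0), Var 1]) ?R (3 + s + 1)"
    using call_computes[OF IH loop_args(2)] by auto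
  have "eval P ?env (Var 0) (Cell (h x) ?L) 1" using Var[of 0 ?env P] by simp
  note cell = MkCell[OF Fst[OF this] s(2)]
  have "\<exists>r\<le>t + s + 12. eval P ?env ?e (enc_list (map h (filter Q (x # xs)))) r"
  proof (cases "Q x")
    case True
    then show ?thesis
      by (intro exI[of _ "(3 + t + 1) + (1 + 1 + (3 + s + 1) + 1) + 1"] conjI
          eval_weaken[OF If_True[OF t(2) _ cell]]) auto
  next
    case False
    then have "bv (Q x) = N 0" by simp
    then show ?thesis using False
      by (intro exI[of _ "(3 + t + 1) + (3 + s + 1) + 1"] conjI
          eval_weaken[OF If_False[OF t(2)[unfolded \<open>bv (Q x) = N 0\<close>] s(2)]]) auto
  qed
  then obtain r where r: "r \<le> t + s + 12" "eval P ?env ?e (enc_list (map h (filter Q (x # xs)))) r"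
    by blast
  from computes_mono[OF loop_cell[OF P(1) P(2)[unfolded filter_loop_def] r(2)]] t(1) s(1) r(1)
  show ?case by simp
qed

lemma computes_map_loop_exact:
  assumes P: "i < length P" "P ! i = map_loop i j"
    and "\<And>x. x \<in> set xs \<Longrightarrow> computes P K j [h x, c] (h' (f x))"
  shows "computes P (length xs * (K + 15) + 5) i [enc_list (map h xs), c]
    (enc_list (map h' (map f xs)))"
  using assms(3)
proof (induction xs)
  case Nil
  show ?case
    by (rule computes_mono[OF loop_end[OF P(1) P(2)[unfolded map_loop_def]]])
      (use Lit[of P _ 0] in auto)
next
  case (Cons x xs)
  let ?L = "enc_list (map h xs)" and ?R = "enc_list (map h' (map f xs))"
  let ?env = "[Cell (h x) ?L, c]"
  obtain t where t: "t \<le> K" "eval P ?env (Call j [Fst (Var 0), Var 1]) (h' (f x)) (3 + t + 1)"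
    using call_computes[OF Cons.prems loop_args(1)] by auto
  have IH: "computes P (length xs * (K + 15) + 5) i [?L, c] ?R"
    using Cons by auto
  obtain s where s: "s \<le> length xs * (K + 15) + 5"
    "eval P ?env (Call i [Snd (Var 0), Var 1]) ?R (3 + s + 1)"
    using call_computes[OF IH loop_args(2)] by auto
  from computes_mono[OF loop_cell[OF P(1) P(2)[unfolded map_loop_def] MkCell[OF t(2) s(2)]]] t(1) s(1)
  show ?case by simp
qed

text \<open>A step is cheap only while the accumulator is short. \<open>Inv\<close>, which also sees
  the entries still to come, carries such bounds through the loop.\<close>

lemma computes_fold_loop_exact:
  assumes P: "i < length P" "P ! i = fold_loop i j"
    and step: "\<And>x xs a. Inv (x # xs) a \<Longrightarrow> computes P K j [h x, h' a, c] (h' (f x a))"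
    and inv: "\<And>x xs a. Inv (x # xs) a \<Longrightarrow> Inv xs (f x a)"
    and "Inv xs a"
  shows "computes P (length xs * (K + 15) + 5) i [enc_list (map h xs), h' a, c] (h' (fold f xs a))"
  using assms(5)
proof (induction xs arbitrary: a)
  case Nil
  have "eval P [N 0, h' a, c] (Var 1) (h' a) 1" using Var[of 1 "[N 0, h' a, c]" P] by simp
  then show ?case
    by (intro computes_mono[OF loop_end[OF P(1) P(2)[unfolded fold_loop_def]]]) auto
next
  case (Cons x xs)
  let ?L = "enc_list (map h xs)"
  let ?env = "[Cell (h x) ?L, h' a, c]"
  obtain t where t: "t \<le> K" "eval P ?env (Call j [Fst (Var 0), Var 1, Var 2]) (h' (f x a)) (4 + t + 1)"
    using call_computes[OF step[OF Cons.prems] loop_args(3)] by auto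
  have v: "eval P ?env (Var 0) (Cell (h x) ?L) 1" "eval P ?env (Var 2) c 1"
    using Var[of 0 ?env P] Var[of 2 ?env P] by simp_all
  have IH: "computes P (length xs * (K + 15) + 5) i [?L, h' (f x a), c] (h' (fold f (x # xs) a))"
    using Cons.IH[OF inv[OF Cons.prems]] by simp
  obtain s where s: "s \<le> length xs * (K + 15) + 5"
    "eval P ?env (Call i [Snd (Var 0), Call j [Fst (Var 0), Var 1, Var 2], Var 2])
      (h' (fold f (x # xs) a)) (1 + 1 + (4 + t + 1 + (1 + 0)) + s + 1)"
    using call_computes[OF IH Args_Cons[OF Snd[OF v(1)] Args_Cons[OF t(2) Args_Cons[OF v(2) Args_Nil]]]]
    by blast
  from computes_mono[OF loop_cell[OF P(1) P(2)[unfolded fold_loop_def] s(2)]] t(1) s(1)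
  show ?case by simp
qed

text \<open>Costs are kept as powers of a single \<open>n\<close>, so that only exponents have to be
  tracked: a loop of at most \<open>n\<close> rounds adds two to the exponent, a plain body
  one.\<close>

lemma loop_cost:
  fixes n l :: nat
  assumes "200 \<le> n" "l \<le> n"
  shows "l * (n ^ d + 15) + 5 \<le> n ^ (d + 2 :: nat)"
proof -
  have "1 \<le> n ^ d" using assms by simp
  then have "n ^ d + 15 \<le> 16 * n ^ d" by simp
  then have "l * (n ^ d + 15) \<le> n * (16 * n ^ d)"
    using assms by (intro mult_mono) auto
  moreover have "5 \<le> n * n ^ d" using \<open>1 \<le> n ^ d\<close> assms mult_le_mono[of 5 n 1 "n ^ d"] by simp
  moreover have "17 * (n * n ^ d) \<le> n * (n * n ^ d)" using assms by (intro mult_right_mono) auto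
  ultimately have "l * (n ^ d + 15) + 5 \<le> n * (n * n ^ d)" by linarith
  then show ?thesis by (simp add: power_add power2_eq_square mult.assoc mult.left_commute)
qed

text \<open>The threshold 200 comes from here: size at most 100, times \<open>Suc (n ^ d)\<close>,
  which is at most \<open>2 * n ^ d\<close>.\<close>

lemma computes_body:
  assumes "200 \<le> n" "f < length P" "den P (n ^ d) env (P ! f) = Some v" "esize (P ! f) \<le> 100"
  shows "computes P (n ^ Suc d) f env v"
proof (rule computes_den[OF assms(2,3)])
  have "esize (P ! f) * Suc (n ^ d) \<le> 100 * (2 * n ^ d)"
    using assms(1,4) by (intro mult_mono) auto
  also have "\<dots> \<le> n ^ Suc d" using assms(1) by simp
  finally show "esize (P ! f) * Suc (n ^ d) \<le> n ^ Suc d" .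
qed

lemma res_mono:
  assumes "computes P (n ^ d) f args v" "1 \<le> n" "d \<le> d'"
  shows "res P (n ^ d') f args = Some v"
  unfolding res_Some using assms by (intro computes_mono[OF assms(1)] power_increasing) auto

section \<open>The program\<close>

definition NotE :: "expr \<Rightarrow> expr" where "NotE a = Sub (Lit 1) a"
definition AndE :: "expr \<Rightarrow> expr \<Rightarrow> expr" where "AndE a b = IfNonzero a b (Lit 0)"
definition OrE :: "expr \<Rightarrow> expr \<Rightarrow> expr" where "OrE a b = IfNonzero a (Lit 1) b"
text \<open>Under truncated subtraction both differences vanish exactly for equal numbers;
  subtracting their sum from 1 gives a truth value.\<close>

definition EqE :: "expr \<Rightarrow> expr \<Rightarrow> expr" where "EqE a b = NotE (Add (Sub a b) (Sub b a))"
definition TripleE :: "expr \<Rightarrow> expr" where "TripleE a = Add a (Add a a)"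

abbreviation (input) "f_main \<equiv> 0 :: nat"
abbreviation (input) "f_eq \<equiv> 1 :: nat"
abbreviation (input) "f_mem \<equiv> 2 :: nat"
abbreviation (input) "f_is_edge \<equiv> 3 :: nat"
abbreviation (input) "f_edge \<equiv> 4 :: nat"
abbreviation (input) "f_adj \<equiv> 5 :: nat"
abbreviation (input) "f_near \<equiv> 6 :: nat"
abbreviation (input) "f_any_near \<equiv> 7 :: nat"
abbreviation (input) "f_in_ball \<equiv> 8 :: nat"
abbreviation (input) "f_ball \<equiv> 9 :: nat"
abbreviation (input) "f_bfs_step \<equiv> 10 :: nat"
abbreviation (input) "f_bfs_fold \<equiv> 11 :: nat"
abbreviation (input) "f_bfs \<equiv> 12 :: nat"
abbreviation (input) "f_interval \<equiv> 13 :: nat"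
abbreviation (input) "f_any_interval \<equiv> 14 :: nat"
abbreviation (input) "f_any_adj \<equiv> 15 :: nat"
abbreviation (input) "f_nonadj \<equiv> 16 :: nat"
abbreviation (input) "f_any_nonadj \<equiv> 17 :: nat"
abbreviation (input) "f_in_closure \<equiv> 18 :: nat"
abbreviation (input) "f_closure_filter \<equiv> 19 :: nat"
abbreviation (input) "f_closure_step \<equiv> 20 :: nat"
abbreviation (input) "f_closure \<equiv> 21 :: nat"
abbreviation (input) "f_in_nb \<equiv> 22 :: nat"
abbreviation (input) "f_has_nb \<equiv> 23 :: nat"
abbreviation (input) "f_covered \<equiv> 24 :: nat"
abbreviation (input) "f_covered_by \<equiv> 25 :: nat"
abbreviation (input) "f_meets \<equiv> 26 :: nat"
abbreviation (input) "f_grow_step \<equiv> 27 :: nat"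
abbreviation (input) "f_grow \<equiv> 28 :: nat"
abbreviation (input) "f_part_step \<equiv> 29 :: nat"
abbreviation (input) "f_parts \<equiv> 30 :: nat"
abbreviation (input) "f_inner \<equiv> 31 :: nat"
abbreviation (input) "f_bad \<equiv> 32 :: nat"
abbreviation (input) "f_any_bad \<equiv> 33 :: nat"
abbreviation (input) "f_good \<equiv> 34 :: nat"
abbreviation (input) "f_goods \<equiv> 35 :: nat"
abbreviation (input) "f_with_rep \<equiv> 36 :: nat"
abbreviation (input) "f_with_reps \<equiv> 37 :: nat"
abbreviation (input) "f_interior \<equiv> 38 :: nat"
abbreviation (input) "f_any_interior \<equiv> 39 :: nat"
abbreviation (input) "f_option_step \<equiv> 40 :: nat"
abbreviation (input) "f_option_fold \<equiv> 41 :: nat"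
abbreviation (input) "f_opts \<equiv> 42 :: nat"
abbreviation (input) "f_all_opts \<equiv> 43 :: nat"
abbreviation (input) "f_member_of \<equiv> 44 :: nat"
abbreviation (input) "f_hit \<equiv> 45 :: nat"
abbreviation (input) "f_unhit \<equiv> 46 :: nat"
abbreviation (input) "f_unhits \<equiv> 47 :: nat"
abbreviation (input) "f_hard \<equiv> 48 :: nat"
abbreviation (input) "f_any_hard \<equiv> 49 :: nat"
abbreviation (input) "f_soft \<equiv> 50 :: nat"
abbreviation (input) "f_any_soft \<equiv> 51 :: nat"
abbreviation (input) "f_chosen \<equiv> 52 :: nat"
abbreviation (input) "f_all_chosen \<equiv> 53 :: nat"
abbreviation (input) "f_count \<equiv> 54 :: nat"
abbreviation (input) "f_length \<equiv> 55 :: nat"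
abbreviation (input) "f_missed \<equiv> 56 :: nat"
abbreviation (input) "f_any_missed \<equiv> 57 :: nat"
abbreviation (input) "f_accepts \<equiv> 58 :: nat"
abbreviation (input) "f_search \<equiv> 59 :: nat"
abbreviation (input) "f_branch \<equiv> 60 :: nat"
abbreviation (input) "f_init \<equiv> 61 :: nat"

text \<open>
  The graph is passed as \<open>Cell vs es\<close>.  A function called from a loop takes the list entry, for
  \<open>fold_loop\<close> also the accumulator, and one more argument that holds everything else it needs.
\<close>

definition "b_main = LetIn (Call f_init [Var 0]) (Call f_search [Fst (Var 0), Lit 0, Snd (Var 0)])"
definition "b_eq = EqE (Var 0) (Var 1)"
definition "b_is_edge = OrE (AndE (EqE (Fst (Var 0)) (Fst (Var 1))) (EqE (Snd (Var 0)) (Snd (Var 1))))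
  (AndE (EqE (Fst (Var 0)) (Snd (Var 1))) (EqE (Snd (Var 0)) (Fst (Var 1))))"
definition "b_adj = Call f_edge [Snd (Snd (Var 1)), MkCell (Var 0) (Fst (Var 1))]"
definition "b_near = OrE (EqE (Var 0) (Fst (Var 1))) (Call f_adj [Var 0, Var 1])"
definition "b_in_ball = Call f_any_near [Fst (Var 1), MkCell (Var 0) (Snd (Var 1))]"
definition "b_bfs_step = IfNonzero (Call f_mem [Fst (Var 1), Fst (Var 2)]) (Var 1)
  (MkCell (Call f_ball [Fst (Snd (Var 2)), MkCell (Fst (Var 1)) (Snd (Var 2))]) (Add (Snd (Var 1)) (Lit 1)))"
definition "b_bfs = Call f_bfs_fold [Fst (Var 2), MkCell (MkCell (Var 0) (Lit 0)) (Lit 0), MkCell (Var 1) (Var 2)]"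
definition "b_interval = LetIn (Call f_bfs [Fst (Fst (Var 1)), Snd (Fst (Var 1)), Snd (Var 1)])
  (AndE (Call f_mem [Fst (Var 0), Snd (Fst (Var 2))])
    (EqE (Add (Snd (Call f_bfs [Fst (Fst (Var 2)), Var 1, Snd (Var 2)]))
        (Snd (Call f_bfs [Var 1, Snd (Fst (Var 2)), Snd (Var 2)]))) (Snd (Var 0))))"
definition "b_nonadj = NotE (Call f_adj [Var 0, Var 1])"
definition "b_in_closure = OrE (Call f_mem [Fst (Var 1), Var 0])
  (AndE (Call f_any_adj [Fst (Var 1), MkCell (Var 0) (Snd (Var 1))])
    (Call f_any_nonadj [Fst (Var 1), MkCell (Var 0) (Snd (Var 1))]))"
definition "b_closure_step = Call f_closure_filter [Fst (Var 2), MkCell (Var 1) (Var 2)]"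
definition "b_in_nb = AndE (NotE (Call f_mem [Fst (Var 1), Var 0])) (Call f_any_adj [Fst (Var 1), MkCell (Var 0) (Snd (Var 1))])"
definition "b_covered_by = Call f_covered [Var 1, Var 0]"
definition "b_grow_step = LetIn (Call f_closure [Fst (Snd (Var 2)), MkCell (Var 0) (Var 1), Snd (Var 2)])
  (IfNonzero (AndE (Call f_has_nb [Fst (Snd (Var 3)), MkCell (Var 0) (Snd (Var 3))])
      (NotE (Call f_meets [Var 0, Fst (Var 3)]))) (Var 0) (Var 2))"
definition "b_part_step = IfNonzero (Call f_covered [Var 1, Var 0]) (Var 1)
  (MkCell (Call f_grow [Fst (Var 2), MkCell (Var 0) (Lit 0), MkCell (Var 1) (Var 2)]) (Var 1))"
definition "b_inner = AndE (Call f_mem [Var 0, Fst (Fst (Var 1))]) (AndE (Call f_mem [Var 0, Snd (Fst (Var 1))])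
  (AndE (NotE (EqE (Fst (Fst (Var 1))) (Snd (Fst (Var 1))))) (NotE (Call f_edge [Snd (Snd (Var 1)), Fst (Var 1)]))))"
definition "b_bad = AndE (Call f_inner [Fst (Snd (Var 1)), MkCell (Var 0) (Snd (Snd (Var 1)))])
  (NotE (Call f_interval [Fst (Var 1), MkCell (Var 0) (Snd (Snd (Var 1)))]))"
definition "b_good = NotE (Call f_any_bad [Fst (Snd (Var 1)), MkCell (Var 0) (MkCell (Fst (Var 1)) (Snd (Snd (Var 1))))])"
definition "b_with_rep = LetIn (Call f_goods [Var 0, MkCell (Var 0) (Var 1)])
  (MkCell (IfNonzero (IsCell (Var 0)) (Fst (Var 0)) (Fst (Var 1))) (Var 1))"
definition "b_interior = AndE (NotE (EqE (Var 0) (Fst (Fst (Var 1))))) (AndE (NotE (EqE (Var 0) (Snd (Fst (Var 1)))))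
  (Call f_interval [Var 0, Var 1]))"
definition "b_option_step = IfNonzero (Call f_inner [Var 0, Var 2]) (MkCell (Add (TripleE (Fst (Var 0))) (Lit 2)) (Var 1))
  (IfNonzero (Call f_any_interior [Var 0, Var 2]) (MkCell (Add (TripleE (Fst (Var 0))) (Lit 1)) (Var 1)) (Var 1))"
definition "b_opts = Call f_option_fold [Fst (Var 1),
    MkCell (TripleE (Fst (Var 0))) (MkCell (TripleE (Snd (Var 0))) (Lit 0)), MkCell (Var 0) (Snd (Var 1))]"
definition "b_member_of = Call f_mem [Var 1, Var 0]"
definition "b_unhit = NotE (Call f_hit [Var 0, Var 1])"
definition "b_hard = Call f_mem [Var 1, TripleE (Var 0)]"
definition "b_soft = AndE (EqE (Fst (Var 0)) (Fst (Var 1)))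
  (AndE (OrE (Call f_mem [Snd (Var 1), Add (TripleE (Fst (Var 1))) (Lit 1)])
      (Call f_mem [Snd (Var 1), Add (TripleE (Fst (Var 1))) (Lit 2)]))
    (NotE (Call f_any_hard [Var 0, Snd (Var 1)])))"
definition "b_chosen = OrE (Call f_hard [Var 0, Fst (Var 1)]) (Call f_any_soft [Snd (Var 1), MkCell (Var 0) (Fst (Var 1))])"
definition "b_count = Add (Var 1) (Lit 1)"
definition "b_missed = NotE (Call f_any_interval [Fst (Var 1), MkCell (Var 0) (Snd (Var 1))])"
definition "b_accepts = LetIn (Call f_all_chosen [Fst (Snd (Snd (Snd (Snd (Var 1))))), MkCell (Var 0) (Fst (Snd (Var 1)))])
  (AndE (NotE (Sub (Call f_length [Var 0, Lit 0, Lit 0]) (Fst (Snd (Snd (Snd (Var 2)))))))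
    (NotE (Call f_any_missed [Fst (Snd (Snd (Var 2))), MkCell (Var 0) (Snd (Snd (Snd (Snd (Var 2)))))])))"
definition "b_search = LetIn (Call f_unhits [Fst (Var 2), Var 1])
  (IfNonzero (IsCell (Var 0))
    (IfNonzero (Var 1) (Call f_branch [Fst (Var 0), Var 2, Sub (Var 1) (Lit 1), Var 3]) (Lit 0))
    (Call f_accepts [Var 2, Var 3]))"
definition "b_branch = IfNonzero (IsCell (Var 0))
  (IfNonzero (Call f_search [Var 2, MkCell (Fst (Var 0)) (Var 1), Var 3]) (Lit 1)
    (Call f_branch [Snd (Var 0), Var 1, Var 2, Var 3])) (Lit 0)"
definition "b_init = LetIn (MkCell (Fst (Var 0)) (Fst (Snd (Var 0))))
  (LetIn (Call f_with_reps [Call f_parts [Fst (Var 0), Lit 0, Var 0], MkCell (Fst (Snd (Snd (Var 1)))) (Var 0)])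
    (LetIn (Fst (Snd (Snd (Snd (Var 2)))))
      (MkCell (TripleE (Var 0))
        (MkCell (Call f_all_opts [Fst (Snd (Snd (Var 3))), MkCell (Var 1) (Var 2)])
          (MkCell (Var 1) (MkCell (Fst (Snd (Snd (Var 3)))) (MkCell (Var 0) (Var 2))))))))"

definition prog :: prog where
  "prog = [b_main,
    b_eq,
    any_loop f_mem f_eq,
    b_is_edge,
    any_loop f_edge f_is_edge,
    b_adj,
    b_near,
    any_loop f_any_near f_near,
    b_in_ball,
    filter_loop f_ball f_in_ball,
    b_bfs_step,
    fold_loop f_bfs_fold f_bfs_step,
    b_bfs,
    b_interval,
    any_loop f_any_interval f_interval,
    any_loop f_any_adj f_adj,
    b_nonadj,
    any_loop f_any_nonadj f_nonadj,
    b_in_closure,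
    filter_loop f_closure_filter f_in_closure,
    b_closure_step,
    fold_loop f_closure f_closure_step,
    b_in_nb,
    any_loop f_has_nb f_in_nb,
    any_loop f_covered f_mem,
    b_covered_by,
    any_loop f_meets f_covered_by,
    b_grow_step,
    fold_loop f_grow f_grow_step,
    b_part_step,
    fold_loop f_parts f_part_step,
    b_inner,
    b_bad,
    any_loop f_any_bad f_bad,
    b_good,
    filter_loop f_goods f_good,
    b_with_rep,
    map_loop f_with_reps f_with_rep,
    b_interior,
    any_loop f_any_interior f_interior,
    b_option_step,
    fold_loop f_option_fold f_option_step,
    b_opts,
    map_loop f_all_opts f_opts,
    b_member_of,
    any_loop f_hit f_member_of,
    b_unhit,
    filter_loop f_unhits f_unhit,
    b_hard,
    any_loop f_any_hard f_hard,
    b_soft,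
    any_loop f_any_soft f_soft,
    b_chosen,
    filter_loop f_all_chosen f_chosen,
    b_count,
    fold_loop f_length f_count,
    b_missed,
    any_loop f_any_missed f_missed,
    b_accepts,
    b_search,
    b_branch,
    b_init]"

lemma length_prog: "length prog = 62"
  by (simp add: prog_def)

lemma prog_nth:
  shows nth_main: "prog ! f_main = b_main"
    and nth_eq: "prog ! f_eq = b_eq"
    and nth_mem: "prog ! f_mem = any_loop f_mem f_eq"
    and nth_is_edge: "prog ! f_is_edge = b_is_edge"
    and nth_edge: "prog ! f_edge = any_loop f_edge f_is_edge"
    and nth_adj: "prog ! f_adj = b_adj"
    and nth_near: "prog ! f_near = b_near"
    and nth_any_near: "prog ! f_any_near = any_loop f_any_near f_near"
    and nth_in_ball: "prog ! f_in_ball = b_in_ball"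
    and nth_ball: "prog ! f_ball = filter_loop f_ball f_in_ball"
    and nth_bfs_step: "prog ! f_bfs_step = b_bfs_step"
    and nth_bfs_fold: "prog ! f_bfs_fold = fold_loop f_bfs_fold f_bfs_step"
    and nth_bfs: "prog ! f_bfs = b_bfs"
    and nth_interval: "prog ! f_interval = b_interval"
    and nth_any_interval: "prog ! f_any_interval = any_loop f_any_interval f_interval"
    and nth_any_adj: "prog ! f_any_adj = any_loop f_any_adj f_adj"
    and nth_nonadj: "prog ! f_nonadj = b_nonadj"
    and nth_any_nonadj: "prog ! f_any_nonadj = any_loop f_any_nonadj f_nonadj"
    and nth_in_closure: "prog ! f_in_closure = b_in_closure"
    and nth_closure_filter: "prog ! f_closure_filter = filter_loop f_closure_filter f_in_closure"
    and nth_closure_step: "prog ! f_closure_step = b_closure_step"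
    and nth_closure: "prog ! f_closure = fold_loop f_closure f_closure_step"
    and nth_in_nb: "prog ! f_in_nb = b_in_nb"
    and nth_has_nb: "prog ! f_has_nb = any_loop f_has_nb f_in_nb"
    and nth_covered: "prog ! f_covered = any_loop f_covered f_mem"
    and nth_covered_by: "prog ! f_covered_by = b_covered_by"
    and nth_meets: "prog ! f_meets = any_loop f_meets f_covered_by"
    and nth_grow_step: "prog ! f_grow_step = b_grow_step"
    and nth_grow: "prog ! f_grow = fold_loop f_grow f_grow_step"
    and nth_part_step: "prog ! f_part_step = b_part_step"
    and nth_parts: "prog ! f_parts = fold_loop f_parts f_part_step"
    and nth_inner: "prog ! f_inner = b_inner"
    and nth_bad: "prog ! f_bad = b_bad"
    and nth_any_bad: "prog ! f_any_bad = any_loop f_any_bad f_bad"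
    and nth_good: "prog ! f_good = b_good"
    and nth_goods: "prog ! f_goods = filter_loop f_goods f_good"
    and nth_with_rep: "prog ! f_with_rep = b_with_rep"
    and nth_with_reps: "prog ! f_with_reps = map_loop f_with_reps f_with_rep"
    and nth_interior: "prog ! f_interior = b_interior"
    and nth_any_interior: "prog ! f_any_interior = any_loop f_any_interior f_interior"
    and nth_option_step: "prog ! f_option_step = b_option_step"
    and nth_option_fold: "prog ! f_option_fold = fold_loop f_option_fold f_option_step"
    and nth_opts: "prog ! f_opts = b_opts"
    and nth_all_opts: "prog ! f_all_opts = map_loop f_all_opts f_opts"
    and nth_member_of: "prog ! f_member_of = b_member_of"
    and nth_hit: "prog ! f_hit = any_loop f_hit f_member_of"
    and nth_unhit: "prog ! f_unhit = b_unhit"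
    and nth_unhits: "prog ! f_unhits = filter_loop f_unhits f_unhit"
    and nth_hard: "prog ! f_hard = b_hard"
    and nth_any_hard: "prog ! f_any_hard = any_loop f_any_hard f_hard"
    and nth_soft: "prog ! f_soft = b_soft"
    and nth_any_soft: "prog ! f_any_soft = any_loop f_any_soft f_soft"
    and nth_chosen: "prog ! f_chosen = b_chosen"
    and nth_all_chosen: "prog ! f_all_chosen = filter_loop f_all_chosen f_chosen"
    and nth_count: "prog ! f_count = b_count"
    and nth_length: "prog ! f_length = fold_loop f_length f_count"
    and nth_missed: "prog ! f_missed = b_missed"
    and nth_any_missed: "prog ! f_any_missed = any_loop f_any_missed f_missed"
    and nth_accepts: "prog ! f_accepts = b_accepts"
    and nth_search: "prog ! f_search = b_search"
    and nth_branch: "prog ! f_branch = b_branch"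
    and nth_init: "prog ! f_init = b_init"
  by (simp_all add: prog_def)

lemmas body_defs =
  b_main_def
  b_eq_def
  b_is_edge_def
  b_adj_def
  b_near_def
  b_in_ball_def
  b_bfs_step_def
  b_bfs_def
  b_interval_def
  b_nonadj_def
  b_in_closure_def
  b_closure_step_def
  b_in_nb_def
  b_covered_by_def
  b_grow_step_def
  b_part_step_def
  b_inner_def
  b_bad_def
  b_good_def
  b_with_rep_def
  b_interior_def
  b_option_step_def
  b_opts_def
  b_member_of_def
  b_unhit_def
  b_hard_def
  b_soft_def
  b_chosen_def
  b_count_def
  b_missed_def
  b_accepts_def
  b_search_def
  b_branch_def
  b_init_def

section \<open>Correctness and polynomial cost of the routines\<close>

section \<open>Semantics of the program\<close>

lemma den_macros:
  "den P K env (NotE a) = (case den P K env a of Some (N x) \<Rightarrow> Some (N (1 - x)) | _ \<Rightarrow> None)"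
  "den P K env (AndE a b) = (case den P K env a of Some (N x) \<Rightarrow>
    (if x \<noteq> 0 then den P K env b else Some (N 0)) | _ \<Rightarrow> None)"
  "den P K env (OrE a b) = (case den P K env a of Some (N x) \<Rightarrow>
    (if x \<noteq> 0 then Some (N 1) else den P K env b) | _ \<Rightarrow> None)"
  "den P K env (EqE a b) = (case den P K env a of Some (N x) \<Rightarrow>
    (case den P K env b of Some (N y) \<Rightarrow>
      (case den P K env a of Some (N x) \<Rightarrow> Some (bv (x = y)) | _ \<Rightarrow> None) | _ \<Rightarrow> None) | _ \<Rightarrow> None)"
  "den P K env (TripleE a) = (case den P K env a of Some (N x) \<Rightarrow> Some (N (3 * x)) | _ \<Rightarrow> None)"
  by (auto simp: NotE_def AndE_def OrE_def EqE_def TripleE_def split: option.splits val.splits)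

lemma esize_macros:
  "esize (NotE a) = esize a + 2"
  "esize (AndE a b) = esize a + esize b + 2"
  "esize (OrE a b) = esize a + esize b + 2"
  "esize (EqE a b) = 2 * esize a + 2 * esize b + 5"
  "esize (TripleE a) = 3 * esize a + 2"
  by (simp_all add: NotE_def AndE_def OrE_def EqE_def TripleE_def)

lemma minus_of_bool: "Suc 0 - of_bool p = of_bool (\<not> p)"
  by simp

abbreviation nats :: "nat list \<Rightarrow> val" where
  "nats L \<equiv> enc_list (map N L)"

abbreviation natss :: "nat list list \<Rightarrow> val" where
  "natss Ls \<equiv> enc_list (map (\<lambda>L. nats L) Ls)"

abbreviation pr :: "nat \<times> nat \<Rightarrow> val" where
  "pr \<equiv> (\<lambda>(u, v). Cell (N u) (N v))"

abbreviation prs :: "(nat \<times> nat) list \<Rightarrow> val" where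
  "prs ps \<equiv> enc_list (map pr ps)"

abbreviation enc_state :: "nat list \<times> nat \<Rightarrow> val" where
  "enc_state s \<equiv> Cell (nats (fst s)) (N (snd s))"

text \<open>The reserve of 2 beyond \<open>length vs\<close> pays for \<open>u # W\<close> with
  \<open>W\<close> one longer than \<open>vs\<close>, and for the two end tokens on top of one token
  per part.\<close>

locale program_run = listed_nat_graph G vs ts for G and vs ts +
  fixes es :: "(nat \<times> nat) list" and n :: nat
  assumes es: "adj a b \<longleftrightarrow> (a, b) \<in> set es \<or> (b, a) \<in> set es"
    and n: "200 \<le> n" "length vs + 2 \<le> n" "length es \<le> n" "length ts \<le> n"
begin

abbreviation computes_pow :: "nat \<Rightarrow> nat \<Rightarrow> val list \<Rightarrow> val \<Rightarrow> bool" where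
  "computes_pow d \<equiv> computes prog (n ^ d)"

abbreviation "g \<equiv> Cell (nats vs) (prs es)"

lemma pow_body:
  assumes "den prog (n ^ d) env (prog ! f) = Some v" "f < length prog" "esize (prog ! f) \<le> 100"
    "d' = Suc d"
  shows "computes_pow d' f env v"
  using computes_body[OF n(1) assms(2,1,3)] assms(4) by simp

lemma res_pow: "computes_pow d f args v \<Longrightarrow> d \<le> d' \<Longrightarrow> res prog (n ^ d') f args = Some v"
  using res_mono n(1) by simp

lemma pow_any:
  assumes "prog ! i = any_loop i j" "\<And>x. x \<in> set xs \<Longrightarrow> computes_pow d j [h x, c] (bv (Q x))"
    "length xs \<le> n" "i < length prog" "d' = d + 2" "v = bv (\<exists>x\<in>set xs. Q x)"
  shows "computes_pow d' i [enc_list (map h xs), c] v"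
  unfolding assms(5,6)
  by (rule computes_mono[OF computes_any_loop_exact[OF assms(4,1,2)] loop_cost[OF n(1) assms(3)]])

lemma pow_filter:
  assumes "prog ! i = filter_loop i j" "\<And>x. x \<in> set xs \<Longrightarrow> computes_pow d j [h x, c] (bv (Q x))"
    "length xs \<le> n" "i < length prog" "d' = d + 2" "v = enc_list (map h (filter Q xs))"
  shows "computes_pow d' i [enc_list (map h xs), c] v"
  unfolding assms(5,6)
  by (rule computes_mono[OF computes_filter_loop_exact[OF assms(4,1,2)] loop_cost[OF n(1) assms(3)]])

lemma pow_map:
  assumes "prog ! i = map_loop i j" "\<And>x. x \<in> set xs \<Longrightarrow> computes_pow d j [h x, c] (h' (f x))"
    "length xs \<le> n" "i < length prog" "d' = d + 2" "v = enc_list (map h' (map f xs))"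
  shows "computes_pow d' i [enc_list (map h xs), c] v"
  unfolding assms(5,6)
  by (rule computes_mono[OF computes_map_loop_exact loop_cost[OF n(1) assms(3)]]) (use assms in auto)

lemma pow_fold:
  assumes "prog ! i = fold_loop i j"
    "\<And>x xs a. Inv (x # xs) a \<Longrightarrow> computes_pow d j [h x, h' a, c] (h' (f x a))"
    "\<And>x xs a. Inv (x # xs) a \<Longrightarrow> Inv xs (f x a)"
    "Inv xs a" "length xs \<le> n" "i < length prog" "d' = d + 2" "v = h' (fold f xs a)"
  shows "computes_pow d' i [enc_list (map h xs), h' a, c] v"
  unfolding assms(7,8)
  by (rule computes_mono[OF computes_fold_loop_exact[where Inv = Inv] loop_cost[OF n(1) assms(5)]])
    (use assms in auto)

lemmas run_simps = prog_nth length_prog body_defs esize_macros den_macros minus_of_bool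

subsection \<open>Distances\<close>

lemma computes_eq: "computes_pow 1 f_eq [N a, N b] (bv (a = b))"
  by (rule pow_body[where d = 0]) (simp_all add: run_simps nth_eq[unfolded One_nat_def])

lemma computes_mem: "length L \<le> n \<Longrightarrow> computes_pow 3 f_mem [nats L, N x] (bv (x \<in> set L))"
  by (rule pow_any[where h = N, OF nth_mem computes_eq]) (auto simp: length_prog)

lemma computes_is_edge: "computes_pow 1 f_is_edge [pr p, Cell (N a) (N b)] (bv (p = (a, b) \<or> p = (b, a)))"
  by (rule pow_body[where d = 0]) (auto simp: run_simps split: prod.splits)

lemma computes_edge: "computes_pow 3 f_edge [prs es, Cell (N a) (N b)] (bv (adj a b))"
  by (rule pow_any[where h = pr, OF nth_edge computes_is_edge]) (use n in \<open>auto simp: length_prog es\<close>)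

lemma computes_adj: "computes_pow 4 f_adj [N a, Cell (N w) g] (bv (adj a w))"
  by (rule pow_body[where d = 3]) (simp_all add: run_simps res_pow[OF computes_edge])

lemma computes_near: "computes_pow 5 f_near [N x, Cell (N w) g] (bv (x = w \<or> adj x w))"
  by (rule pow_body[where d = 4]) (simp_all add: run_simps res_pow[OF computes_adj])

lemma computes_any_near: "length B \<le> n \<Longrightarrow>
    computes_pow 7 f_any_near [nats B, Cell (N w) g] (bv (\<exists>x\<in>set B. x = w \<or> adj x w))"
  by (rule pow_any[where h = N, OF nth_any_near computes_near]) (auto simp: length_prog)

lemma computes_in_ball: "length B \<le> n \<Longrightarrow>
    computes_pow 8 f_in_ball [N w, Cell (nats B) g] (bv (\<exists>x\<in>set B. x = w \<or> adj x w))"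
  by (rule pow_body[where d = 7]) (simp_all add: run_simps res_pow[OF computes_any_near])

lemma computes_ball: "length B \<le> n \<Longrightarrow> computes_pow 10 f_ball [nats vs, Cell (nats B) g] (nats (ball_step B))"
  by (rule pow_filter[where h = N, OF nth_ball computes_in_ball]) (use n in \<open>auto simp: length_prog ball_step_def\<close>)

lemma computes_bfs_step: "length (fst s) \<le> n \<Longrightarrow>
    computes_pow 11 f_bfs_step [x, enc_state s, Cell (N v) g] (enc_state (bfs_step v s))"
  by (rule pow_body[where d = 10])
    (auto simp: run_simps res_pow[OF computes_mem] res_pow[OF computes_ball] bfs_step_def split: prod.splits)

lemma length_bfs_step: "length (fst s) \<le> n \<Longrightarrow> length (fst (bfs_step v s)) \<le> n"
proof -
  have "length (ball_step B) \<le> n" for B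
    unfolding ball_step_def by (rule order_trans[OF length_filter_le]) (use n in simp)
  then show "length (fst s) \<le> n \<Longrightarrow> length (fst (bfs_step v s)) \<le> n"
    by (auto simp: bfs_step_def split: prod.splits)
qed

lemma computes_bfs_fold: "length (fst s) \<le> n \<Longrightarrow>
    computes_pow 13 f_bfs_fold [nats vs, enc_state s, Cell (N v) g] (enc_state (fold (\<lambda>_. bfs_step v) vs s))"
  by (rule pow_fold[where h = N and h' = enc_state and Inv = "\<lambda>_ s. length (fst s) \<le> n",
        OF nth_bfs_fold computes_bfs_step])
    (use n in \<open>auto simp: length_prog length_bfs_step\<close>)

lemma computes_bfs: "computes_pow 14 f_bfs [N u, N v, g] (enc_state (bfs u v))"
  by (rule pow_body[where d = 13])
    (use n in \<open>simp_all add: run_simps res_pow[OF computes_bfs_fold[of "([u], 0)"], simplified] bfs_def\<close>)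

lemma length_bfs: "length (fst (bfs u v)) \<le> n"
proof -
  have "length (fst (fold (\<lambda>_. bfs_step v) xs s)) \<le> n" if "length (fst s) \<le> n" for xs s
    using that by (induction xs arbitrary: s) (simp_all add: length_bfs_step)
  from this[of "([u], 0)"] show ?thesis using n by (simp add: bfs_def)
qed

lemma computes_interval:
  assumes "u \<in> V" "v \<in> V" "w \<in> V"
  shows "computes_pow 15 f_interval [N w, Cell (Cell (N u) (N v)) g] (bv (w \<in> interval u v))"
  unfolding interval_bfs[OF assms]
  by (rule pow_body[where d = 14])
    (auto simp: run_simps res_pow[OF computes_bfs] res_pow[OF computes_mem] length_bfs)

lemma computes_any_interval:
  assumes "u \<in> V" "v \<in> V" "set S \<subseteq> V" "length S \<le> n"
  shows "computes_pow 17 f_any_interval [nats S, Cell (Cell (N u) (N v)) g]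
    (bv (\<exists>w\<in>set S. w \<in> interval u v))"
  by (rule pow_any[where h = N, OF nth_any_interval computes_interval]) (use assms in \<open>auto simp: length_prog\<close>)

subsection \<open>Parts\<close>

lemma computes_any_adj: "length W \<le> n \<Longrightarrow>
    computes_pow 6 f_any_adj [nats W, Cell (N w) g] (bv (\<exists>a\<in>set W. adj a w))"
  by (rule pow_any[where h = N, OF nth_any_adj computes_adj]) (auto simp: length_prog)

lemma computes_nonadj: "computes_pow 5 f_nonadj [N a, Cell (N w) g] (bv (\<not> adj a w))"
  by (rule pow_body[where d = 4]) (simp_all add: run_simps res_pow[OF computes_adj])

lemma computes_any_nonadj: "length W \<le> n \<Longrightarrow>
    computes_pow 7 f_any_nonadj [nats W, Cell (N w) g] (bv (\<exists>a\<in>set W. \<not> adj a w))"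
  by (rule pow_any[where h = N, OF nth_any_nonadj computes_nonadj]) (auto simp: length_prog)

lemma computes_in_closure: "length W \<le> n \<Longrightarrow> computes_pow 8 f_in_closure [N w, Cell (nats W) g]
    (bv (w \<in> set W \<or> (\<exists>a\<in>set W. adj a w) \<and> (\<exists>a\<in>set W. \<not> adj a w)))"
  by (rule pow_body[where d = 7])
    (auto simp: run_simps res_pow[OF computes_mem] res_pow[OF computes_any_adj] res_pow[OF computes_any_nonadj])

lemma computes_closure_filter: "length W \<le> n \<Longrightarrow>
    computes_pow 10 f_closure_filter [nats vs, Cell (nats W) g] (nats (closure_step W))"
  by (rule pow_filter[where h = N, OF nth_closure_filter computes_in_closure])
    (use n in \<open>auto simp: length_prog closure_step_def\<close>)

lemma computes_closure_step: "length W \<le> n \<Longrightarrow>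
    computes_pow 11 f_closure_step [x, nats W, g] (nats (closure_step W))"
  by (rule pow_body[where d = 10]) (simp_all add: run_simps res_pow[OF computes_closure_filter])

lemma length_closure_step: "length (closure_step W) \<le> length vs"
  by (simp add: closure_step_def)

lemma computes_closure: "length W \<le> n \<Longrightarrow> computes_pow 13 f_closure [nats vs, nats W, g] (nats (closure W))"
  by (rule pow_fold[where h = N and h' = nats and Inv = "\<lambda>_ W. length W \<le> n",
        OF nth_closure computes_closure_step])
    (use n order_trans[OF length_closure_step] in \<open>auto simp: length_prog closure_def\<close>)

text \<open>After a single round the list is a filtered copy of \<open>vs\<close>, however long
  \<open>W\<close> was; the vertex \<open>u\<close> guarantees that there is a round.\<close>

lemma length_closure: "u \<in> set vs \<Longrightarrow> length (closure W) \<le> length vs"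
proof -
  assume "u \<in> set vs"
  then have "vs \<noteq> []" by auto
  have "length (fold (\<lambda>_. closure_step) xs W) \<le> length vs" if "xs \<noteq> [] \<or> length W \<le> length vs" for xs W
    using that by (induction xs arbitrary: W) (simp_all add: length_closure_step)
  from this[of vs W] show ?thesis using \<open>vs \<noteq> []\<close> by (simp add: closure_def)
qed

lemma computes_in_nb: "length U \<le> n \<Longrightarrow>
    computes_pow 7 f_in_nb [N y, Cell (nats U) g] (bv (y \<notin> set U \<and> (\<exists>a\<in>set U. adj a y)))"
  by (rule pow_body[where d = 6]) (auto simp: run_simps res_pow[OF computes_mem] res_pow[OF computes_any_adj])

lemma computes_has_nb: "length U \<le> n \<Longrightarrow>
    computes_pow 9 f_has_nb [nats vs, Cell (nats U) g] (bv (nb (set U) \<noteq> {}))"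
  by (rule pow_any[where h = N, OF nth_has_nb computes_in_nb])
    (use n adj_sym in \<open>auto simp: length_prog nb_def set_vs\<close>)

definition short :: "nat list list \<Rightarrow> bool" where
  "short Ls \<longleftrightarrow> length Ls \<le> n \<and> (\<forall>L\<in>set Ls. length L \<le> n)"

lemma computes_covered: "short Ls \<Longrightarrow> computes_pow 5 f_covered [natss Ls, N x] (bv (x \<in> covered Ls))"
  by (rule pow_any[where h = nats, OF nth_covered computes_mem]) (auto simp: length_prog covered_def short_def)

lemma computes_covered_by: "short Ls \<Longrightarrow> computes_pow 6 f_covered_by [N x, natss Ls] (bv (x \<in> covered Ls))"
  by (rule pow_body[where d = 5]) (simp_all add: run_simps res_pow[OF computes_covered])

lemma computes_meets: "short Ls \<Longrightarrow> length U \<le> n \<Longrightarrow>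
    computes_pow 8 f_meets [nats U, natss Ls] (bv (set U \<inter> covered Ls \<noteq> {}))"
  by (rule pow_any[where h = N, OF nth_meets computes_covered_by]) (auto simp: length_prog)

lemma computes_grow_step:
  assumes "short acc" "length W \<le> Suc (length vs)" "u \<in> set vs"
  shows "computes_pow 14 f_grow_step [N u, nats W, Cell (natss acc) g] (nats (grow_step acc u W))"
proof -
  have "length (u # W) \<le> n" "length (closure (u # W)) \<le> n"
    using assms n length_closure[of u "u # W"] by auto
  then show ?thesis using assms(1)
    by (intro pow_body[where d = 13])
      (auto simp: run_simps res_pow[OF computes_closure[of "u # W"], simplified] res_pow[OF computes_has_nb]
        res_pow[OF computes_meets] grow_step_def Let_def)
qed

lemma length_grow_step:
  "length W \<le> Suc (length vs) \<Longrightarrow> u \<in> set vs \<Longrightarrow> length (grow_step acc u W) \<le> Suc (length vs)"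
  using length_closure[of u "u # W"] by (auto simp: grow_step_def Let_def)

lemma computes_grow:
  assumes "short acc"
  shows "computes_pow 16 f_grow [nats vs, nats [v], Cell (natss acc) g] (nats (grow acc v))"
  by (rule pow_fold[where h = N and h' = nats
        and Inv = "\<lambda>us W. set us \<subseteq> set vs \<and> length W \<le> Suc (length vs)", OF nth_grow computes_grow_step])
    (use assms n in \<open>auto simp: length_prog grow_def length_grow_step\<close>)

lemma length_grow: "length (grow acc v) \<le> Suc (length vs)"
proof -
  have "length (fold (grow_step acc) us W) \<le> Suc (length vs)"
    if "set us \<subseteq> set vs" "length W \<le> Suc (length vs)" for us W
    using that by (induction us arbitrary: W) (simp_all add: length_grow_step)
  then show ?thesis by (simp add: grow_def)
qed

lemma computes_part_step: "short acc \<Longrightarrow>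
    computes_pow 17 f_part_step [N v, natss acc, g] (natss (part_step v acc))"
  by (rule pow_body[where d = 16])
    (auto simp: run_simps res_pow[OF computes_covered] res_pow[OF computes_grow, simplified] part_step_def)

text \<open>A processed vertex opens at most one part, so the number of parts plus the number of
  vertices still to come never grows.\<close>

definition parts_inv :: "nat list \<Rightarrow> nat list list \<Rightarrow> bool" where
  "parts_inv us acc \<longleftrightarrow> length us + length acc \<le> length vs \<and>
    (\<forall>L\<in>set acc. length L \<le> Suc (length vs))"

lemma parts_inv_step: "parts_inv (u # us) acc \<Longrightarrow> parts_inv us (part_step u acc)"
  using length_grow by (simp add: parts_inv_def part_step_def)

lemma parts_inv_short: "parts_inv us acc \<Longrightarrow> short acc"
  using n unfolding parts_inv_def short_def by fastforce

lemma computes_parts: "computes_pow 19 f_parts [nats vs, N 0, g] (natss parts)"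
proof -
  have "computes_pow 19 f_parts [nats vs, natss [], g] (natss parts)"
  proof (rule pow_fold[where h = N and h' = natss and Inv = parts_inv and d = 17, OF nth_parts])
    show "computes_pow 17 f_part_step [N v, natss acc, g] (natss (part_step v acc))"
      if "parts_inv (v # us) acc" for v us acc
      by (rule computes_part_step[OF parts_inv_short[OF that]])
  qed (use n parts_inv_step in \<open>simp_all add: length_prog parts_def parts_inv_def\<close>)
  then show ?thesis by simp
qed

lemma parts_inv_parts: "parts_inv [] parts"
proof -
  have "parts_inv us acc \<Longrightarrow> parts_inv [] (fold part_step us acc)" for us acc
    by (induction us arbitrary: acc) (simp_all add: parts_inv_step)
  from this[of vs "[]"] show ?thesis by (simp add: parts_def parts_inv_def)
qed

end

context program_run
begin

subsection \<open>Options\<close>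

lemma part_V: "c \<in> set parts \<Longrightarrow> c \<noteq> [] \<and> set c \<subseteq> V"
  using valid_part[OF parts_valid(1)] by (auto simp: homogeneous_def)

lemma part_length: "c \<in> set parts \<Longrightarrow> Suc (length c) \<le> n"
  using parts_inv_parts n by (fastforce simp: parts_inv_def)

lemma ps_part: "c \<in> set ps \<Longrightarrow> c \<noteq> [] \<and> set c \<subseteq> V \<and> length c \<le> n"
  using part_V part_length set_with_rep[of _ ts] by (fastforce simp: with_rep_def ps_def)

lemma length_ps: "length ps + 2 \<le> n"
  using parts_inv_parts n by (simp add: parts_inv_def ps_def)

lemma ts_ends: "p \<in> set ts \<Longrightarrow> fst p \<in> V \<and> snd p \<in> V"
  using ts_V by auto

lemma computes_inner: "length c \<le> n \<Longrightarrow>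
    computes_pow 4 f_inner [nats c, Cell (Cell (N u) (N v)) g] (bv (inner (set c) u v))"
  by (rule pow_body[where d = 3])
    (auto simp: run_simps res_pow[OF computes_mem] res_pow[OF computes_edge] inner_def)

lemma computes_bad:
  assumes "p \<in> set ts" "length c \<le> n" "x \<in> V"
  shows "computes_pow 16 f_bad [pr p, Cell (N x) (Cell (nats c) g)]
    (bv (inner (set c) (fst p) (snd p) \<and> x \<notin> interval (fst p) (snd p)))"
  by (rule pow_body[where d = 15])
    (use assms ts_ends[of p] in \<open>auto simp: run_simps case_prod_beta res_pow[OF computes_inner] res_pow[OF computes_interval]\<close>)

lemma computes_any_bad: "length c \<le> n \<Longrightarrow> x \<in> V \<Longrightarrow>
    computes_pow 18 f_any_bad [prs ts, Cell (N x) (Cell (nats c) g)] (bv (\<not> good ts c x))"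
  by (rule pow_any[where h = pr, OF nth_any_bad computes_bad])
    (use n in \<open>auto simp: length_prog good_def case_prod_beta\<close>)

lemma computes_good: "length c \<le> n \<Longrightarrow> x \<in> V \<Longrightarrow>
    computes_pow 19 f_good [N x, Cell (nats c) (Cell (prs ts) g)] (bv (good ts c x))"
  by (rule pow_body[where d = 18]) (simp_all add: run_simps res_pow[OF computes_any_bad])

lemma computes_goods: "length c \<le> n \<Longrightarrow> set c \<subseteq> V \<Longrightarrow>
    computes_pow 21 f_goods [nats c, Cell (nats c) (Cell (prs ts) g)] (nats (List.filter (good ts c) c))"
  by (rule pow_filter[where h = N, OF nth_goods computes_good]) (auto simp: length_prog)

lemma computes_with_rep: "length c \<le> n \<Longrightarrow> set c \<subseteq> V \<Longrightarrow> c \<noteq> [] \<Longrightarrow>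
    computes_pow 22 f_with_rep [nats c, Cell (prs ts) g] (nats (with_rep ts c))"
  by (rule pow_body[where d = 21])
    (auto simp: run_simps res_pow[OF computes_goods] with_rep_def neq_Nil_conv split: list.splits)

lemma computes_with_reps: "computes_pow 24 f_with_reps [natss parts, Cell (prs ts) g] (natss ps)"
  by (rule pow_map[where h = nats and h' = nats, OF nth_with_reps computes_with_rep])
    (use part_V part_length parts_inv_parts n in
      \<open>auto simp: length_prog parts_inv_def ps_def simp del: map_map dest: Suc_leD\<close>)

lemma computes_interior: "u \<in> V \<Longrightarrow> v \<in> V \<Longrightarrow> w \<in> V \<Longrightarrow>
    computes_pow 16 f_interior [N w, Cell (Cell (N u) (N v)) g] (bv (w \<noteq> u \<and> w \<noteq> v \<and> w \<in> interval u v))"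
  by (rule pow_body[where d = 15]) (auto simp: run_simps res_pow[OF computes_interval])

lemma computes_any_interior: "u \<in> V \<Longrightarrow> v \<in> V \<Longrightarrow> length c \<le> n \<Longrightarrow> set c \<subseteq> V \<Longrightarrow>
    computes_pow 18 f_any_interior [nats c, Cell (Cell (N u) (N v)) g]
      (bv (\<exists>w\<in>set c. w \<noteq> u \<and> w \<noteq> v \<and> w \<in> interval u v))"
  by (rule pow_any[where h = N, OF nth_any_interior computes_interior]) (auto simp: length_prog)

lemma computes_option_step:
  assumes "u \<in> V" "v \<in> V" "c \<in> set ps"
  shows "computes_pow 19 f_option_step [nats c, nats acc, Cell (Cell (N u) (N v)) g]
    (nats (option_step (u, v) c acc))"
proof -
  have c: "length c \<le> n" "set c \<subseteq> V" "c \<noteq> []"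
    using ps_part assms(3) by blast+
  \<comment> \<open>The code reads the representative with \<open>Fst\<close>, so the encoded list
    is exposed as a cell.\<close>
  then obtain x where x: "nats c = Cell (N (hd c)) x" by (cases c) auto
  show ?thesis
    by (rule pow_body[where d = 18])
      (use assms c in \<open>auto simp: run_simps res_pow[OF computes_inner, unfolded x] res_pow[OF computes_any_interior, unfolded x]
        res_pow[OF computes_inner[of c], unfolded x] res_pow[OF computes_any_interior[of _ _ c], unfolded x]
        option_step_def x\<close>)
qed

lemma computes_option_fold: "u \<in> V \<Longrightarrow> v \<in> V \<Longrightarrow>
    computes_pow 21 f_option_fold [natss ps, nats acc, Cell (Cell (N u) (N v)) g]
      (nats (List.fold (option_step (u, v)) ps acc))"
  by (rule pow_fold[where h = nats and h' = nats and Inv = "\<lambda>cs _. set cs \<subseteq> set ps" and d = 19,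
        OF nth_option_fold])
    (use length_ps computes_option_step in \<open>auto simp: length_prog\<close>)

lemma computes_opts: "p \<in> set ts \<Longrightarrow> computes_pow 22 f_opts [pr p, Cell (natss ps) g] (nats (opts p))"
  by (rule pow_body[where d = 21])
    (use ts_ends[of p] in \<open>simp_all add: run_simps case_prod_beta opts_def
      res_pow[OF computes_option_fold[where acc = "[3 * fst p, 3 * snd p]"], simplified]\<close>)

definition all_opts :: "nat list list" where
  "all_opts = List.map opts ts"

lemma computes_all_opts: "computes_pow 24 f_all_opts [prs ts, Cell (natss ps) g] (natss all_opts)"
  by (rule pow_map[where h = pr and h' = nats, OF nth_all_opts computes_opts])
    (use n in \<open>auto simp: length_prog all_opts_def simp del: map_map\<close>)

lemma short_opts: "short all_opts"
proof -
  have *: "length (List.fold (option_step p) cs acc) \<le> length acc + length cs" for p cs acc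
  proof (induction cs arbitrary: acc)
    case (Cons c cs)
    have "length (option_step p c acc) \<le> Suc (length acc)"
      by (auto simp: option_step_def split: prod.splits)
    then show ?case using Cons[of "option_step p c acc"] by simp
  qed simp
  have "length (opts p) \<le> n" for p
    using *[of p ps "[3 * fst p, 3 * snd p]"] length_ps by (simp add: opts_def case_prod_beta)
  then show ?thesis using n by (simp add: short_def all_opts_def)
qed

subsection \<open>Search\<close>

lemma computes_member_of: "length L \<le> n \<Longrightarrow> computes_pow 4 f_member_of [N x, nats L] (bv (x \<in> set L))"
  by (rule pow_body[where d = 3]) (simp_all add: run_simps res_pow[OF computes_mem])

lemma computes_hit: "length ob \<le> n \<Longrightarrow> length Z \<le> n \<Longrightarrow>
    computes_pow 6 f_hit [nats ob, nats Z] (bv (set ob \<inter> set Z \<noteq> {}))"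
  by (rule pow_any[where h = N, OF nth_hit computes_member_of]) (auto simp: length_prog)

lemma computes_unhit: "length ob \<le> n \<Longrightarrow> length Z \<le> n \<Longrightarrow>
    computes_pow 7 f_unhit [nats ob, nats Z] (bv (set ob \<inter> set Z = {}))"
  by (rule pow_body[where d = 6]) (simp_all add: run_simps res_pow[OF computes_hit])

lemma computes_unhits: "short obs \<Longrightarrow> length Z \<le> n \<Longrightarrow>
    computes_pow 9 f_unhits [natss obs, nats Z] (natss (unhit obs Z))"
  by (rule pow_filter[where h = nats, OF nth_unhits computes_unhit])
    (auto simp: length_prog short_def unhit_def)

lemma computes_hard: "length Z \<le> n \<Longrightarrow> computes_pow 4 f_hard [N x, nats Z] (bv (3 * x \<in> set Z))"
  by (rule pow_body[where d = 3]) (simp_all add: run_simps res_pow[OF computes_mem])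

lemma computes_any_hard: "length c \<le> n \<Longrightarrow> length Z \<le> n \<Longrightarrow>
    computes_pow 6 f_any_hard [nats c, nats Z] (bv (\<exists>x\<in>set c. 3 * x \<in> set Z))"
  by (rule pow_any[where h = N, OF nth_any_hard computes_hard]) (auto simp: length_prog)

definition soft :: "nat \<Rightarrow> nat list \<Rightarrow> nat list \<Rightarrow> bool" where
  "soft v Z c \<longleftrightarrow> v = hd c \<and> (3 * v + 1 \<in> set Z \<or> 3 * v + 2 \<in> set Z) \<and>
    \<not> (\<exists>x\<in>set c. 3 * x \<in> set Z)"

lemma computes_soft:
  assumes "c \<in> set ps" "length Z \<le> n"
  shows "computes_pow 7 f_soft [nats c, Cell (N v) (nats Z)] (bv (soft v Z c))"
proof -
  have c: "length c \<le> n" "c \<noteq> []"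
    using ps_part assms(1) by blast+
  then obtain x where x: "nats c = Cell (N (hd c)) x" by (cases c) auto
  show ?thesis
    by (rule pow_body[where d = 6])
      (use assms c in \<open>auto simp: run_simps res_pow[OF computes_mem] res_pow[OF computes_any_hard[of c], unfolded x]
        soft_def x\<close>)
qed

lemma computes_any_soft: "length Z \<le> n \<Longrightarrow>
    computes_pow 9 f_any_soft [natss ps, Cell (N v) (nats Z)] (bv (\<exists>c\<in>set ps. soft v Z c))"
  by (rule pow_any[where h = nats, OF nth_any_soft computes_soft])
    (use length_ps in \<open>auto simp: length_prog\<close>)

lemma computes_chosen: "length Z \<le> n \<Longrightarrow> v \<in> V \<Longrightarrow>
    computes_pow 10 f_chosen [N v, Cell (nats Z) (natss ps)] (bv (v \<in> chosen Z))"
  by (rule pow_body[where d = 9])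
    (auto simp: run_simps res_pow[OF computes_hard] res_pow[OF computes_any_soft] chosen_def soft_def)

lemma computes_all_chosen: "length Z \<le> n \<Longrightarrow>
    computes_pow 12 f_all_chosen [nats vs, Cell (nats Z) (natss ps)]
      (nats (List.filter (\<lambda>v. v \<in> chosen Z) vs))"
  by (rule pow_filter[where h = N, OF nth_all_chosen computes_chosen])
    (use n set_vs in \<open>auto simp: length_prog\<close>)

lemma computes_count: "computes_pow 1 f_count [x, N m, y] (N (Suc m))"
  by (rule pow_body[where d = 0]) (simp_all add: run_simps)

lemma computes_length: "length L \<le> n \<Longrightarrow> computes_pow 3 f_length [nats L, N 0, y] (N (length L))"
proof -
  have "List.fold (\<lambda>_. Suc) L m = length L + m" for m
    by (induction L arbitrary: m) simp_all
  then show "length L \<le> n \<Longrightarrow> computes_pow 3 f_length [nats L, N 0, y] (N (length L))"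
    by (intro pow_fold[where h = N and h' = N and f = "\<lambda>_. Suc" and Inv = "\<lambda>_ _. True",
        OF nth_length computes_count]) (auto simp: length_prog)
qed

lemma computes_missed: "p \<in> set ts \<Longrightarrow> set S \<subseteq> V \<Longrightarrow> length S \<le> n \<Longrightarrow>
    computes_pow 18 f_missed [pr p, Cell (nats S) g] (bv (set S \<inter> interval (fst p) (snd p) = {}))"
  by (rule pow_body[where d = 17])
    (use ts_ends[of p] in \<open>auto simp: run_simps case_prod_beta res_pow[OF computes_any_interval]\<close>)

lemma computes_any_missed: "set S \<subseteq> V \<Longrightarrow> length S \<le> n \<Longrightarrow>
    computes_pow 20 f_any_missed [prs ts, Cell (nats S) g] (bv (\<not> hits (set ts) (set S)))"
  by (rule pow_any[where h = pr, OF nth_any_missed computes_missed])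
    (use n in \<open>auto simp: length_prog hits_def case_prod_beta\<close>)

abbreviation ctx :: "nat \<Rightarrow> val" where
  "ctx k \<equiv> Cell (natss (all_opts)) (Cell (natss ps) (Cell (prs ts) (Cell (N k) g)))"

lemma computes_accepts:
  assumes "length Z \<le> n"
  shows "computes_pow 21 f_accepts [nats Z, ctx k] (bv (accepts k Z))"
proof -
  let ?S = "List.filter (\<lambda>v. v \<in> chosen Z) vs"
  have set: "set ?S = chosen Z" using set_vs by (auto simp: chosen_def)
  then have len: "length ?S = card (chosen Z)"
    using distinct_vs by (metis distinct_card distinct_filter)
  have "chosen Z \<subseteq> V" by (auto simp: chosen_def)
  moreover have "length ?S \<le> n"
    by (rule order_trans[OF length_filter_le]) (use n in simp)
  ultimately show ?thesis
    using assms res_pow[OF computes_any_missed[of ?S, unfolded set]] res_pow[OF computes_length[of ?S]]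
    by (intro pow_body[where d = 20])
      (auto simp: run_simps res_pow[OF computes_all_chosen] set len accepts_def)
qed

lemma computes_init: "computes_pow 25 f_init [enc_list [nats vs, prs es, prs ts, N k]] (Cell (N (3 * k)) (ctx k))"
  by (rule pow_body[where d = 24])
    (simp_all add: run_simps res_pow[OF computes_parts] res_pow[OF computes_with_reps] res_pow[OF computes_all_opts])

text \<open>Search and branching call each other, but for a fixed \<open>f\<close> the branching is
  a loop over \<open>ob\<close> that uses the search as a routine of cost \<open>K\<close>. This
  avoids a mutual induction.\<close>

lemma computes_branch:
  assumes "\<And>x. x \<in> set ob \<Longrightarrow> computes prog K f_search [N f, nats (x # Z), c] (bv (Q x))"
  shows "computes prog (length ob * (K + 20) + 5) f_branch [nats ob, nats Z, N f, c]
    (bv (\<exists>x\<in>set ob. Q x))"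
  using assms
proof (induction ob)
  case Nil
  show ?case
    by (rule computes_mono[OF loop_end[OF _ nth_branch[unfolded b_branch_def]]])
      (use Lit[of prog _ 0] in \<open>auto simp: length_prog\<close>)
next
  case (Cons x ob)
  let ?env = "[Cell (N x) (nats ob), nats Z, N f, c]"
  have v: "eval prog ?env (Var 0) (Cell (N x) (nats ob)) 1" "eval prog ?env (Var 1) (nats Z) 1"
    "eval prog ?env (Var 2) (N f) 1" "eval prog ?env (Var 3) c 1"
    using Var[of 0 ?env prog] Var[of 1 ?env prog] Var[of 2 ?env prog] Var[of 3 ?env prog]
    by simp_all
  have sargs: "eval_args prog ?env [Var 2, MkCell (Fst (Var 0)) (Var 1), Var 3]
      [N f, nats (x # Z), c] 6"
    using Args_Cons[OF v(3) Args_Cons[OF MkCell[OF Fst[OF v(1)] v(2)] Args_Cons[OF v(4) Args_Nil]]]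
    by (simp add: eval_nat_numeral)
  have bargs: "eval_args prog ?env [Snd (Var 0), Var 1, Var 2, Var 3] [nats ob, nats Z, N f, c] 5"
    using Args_Cons[OF Snd[OF v(1)] Args_Cons[OF v(2) Args_Cons[OF v(3) Args_Cons[OF v(4) Args_Nil]]]]
    by (simp add: eval_nat_numeral)
  obtain t where t: "t \<le> K" "eval prog ?env
      (Call f_search [Var 2, MkCell (Fst (Var 0)) (Var 1), Var 3]) (bv (Q x)) (6 + t + 1)"
    using call_computes[OF Cons.prems sargs] by auto
  note cell = loop_cell[OF _ nth_branch[unfolded b_branch_def]]
  show ?case
  proof (cases "Q x")
    case True
    then have "bv (Q x) = N 1" by simp
    from computes_mono[OF cell[OF _ If_True[OF t(2)[unfolded this] _ Lit[of prog _ 1]]]] t(1) True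
    show ?thesis by (simp add: length_prog)
  next
    case False
    then have "bv (Q x) = N 0" by simp
    note this[simp]
    have IH: "computes prog (length ob * (K + 20) + 5) f_branch [nats ob, nats Z, N f, c]
        (bv (\<exists>x\<in>set (x # ob). Q x))"
      using Cons False by auto
    obtain s where s: "s \<le> length ob * (K + 20) + 5" "eval prog ?env
        (Call f_branch [Snd (Var 0), Var 1, Var 2, Var 3]) (bv (\<exists>x\<in>set (x # ob). Q x)) (5 + s + 1)"
      using call_computes[OF IH bargs] by auto
    from computes_mono[OF cell[OF _ If_False[OF t(2)[unfolded \<open>bv (Q x) = N 0\<close>] s(2)]]] t(1) s(1)
    show ?thesis by (simp add: length_prog)
  qed
qed

text \<open>One more unit of \<open>f\<close> multiplies the cost by at most
  \<open>100 * Suc b\<close>: a call runs a filter or a leaf test within \<open>n ^ 21\<close> and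
  at most \<open>b\<close> smaller searches, and its own body has size at most 50. The bound on
  \<open>length Z + f\<close> keeps \<open>Z\<close> within \<open>n\<close> down to the
  leaves.\<close>

lemma computes_search:
  assumes b: "\<And>p. p \<in> set ts \<Longrightarrow> length (opts p) \<le> b"
  shows "length Z + f \<le> n \<Longrightarrow> computes prog (n ^ 22 * (100 * Suc b) ^ f) f_search [N f, nats Z, ctx k]
    (bv (search (all_opts) (accepts k) f Z))"
proof (induction f arbitrary: Z)
  case 0
  have "computes_pow 22 f_search [N 0, nats Z, ctx k] (bv (search (all_opts) (accepts k) 0 Z))"
    using 0 short_opts
    by (intro pow_body[where d = 21])
      (auto simp: run_simps res_pow[OF computes_unhits] res_pow[OF computes_accepts] split: list.splits)
  then show ?case by simp
next
  case (Suc f)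
  let ?O = all_opts
  define K where "K = n ^ 22 * (100 * Suc b) ^ f"
  \<comment> \<open>One bound for every routine the body calls: \<open>n ^ 21\<close> for the filter
    and the leaf test, the remaining terms for the branching.\<close>
  define K' where "K' = n ^ 21 + b * (K + 20) + 5"
  have Z: "length Z \<le> n" using Suc.prems by simp
  have n21: "n ^ 9 \<le> n ^ 21" "1 \<le> n ^ 21" using n by (auto intro: power_increasing)
  have r1: "res prog K' f_unhits [natss ?O, nats Z] = Some (natss (unhit ?O Z))"
    unfolding res_Some
    by (rule computes_mono[OF computes_unhits[OF short_opts Z]]) (use n21 in \<open>simp add: K'_def\<close>)
  have r2: "res prog K' f_accepts [nats Z, ctx k] = Some (bv (accepts k Z))"
    unfolding res_Some
    by (rule computes_mono[OF computes_accepts[OF Z]]) (simp add: K'_def)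
  have r3: "res prog K' f_branch [nats ob, nats Z, N f, ctx k] =
      Some (bv (\<exists>x\<in>set ob. search ?O (accepts k) f (x # Z)))" if "unhit ?O Z = ob # obs" for ob obs
  proof -
    have "ob \<in> set ?O" using that using filter_eq_ConsD[of _ ?O] unfolding unhit_def by fastforce
    then have len: "length ob \<le> b" using b by (auto simp: all_opts_def)
    have "computes prog (length ob * (K + 20) + 5) f_branch [nats ob, nats Z, N f, ctx k]
      (bv (\<exists>x\<in>set ob. search ?O (accepts k) f (x # Z)))"
    proof (rule computes_branch)
      show "computes prog K f_search [N f, nats (x # Z), ctx k]
          (bv (search ?O (accepts k) f (x # Z)))" for x
        unfolding K_def by (rule Suc.IH) (use Suc.prems in simp)
    qed
    moreover have "length ob * (K + 20) + 5 \<le> K'"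
      using mult_le_mono1[OF len, of "K + 20"] unfolding K'_def by linarith
    ultimately show ?thesis unfolding res_Some by (rule computes_mono)
  qed
  have "computes prog (50 * Suc K') f_search [N (Suc f), nats Z, ctx k]
      (bv (search ?O (accepts k) (Suc f) Z))"
  proof (rule computes_den)
    show "den prog K' [N (Suc f), nats Z, ctx k] (prog ! f_search) =
        Some (bv (search ?O (accepts k) (Suc f) Z))"
      using r3 by (cases "unhit ?O Z") (simp_all add: run_simps r1 r2)
  qed (simp_all add: run_simps)
  moreover have "50 * Suc K' \<le> n ^ 22 * (100 * Suc b) ^ Suc f"
  proof -
    have "1 \<le> (100 * Suc b) ^ f" by simp
    then have K1: "n ^ 22 \<le> K" unfolding K_def by simp
    have n22: "200 * n ^ 21 \<le> n ^ 22"
      using mult_le_mono1[OF n(1), of "n ^ 21"] power_Suc[of n 21] by simp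
    have "200 * 1 \<le> 200 * n ^ 21" using n21 by simp
    then have K2: "200 \<le> K" using n22 K1 by linarith
    have "50 * Suc K' = 50 * n ^ 21 + 50 * b * K + 1000 * b + 300"
      by (simp add: K'_def algebra_simps)
    also have "\<dots> \<le> K + 50 * b * K + 5 * b * K + 2 * K"
    proof -
      have "5 * b * 200 \<le> 5 * b * K" using K2 by (rule mult_le_mono2)
      then show ?thesis using K1 K2 n22 by linarith
    qed
    also have "\<dots> \<le> K * (100 * Suc b)" by (simp add: algebra_simps)
    finally show ?thesis by (simp add: K_def algebra_simps)
  qed
  ultimately show ?case by (rule computes_mono)
qed

end

section \<open>Separating the parameter from the input size\<close>

section \<open>The parameterized running time\<close>

lemma computes_runs:
  assumes "computes P K 0 [x] y"
  shows "\<exists>t\<le>K + 2. runs P x y t"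
proof -
  obtain t where t: "0 < length P" "t \<le> K" "eval P [x] (P ! 0) y t"
    using assms by (auto simp: computes_def)
  have "eval P [x] (Var 0) x 1" using Var[of 0 "[x]" P] by simp
  from Call[OF t(1) Args_Cons[OF this Args_Nil] t(3)] show ?thesis
    unfolding runs_def using t(2) by (intro exI[of _ "1 + 0 + t + 1"]) auto
qed

text \<open>Function 1 computes a power of two by repeated doubling; function 0 applies it twice. No
  multiplication is required.\<close>

definition tower_prog :: prog where
  "tower_prog = [Call 1 [Call 1 [Add (Var 0) (Lit 8)]],
    IfNonzero (Var 0) (LetIn (Call 1 [Sub (Var 0) (Lit 1)]) (Add (Var 0) (Var 0))) (Lit 1)]"

lemma tower_nth:
  "length tower_prog = 2"
  "tower_prog ! 0 = Call 1 [Call 1 [Add (Var 0) (Lit 8)]]"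
  "tower_prog ! 1 =
    IfNonzero (Var 0) (LetIn (Call 1 [Sub (Var 0) (Lit 1)]) (Add (Var 0) (Var 0))) (Lit 1)"
  by (simp_all add: tower_prog_def)

lemma computable_tower: "computable (\<lambda>m. 2 ^ 2 ^ (m + 8))"
proof -
  have pow: "\<exists>K. computes tower_prog K 1 [N m] (N (2 ^ m))" for m
  proof (induction m)
    case 0
    have "den tower_prog 0 [N 0] (tower_prog ! 1) = Some (N (2 ^ 0))"
      unfolding tower_nth by simp
    then show ?case
      using computes_den[OF _ _ order_refl] by (metis tower_nth(1) one_less_numeral_iff semiring_norm(76))
  next
    case (Suc m)
    then obtain K where "res tower_prog K 1 [N m] = Some (N (2 ^ m))"
      by (auto simp: res_Some)
    then have "den tower_prog K [N (Suc m)] (tower_prog ! 1) = Some (N (2 ^ Suc m))"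
      unfolding tower_nth by simp
    then show ?case
      using computes_den[OF _ _ order_refl] by (metis tower_nth(1) one_less_numeral_iff semiring_norm(76))
  qed
  have "\<exists>t. runs tower_prog (N m) (N (2 ^ 2 ^ (m + 8))) t" for m
  proof -
    obtain K1 K2 where K: "computes tower_prog K1 1 [N (m + 8)] (N (2 ^ (m + 8)))"
      "computes tower_prog K2 1 [N (2 ^ (m + 8))] (N (2 ^ 2 ^ (m + 8)))"
      using pow by meson
    define K where "K = K1 + K2"
    have "computes tower_prog K 1 [N (m + 8)] (N (2 ^ (m + 8)))"
      by (rule computes_mono[OF K(1)]) (simp add: K_def)
    moreover have "computes tower_prog K 1 [N (2 ^ (m + 8))] (N (2 ^ 2 ^ (m + 8)))"
      by (rule computes_mono[OF K(2)]) (simp add: K_def)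
    ultimately have "den tower_prog K [N m] (tower_prog ! 0) = Some (N (2 ^ 2 ^ (m + 8)))"
      unfolding res_Some[symmetric] tower_nth by simp
    from computes_den[OF _ this order_refl]
    have "computes tower_prog (esize (tower_prog ! 0) * Suc K) 0 [N m] (N (2 ^ 2 ^ (m + 8)))"
      by (simp only: tower_nth(1) zero_less_numeral)
    then show ?thesis using computes_runs by blast
  qed
  then show ?thesis unfolding computable_def by blast
qed

text \<open>The left side is the exponent of 2 collected in the final estimate. Since 207 is below
  \<open>2 ^ 8\<close>, a tower starting at \<open>m + 8\<close> is high enough.\<close>

lemma quadratic_le_exp: "3 * m\<^sup>2 + 52 * m + 207 \<le> 207 * 2 ^ (m :: nat)"
proof (induction m)
  case (Suc m)
  have "3 * (Suc m)\<^sup>2 + 52 * Suc m + 207 \<le> 2 * (3 * m\<^sup>2 + 52 * m + 207)"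
    by (simp add: power2_eq_square)
  then show ?case using Suc by simp
qed simp

lemma le_exp: "2 ^ c * Suc m \<le> 2 ^ (c + m)"
proof -
  have "Suc m \<le> 2 ^ m" by (induction m) auto
  then show ?thesis unfolding power_add by (rule mult_le_mono2)
qed

text \<open>The input size is pulled out of \<open>200 + s + 3 * k\<close>, which is at most
  \<open>256 * Suc (k + w) * s\<close>; everything else is rounded up to a power of two in
  \<open>k + w\<close>, with \<open>2 ^ 7\<close> for the factor 100 and \<open>2 ^ 9\<close> for
  the base of the branching.\<close>

lemma running_time_bound:
  fixes k w s :: nat
  assumes "1 \<le> s"
  shows "100 * ((200 + s + 3 * k) ^ 25 * (100 * Suc (2 + w)) ^ (3 * k)) \<le> 2 ^ 2 ^ ((k + w) + 8) * s ^ 25"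
proof -
  let ?m = "k + w"
  have "200 + s + 3 * k \<le> 256 * Suc ?m * s"
  proof -
    have "200 + s + 3 * k \<le> 256 * Suc ?m + s - 1"
      by simp
    also have "\<dots> \<le> 256 * Suc ?m * s"
      using assms by (cases s) auto
    finally show ?thesis .
  qed
  also have "\<dots> \<le> 2 ^ (8 + ?m) * s"
    using mult_le_mono1[OF le_exp[of 8 ?m]] by simp
  finally have 1: "(200 + s + 3 * k) ^ 25 \<le> (2 ^ (8 + ?m) * s) ^ 25"
    by (rule power_mono) simp
  have "100 * Suc (2 + w) \<le> 2 ^ 9 * Suc ?m" by simp
  also have "\<dots> \<le> 2 ^ (9 + ?m)"
    by (rule le_exp)
  finally have "(100 * Suc (2 + w)) ^ (3 * k) \<le> (2 ^ (9 + ?m)) ^ (3 * k)"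
    by (rule power_mono) simp
  also have "\<dots> \<le> (2 ^ (9 + ?m)) ^ (3 * ?m)"
    by (rule power_increasing) auto
  finally have 2: "(100 * Suc (2 + w)) ^ (3 * k) \<le> (2 ^ (9 + ?m)) ^ (3 * ?m)" .
  have "100 * ((200 + s + 3 * k) ^ 25 * (100 * Suc (2 + w)) ^ (3 * k)) \<le>
      2 ^ 7 * ((2 ^ (8 + ?m) * s) ^ 25 * (2 ^ (9 + ?m)) ^ (3 * ?m))"
    by (intro mult_mono 1 2) auto
  also have "\<dots> = 2 ^ 7 * (2 ^ ((8 + ?m) * 25) * s ^ 25 * 2 ^ ((9 + ?m) * (3 * ?m)))"
    by (simp only: power_mult_distrib power_mult)
  also have "\<dots> = 2 ^ (7 + (8 + ?m) * 25 + (9 + ?m) * (3 * ?m)) * s ^ 25"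
    by (simp only: power_add mult_ac)
  also have "7 + (8 + ?m) * 25 + (9 + ?m) * (3 * ?m) = 3 * ?m\<^sup>2 + 52 * ?m + 207"
    by (simp add: power2_eq_square algebra_simps)
  also have "(2 :: nat) ^ (3 * ?m\<^sup>2 + 52 * ?m + 207) * s ^ 25 \<le> 2 ^ 2 ^ (?m + 8) * s ^ 25"
  proof -
    have "207 * 2 ^ ?m \<le> (2 :: nat) ^ (?m + 8)" by (simp add: power_add)
    then show ?thesis
      using quadratic_le_exp[of ?m] by (intro mult_right_mono power_increasing) auto
  qed
  finally show ?thesis .
qed

lemma length_le_val_size: "length L \<le> val_size (enc_list L)"
  by (induction L) auto

lemma val_size_pos: "1 \<le> val_size x"
  by (induction x) auto

lemma lists_pairs_iff:
  assumes "lists_pairs ps A"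
  shows "{u, v} \<in> A \<longleftrightarrow> (u, v) \<in> set ps \<or> (v, u) \<in> set ps"
proof
  have A: "A = (\<lambda>(u, v). {u, v}) ` set ps"
    using assms by (simp add: lists_pairs_def)
  show "{u, v} \<in> A \<Longrightarrow> (u, v) \<in> set ps \<or> (v, u) \<in> set ps"
    unfolding A by (auto simp: doubleton_eq_iff)
  show "(u, v) \<in> set ps \<or> (v, u) \<in> set ps \<Longrightarrow> {u, v} \<in> A"
    unfolding A by (auto simp: image_iff doubleton_eq_iff Bex_def)
qed

lemma fixed_parameter_time:
  assumes enc: "hgi_encodes (G, T, k) x"
  shows "\<exists>t \<le> 2 ^ 2 ^ (k + modular_width G + 8) * val_size x ^ 25.
    runs prog x (N (if hgi_yes (G, T, k) then 1 else 0)) t"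
proof -
  obtain vs es ts where inst: "hgi_instance (G, T, k)" and vs: "distinct vs" "set vs = verts G"
    and es: "lists_pairs es (edges G)" and ts: "lists_pairs ts T"
    and x: "x = enc_list [enc_list (map N vs), enc_pairs es, enc_pairs ts, N k]"
    using enc by (auto simp: hgi_encodes_def)
  \<comment> \<open>The token list may reach length \<open>3 * k\<close>, and \<open>k\<close> is
    written in binary, so this length is not polynomial in the input size;
    \<open>running_time_bound\<close> charges it to the parameter.\<close>
  define n where "n = 200 + val_size x + 3 * k"
  have T: "{u, v} \<in> T \<longleftrightarrow> (u, v) \<in> set ts \<or> (v, u) \<in> set ts" for u v
    by (rule lists_pairs_iff[OF ts])
  have E: "{u, v} \<in> edges G \<longleftrightarrow> (u, v) \<in> set es \<or> (v, u) \<in> set es" for u v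
    by (rule lists_pairs_iff[OF es])
  have ts_V: "set ts \<subseteq> verts G \<times> verts G"
  proof
    fix p
    assume "p \<in> set ts"
    moreover obtain u v where p: "p = (u, v)" by (cases p)
    ultimately have "{u, v} \<in> T" using T by blast
    then obtain u' v' where "u' \<in> verts G" "v' \<in> verts G" "{u, v} = {u', v'}"
      using inst by (auto simp: hgi_instance_def)
    then show "p \<in> verts G \<times> verts G" using p by (auto simp: doubleton_eq_iff)
  qed
  interpret fin_graph G
    by unfold_locales (use inst in \<open>simp add: hgi_instance_def\<close>)
  interpret program_run G vs ts es n
  proof unfold_locales
    show "adj a b \<longleftrightarrow> (a, b) \<in> set es \<or> (b, a) \<in> set es" for a b
      by (simp add: adj_def E)
    show "200 \<le> n" by (simp add: n_def)
    show "length vs + 2 \<le> n" "length es \<le> n" "length ts \<le> n"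
      using length_le_val_size[of "map N vs"]
        length_le_val_size[of "map (\<lambda>(u, v). Cell (N u) (N v)) es"]
        length_le_val_size[of "map (\<lambda>(u, v). Cell (N u) (N v)) ts"]
      by (simp_all add: n_def x enc_pairs_def)
  qed (use vs ts_V in auto)
  \<comment> \<open>\<open>T\<close> consists of unordered pairs whereas \<open>ts\<close> fixes an
    orientation; the symmetry of intervals reconciles them.\<close>
  have yes: "hgi_yes (G, T, k) \<longleftrightarrow> search all_opts (accepts k) (3 * k) []"
  proof -
    have "hits (set ts) S \<longleftrightarrow> S \<subseteq> V \<and> (\<forall>u v. {u, v} \<in> T \<longrightarrow> S \<inter> interval u v \<noteq> {})" for S
      using ts_V interval_commute by (fastforce simp: hits_def T)
    then show ?thesis
      unfolding all_opts_def search_iff by (auto simp: hgi_yes_def)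
  qed
  define b where "b = 2 + modular_width G"
  have b: "length (opts p) \<le> b" if "p \<in> set ts" for p
    using length_opts ts_V that by (cases p) (auto simp: b_def)
  define K where "K = n ^ 25 * (100 * Suc b) ^ (3 * k)"
  have one: "1 \<le> (100 * Suc b) ^ (3 * k)" "1 \<le> n ^ 25" using n(1) by simp_all
  have pows: "n ^ 22 \<le> n ^ 25" using n(1) by (intro power_increasing) auto
  have "computes prog K f_init [x] (Cell (N (3 * k)) (ctx k))"
    unfolding x enc_pairs_def
    by (rule computes_mono[OF computes_init]) (use one in \<open>simp add: K_def\<close>)
  moreover have "computes prog K f_search [N (3 * k), N 0, ctx k] (bv (hgi_yes (G, T, k)))"
    unfolding yes
    using computes_mono[OF computes_search[OF b, of "[]" "3 * k" k], of K] pows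
    by (simp add: n_def K_def)
  ultimately have "den prog K [x] (prog ! 0) = Some (bv (hgi_yes (G, T, k)))"
    unfolding res_Some[symmetric] by (simp add: nth_main b_main_def)
  then have "computes prog (20 * Suc K) 0 [x] (bv (hgi_yes (G, T, k)))"
    by (rule computes_den[rotated]) (simp_all add: nth_main b_main_def length_prog)
  then obtain t where t: "t \<le> 20 * Suc K + 2" "runs prog x (bv (hgi_yes (G, T, k))) t"
    using computes_runs by blast
  have "1 \<le> K" using one mult_le_mono[OF one] by (simp add: K_def mult.commute)
  then have "t \<le> 100 * K" using t(1) by simp
  also have "\<dots> \<le> 2 ^ 2 ^ (k + modular_width G + 8) * val_size x ^ 25"
    unfolding K_def b_def n_def by (rule running_time_bound) (rule val_size_pos)
  finally show ?thesis
    using t(2) by (auto simp: of_bool_def)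
qed

theorem theorem5:
  "fixed_parameter_tractable hgi_encodes hgi_yes (\<lambda>(G, T, k). k + modular_width G)"
  unfolding fixed_parameter_tractable_def
proof (rule exI[of _ prog], rule exI[of _ "\<lambda>m. 2 ^ 2 ^ (m + 8)"], rule exI[of _ 25], intro conjI allI impI)
  show "computable (\<lambda>m. 2 ^ 2 ^ (m + 8))" by (rule computable_tower)
next
  fix I x
  assume "hgi_encodes I x"
  then show "\<exists>t\<le>2 ^ 2 ^ ((case I of (G, T, k) \<Rightarrow> k + modular_width G) + 8) * val_size x ^ 25.
      runs prog x (N (if hgi_yes I then 1 else 0)) t"
    using fixed_parameter_time by (cases I) auto
qed

end
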